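(* Let $U=SC$ and $U_0=SC_0$ be as in the context and assume (A.1). Then the strong limit \[ W_+=\operatorname{s-lim}_{t\to\infty,\ t\in\mathbb{N}} U^{-t}U_0^t\,\Pi_{\rm ac}(U_0) \] exists, and it is complete, i.e. the strong limit $\operatorname{s-lim}_{t\to\infty}U_0^{-t}U^t\,\Pi_{\rm ac}(U)$ also exists (and equals $W_+^*$), so that $W_+$ is a unitary map from $\operatorname{Ran}\Pi_{\rm ac}(U_0)$ onto $\operatorname{Ran}\Pi_{\rm ac}(U)$.
   Context: $\mathcal{H}=\ell^2(\mathbb{Z};\mathbb{C}^2)$. The shift $S$ is $(S\Psi)(x)=(\Psi^{(0)}(x+1),\Psi^{(1)}(x-1))^T$. For $\{C(x)\}_{x\in\mathbb{Z}}\subset U(2)$, $(C\Psi)(x)=C(x)\Psi(x)$ and $U=SC$; for $C_0\in U(2)$, $U_0=SC_0$ (constant coin). Condition (A.1): there exist $c_1>0$, $\epsilon>0$ such that $\|C(x)-C_0\|\le c_1|x|^{-1-\epsilon}$ for all $x\neq0$ (matrix operator norm). For a unitary operator $V$, $\Pi_{\rm ac}(V)$ denotes the orthogonal projection onto the absolutely continuous subspace of $V$. *)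

theory Defs
  imports "HOL-Analysis.Analysis"
begin

text \<open>Elements of the Hilbert space l2(Z;C^2) are represented as functions
  int => complex^2 that are square summable. Component 0 of the paper is
  index 1, component 1 of the paper is index 2.\<close>

type_synonym state = "int \<Rightarrow> complex^2"

definition ell2 :: "state set" where
  "ell2 = {\<psi>. (\<lambda>x. (norm (\<psi> x))\<^sup>2) summable_on UNIV}"

definition l2inner :: "state \<Rightarrow> state \<Rightarrow> complex" where
  "l2inner \<phi> \<psi> = infsum (\<lambda>x. \<Sum>j\<in>UNIV. cnj (\<phi> x $ j) * (\<psi> x $ j)) UNIV"

definition l2norm :: "state \<Rightarrow> real" where
  "l2norm \<psi> = sqrt (infsum (\<lambda>x. (norm (\<psi> x))\<^sup>2) UNIV)"

definition l2lim :: "(nat \<Rightarrow> state) \<Rightarrow> state \<Rightarrow> bool" where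
  "l2lim f \<phi> \<longleftrightarrow> \<phi> \<in> ell2 \<and> (\<lambda>t. l2norm (f t - \<phi>)) \<longlonglongrightarrow> 0"

definition adjm :: "complex^2^2 \<Rightarrow> complex^2^2" where
  "adjm A = (\<chi> i j. cnj (A $ j $ i))"

definition unitary2 :: "complex^2^2 \<Rightarrow> bool" where
  "unitary2 A \<longleftrightarrow> adjm A ** A = mat 1 \<and> A ** adjm A = mat 1"

definition shift_op :: "state \<Rightarrow> state" where
  "shift_op \<psi> = (\<lambda>x. vector [\<psi> (x + 1) $ 1, \<psi> (x - 1) $ 2])"

definition shift_inv :: "state \<Rightarrow> state" where
  "shift_inv \<psi> = (\<lambda>x. vector [\<psi> (x - 1) $ 1, \<psi> (x + 1) $ 2])"

definition coin_op :: "(int \<Rightarrow> complex^2^2) \<Rightarrow> state \<Rightarrow> state" where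
  "coin_op C \<psi> = (\<lambda>x. C x *v \<psi> x)"

definition qw :: "(int \<Rightarrow> complex^2^2) \<Rightarrow> state \<Rightarrow> state" where
  "qw C = shift_op \<circ> coin_op C"

definition qw_inv :: "(int \<Rightarrow> complex^2^2) \<Rightarrow> state \<Rightarrow> state" where
  "qw_inv C = coin_op (\<lambda>x. adjm (C x)) \<circ> shift_inv"

text \<open>Absolutely continuous subspace of a unitary V: those psi whose spectral
  measure mu_psi on the circle (parametrised by [0,2pi)), i.e. the finite Borel
  measure with <psi, V^n psi> = int e^{i n theta} d mu_psi(theta) for n >= 0
  (which determines mu_psi uniquely), is absolutely continuous w.r.t. Lebesgue.\<close>
definition ac_subspace :: "(state \<Rightarrow> state) \<Rightarrow> state set" where
  "ac_subspace V = {\<psi> \<in> ell2. \<exists>\<mu>. sets \<mu> = sets borel \<and> finite_measure \<mu> \<and>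
      emeasure \<mu> (- {0..<2*pi}) = 0 \<and> absolutely_continuous lborel \<mu> \<and>
      (\<forall>n::nat. l2inner \<psi> ((V ^^ n) \<psi>) =
          integral\<^sup>L \<mu> (\<lambda>\<theta>::real. exp (\<i> * of_nat n * of_real \<theta>)))}"

definition proj_onto :: "state set \<Rightarrow> state \<Rightarrow> state" where
  "proj_onto A \<psi> = (THE \<phi>. \<phi> \<in> A \<and> (\<forall>\<eta>\<in>A. l2inner \<eta> (\<psi> - \<phi>) = 0))"

end

theory Submission
  imports Defs
begin

text \<open>
  The operator \<open>U - U0\<close> is of trace class because \<open>\<parallel>C x - C0\<parallel>\<close> is summable, so this is a case of the
  Kato-Rosenblum theorem for unitary operators.

  For a unitary \<open>V\<close>, call \<open>\<psi>\<close> a Bessel vector if \<open>\<Sum>n. |\<langle>\<phi>, V\<^sup>n \<psi>\<rangle>|\<^sup>2 \<le> B \<parallel>\<phi>\<parallel>\<^sup>2\<close> for all \<open>\<phi>\<close>. The absolutely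
  continuous subspace is the closure of the Bessel vectors. If the spectral measure of \<open>\<psi>\<close> has density
  \<open>F\<close>, then the vectors \<open>1(F \<le> k)(V) \<psi>\<close>, obtained from the Riesz representation theorem, are Bessel
  vectors converging to \<open>\<psi>\<close>. Conversely, the Fejer means
  \<open>\<parallel>\<Sum>j<N. e\<^bsup>-ij\<theta>\<^esup> V\<^sup>j \<psi>\<parallel>\<^sup>2 / (2 \<pi> N)\<close> depend on \<open>\<psi>\<close> Lipschitz continuously in \<open>L\<^sup>1\<close>, uniformly in \<open>N\<close>, and
  converge in \<open>L\<^sup>1\<close> for Bessel vectors by Parseval; hence they converge to a density for every vector in
  the closure.

  For a Bessel vector \<open>\<psi>\<close> of \<open>U0\<close> the waves \<open>U\<^sup>-\<^sup>t U0\<^sup>t \<psi>\<close> form a Cauchy sequence by Pearson's argument: with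
  \<open>t = s + m\<close> the overlap \<open>\<langle>U0\<^sup>n\<^sup>+\<^sup>t \<psi>, U\<^sup>m U0\<^sup>n\<^sup>+\<^sup>s \<psi>\<rangle>\<close> tends to \<open>\<parallel>\<psi>\<parallel>\<^sup>2\<close> as \<open>n\<close> grows, and the sum of its increments
  over \<open>n\<close> is small for large \<open>s\<close>, uniformly in \<open>m\<close>, because a Hilbert-Schmidt operator maps Bessel sequences to square
  summable ones. Completeness follows by exchanging \<open>U\<close> and \<open>U0\<close>, since wave limits of Bessel vectors are
  Bessel vectors.
\<close>

text \<open>The definition of the absolutely continuous subspace speaks only of the moments of some
  measure. That the subspace is linear and closed does not follow directly from it, yet both are
  required before the orthogonal projection onto it makes sense. The description by Bessel vectors
  supplies both and is stable under the limits defining the wave operators, so no projection-valued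
  spectral measure has to be constructed.

  Bessel orbits suit the trace class method because a unitary map applied to such an orbit changes
  neither the Bessel property nor its bound. Estimates along the orbit are therefore uniform in the
  number of perturbed steps already made. A general vector of the subspace comes without such a
  bound; it is reached by density, since all waves are isometries.

  The exponent \<open>-1 - \<epsilon>\<close> enters only through summability over the sites.
  Because \<open>S C - S C0 = S (C - C0)\<close> and \<open>S\<close> is unitary, the perturbation
  acts site by site up to a shift, and the square root of the local norm
  \<open>\<parallel>C x - C0\<parallel>\<close> can be given to each of the two Hilbert-Schmidt
  factors.\<close>

class complex_hilbert = real_inner + complete_space +
  fixes scaleC :: "complex \<Rightarrow> 'a \<Rightarrow> 'a"  (infixr "*\<^sub>C" 75)
    and cinner :: "'a \<Rightarrow> 'a \<Rightarrow> complex"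
  assumes cinner_add_right: "cinner x (y + z) = cinner x y + cinner x z"
    and cinner_scaleC_right: "cinner x (a *\<^sub>C y) = a * cinner x y"
    and cinner_commute: "cinner x y = cnj (cinner y x)"
    and Re_cinner: "Re (cinner x y) = inner x y"

section \<open>Algebra and continuity of the complex inner product\<close>

lemma cinner_add_left: "cinner (x + y) z = cinner x z + cinner y z"
  by (metis cinner_add_right cinner_commute complex_cnj_add)

lemma cinner_scaleC_left: "cinner (a *\<^sub>C x) y = cnj a * cinner x y"
  by (metis cinner_commute cinner_scaleC_right complex_cnj_mult)

lemma cinner_zero_right [simp]: "cinner x 0 = 0"
  using cinner_add_right[of x 0 0] by simp

lemma cinner_zero_left [simp]: "cinner 0 x = 0"
  using cinner_add_left[of 0 0 x] by simp

lemma cinner_minus_right: "cinner x (- y) = - cinner x y"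
  using cinner_add_right[of x y "- y"] by (simp add: eq_neg_iff_add_eq_0 add.commute)

lemma cinner_minus_left: "cinner (- x) y = - cinner x y"
  using cinner_add_left[of x "- x" y] by (simp add: eq_neg_iff_add_eq_0 add.commute)

lemma cinner_diff_right: "cinner x (y - z) = cinner x y - cinner x z"
  using cinner_add_right[of x y "- z"] by (simp add: cinner_minus_right)

lemma cinner_diff_left: "cinner (x - y) z = cinner x z - cinner y z"
  using cinner_add_left[of x "- y" z] by (simp add: cinner_minus_left)

lemma cinner_sum_right: "cinner x (\<Sum>i\<in>I. f i) = (\<Sum>i\<in>I. cinner x (f i))"
  by (induction I rule: infinite_finite_induct) (auto simp: cinner_add_right)

lemma cinner_sum_left: "cinner (\<Sum>i\<in>I. f i) x = (\<Sum>i\<in>I. cinner (f i) x)"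
  by (induction I rule: infinite_finite_induct) (auto simp: cinner_add_left)

lemma cinner_self: "cinner x x = complex_of_real ((norm x)\<^sup>2)"
proof (rule complex_eqI)
  show "Im (cinner x x) = Im (complex_of_real ((norm x)\<^sup>2))"
    using arg_cong[OF cinner_commute[of x x], of Im] by simp
qed (simp add: Re_cinner power2_norm_eq_inner)

lemma Im_cinner: "Im (cinner x y) = inner (\<i> *\<^sub>C x) y"
  by (simp add: Re_cinner[symmetric] cinner_scaleC_left)

text \<open>Nondegeneracy stands in for the module axioms of \<open>scaleC\<close>, which the class
  does not contain: the laws below become identities of complex numbers once they are paired with an
  arbitrary vector.\<close>

lemma cinner_ext:
  assumes "\<And>z. cinner z x = cinner z y" shows "x = y"
proof -
  have "cinner (x - y) (x - y) = 0"
    using assms by (simp add: cinner_diff_right)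
  then show ?thesis by (simp add: cinner_self)
qed

lemma scaleC_of_real: "complex_of_real r *\<^sub>C x = r *\<^sub>R x"
proof -
  have *: "inner z (complex_of_real r *\<^sub>C x) = inner z (r *\<^sub>R x)" for z
    by (simp add: Re_cinner[symmetric] cinner_scaleC_right) (simp add: Re_cinner)
  have "inner (complex_of_real r *\<^sub>C x - r *\<^sub>R x) (complex_of_real r *\<^sub>C x - r *\<^sub>R x) = 0"
    unfolding inner_diff_right * by simp
  then show ?thesis by simp
qed

lemma scaleC_add_right: "a *\<^sub>C (x + y) = a *\<^sub>C x + a *\<^sub>C y"
  by (rule cinner_ext) (simp add: cinner_add_right cinner_scaleC_right algebra_simps)

lemma scaleC_diff_right: "a *\<^sub>C (x - y) = a *\<^sub>C x - a *\<^sub>C y"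
  by (rule cinner_ext) (simp add: cinner_diff_right cinner_scaleC_right algebra_simps)

lemma scaleC_scaleC: "a *\<^sub>C b *\<^sub>C x = (a * b) *\<^sub>C x"
  by (rule cinner_ext) (simp add: cinner_scaleC_right algebra_simps)

lemma scaleC_one [simp]: "1 *\<^sub>C x = x"
  by (rule cinner_ext) (simp add: cinner_scaleC_right)

lemma scaleC_zero_left [simp]: "0 *\<^sub>C x = 0"
  by (rule cinner_ext) (simp add: cinner_scaleC_right)

lemma norm_scaleC: "norm (a *\<^sub>C x) = cmod a * norm x"
proof -
  have "complex_of_real ((norm (a *\<^sub>C x))\<^sup>2) = complex_of_real ((cmod a * norm x)\<^sup>2)"
    unfolding cinner_self[symmetric] cinner_scaleC_left cinner_scaleC_right
    by (simp add: cinner_self power_mult_distrib mult.assoc[symmetric] complex_norm_square[symmetric] mult.commute[of "cnj a"])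
  then have "(norm (a *\<^sub>C x))\<^sup>2 = (cmod a * norm x)\<^sup>2"
    using of_real_eq_iff by blast
  then show ?thesis
    by (simp add: power2_eq_iff_nonneg)
qed

lemma norm_cinner_le: "cmod (cinner x y) \<le> norm x * norm y"
proof (cases "cinner x y = 0")
  case False
  \<comment> \<open>This phase rotates \<open>y\<close> so that the pairing equals its own modulus;
    the real Cauchy-Schwarz inequality then applies.\<close>
  define a where "a = cnj (cinner x y) / cmod (cinner x y)"
  have a: "cmod a = 1"
    using False by (simp add: a_def norm_divide)
  have "a * cinner x y = cmod (cinner x y)"
    using False complex_norm_square[of "cinner x y"]
    by (simp add: a_def divide_eq_eq mult.commute) (simp add: power2_eq_square)
  then have "cinner x (a *\<^sub>C y) = cmod (cinner x y)"
    by (simp add: cinner_scaleC_right)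
  then have "cmod (cinner x y) = inner x (a *\<^sub>C y)"
    by (metis Re_cinner Re_complex_of_real)
  also have "\<dots> \<le> norm x * norm y"
    using norm_cauchy_schwarz[of x "a *\<^sub>C y"] a by (simp add: norm_scaleC)
  finally show ?thesis .
qed auto

lemma tendsto_cinner:
  fixes l m :: "'a::complex_hilbert"
  assumes "(f \<longlongrightarrow> l) F" "(g \<longlongrightarrow> m) F"
  shows "((\<lambda>x. cinner (f x) (g x)) \<longlongrightarrow> cinner l m) F"
proof -
  have e: "cinner x y = Complex (inner x y) (inner (\<i> *\<^sub>C x) y)" for x y :: 'a
    by (simp add: complex_eq_iff Re_cinner Im_cinner)
  have "((\<lambda>x. \<i> *\<^sub>C f x) \<longlongrightarrow> \<i> *\<^sub>C l) F"
    using assms(1) unfolding tendsto_dist_iff[of f] tendsto_dist_iff[of "\<lambda>x. \<i> *\<^sub>C f x"]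
    by (simp add: dist_norm scaleC_diff_right[symmetric] norm_scaleC)
  then show ?thesis
    unfolding e using assms by (intro tendsto_Complex tendsto_inner)
qed

lemma tendsto_scaleC:
  fixes l :: "'a::complex_hilbert"
  assumes "(f \<longlongrightarrow> l) F"
  shows "((\<lambda>x. a *\<^sub>C f x) \<longlongrightarrow> a *\<^sub>C l) F"
proof -
  have "((\<lambda>x. cmod a * dist (f x) l) \<longlongrightarrow> cmod a * 0) F"
    using assms by (intro tendsto_mult_left) (simp add: tendsto_dist_iff[of f])
  then show ?thesis
    by (subst tendsto_dist_iff) (simp add: dist_norm scaleC_diff_right[symmetric] norm_scaleC)
qed

section \<open>Unitary operators and Bessel vectors\<close>

definition unitary :: "('a::complex_hilbert \<Rightarrow> 'a) \<Rightarrow> bool" where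
  "unitary V \<longleftrightarrow> surj V \<and> (\<forall>x y. cinner (V x) (V y) = cinner x y)"

lemma unitary_cinner: "unitary V \<Longrightarrow> cinner (V x) (V y) = cinner x y"
  and unitary_surj: "unitary V \<Longrightarrow> surj V"
  by (auto simp: unitary_def)

lemma unitary_inner: "unitary V \<Longrightarrow> inner (V x) (V y) = inner x y"
  by (simp only: Re_cinner[symmetric] unitary_cinner)

lemma unitary_norm: "unitary V \<Longrightarrow> norm (V x) = norm x"
  by (simp only: norm_eq_sqrt_inner unitary_inner)

text \<open>By surjectivity every test vector is some \<open>V w\<close>, and pairing with it
  removes \<open>V\<close> from both sides. Linearity is thus a consequence of preserving the inner
  product.\<close>

lemma unitary_add: assumes "unitary V" shows "V (x + y) = V x + V y"
proof (rule cinner_ext)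
  fix z obtain w where "z = V w" using surjD[OF unitary_surj[OF assms]] by blast
  then show "cinner z (V (x + y)) = cinner z (V x + V y)"
    by (simp add: cinner_add_right unitary_cinner[OF assms])
qed

lemma unitary_scaleC: assumes "unitary V" shows "V (a *\<^sub>C x) = a *\<^sub>C V x"
proof (rule cinner_ext)
  fix z obtain w where "z = V w" using surjD[OF unitary_surj[OF assms]] by blast
  then show "cinner z (V (a *\<^sub>C x)) = cinner z (a *\<^sub>C V x)"
    by (simp add: cinner_scaleC_right unitary_cinner[OF assms])
qed

lemma unitary_diff: assumes "unitary V" shows "V (x - y) = V x - V y"
  using unitary_add[OF assms, of "x - y" y] by simp

lemma unitary_zero: assumes "unitary V" shows "V 0 = 0"
  using unitary_diff[OF assms, of 0 0] by simp

lemma unitary_inj: assumes "unitary V" shows "inj V"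
proof (rule injI)
  fix x y assume "V x = V y"
  then have "norm (x - y) = 0"
    using unitary_norm[OF assms, of "x - y"] by (simp add: unitary_diff[OF assms])
  then show "x = y" by simp
qed

lemma unitary_inv_f [simp]: "unitary V \<Longrightarrow> inv V (V x) = x"
  and unitary_f_inv [simp]: "unitary V \<Longrightarrow> V (inv V x) = x"
  using inv_f_f[OF unitary_inj, of V] surj_f_inv_f[OF unitary_surj, of V] by auto

lemma unitary_inv: assumes V: "unitary V" shows "unitary (inv V)"
  unfolding unitary_def
proof (intro conjI allI)
  show "surj (inv V)"
    by (rule surjI[of _ V]) (simp add: V)
  show "cinner (inv V x) (inv V y) = cinner x y" for x y
    using unitary_cinner[OF V, of "inv V x" "inv V y"] by (simp add: V)
qed

lemma unitary_id: "unitary (\<lambda>x. x)"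
  by (auto simp: unitary_def)

lemma unitary_comp: "unitary V \<Longrightarrow> unitary W \<Longrightarrow> unitary (\<lambda>x. V (W x))"
  unfolding unitary_def using comp_surj[of W V] by (auto simp: comp_def)

lemma unitary_funpow: assumes "unitary V" shows "unitary (V ^^ n)"
proof (induction n)
  case 0 then show ?case by (simp add: id_def unitary_id)
next
  case (Suc n) then show ?case
    using unitary_comp[OF assms] by (simp add: comp_def)
qed

lemma unitary_inv_funpow [simp]: "unitary V \<Longrightarrow> (inv V ^^ n) ((V ^^ n) x) = x"
proof (induction n arbitrary: x)
  case (Suc n)
  then show ?case unfolding funpow_Suc_right[of n "inv V"] by simp
qed simp

lemma unitary_funpow_inv [simp]: "unitary V \<Longrightarrow> (V ^^ n) ((inv V ^^ n) x) = x"
proof (induction n arbitrary: x)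
  case (Suc n)
  then show ?case unfolding funpow_Suc_right[of n V] by simp
qed simp

lemma unitary_cinner_inv: "unitary V \<Longrightarrow> cinner x (V y) = cinner (inv V x) y"
  using unitary_cinner[of V "inv V x" y] by simp

lemma unitary_cinner_funpow: "unitary V \<Longrightarrow> cinner ((V ^^ n) x) ((V ^^ n) y) = cinner x y"
  by (rule unitary_cinner[OF unitary_funpow])

lemma unitary_cinner_inv_funpow: "unitary V \<Longrightarrow> cinner x ((V ^^ n) y) = cinner ((inv V ^^ n) x) y"
  using unitary_cinner_funpow[of V n "(inv V ^^ n) x" y] by simp

lemma unitary_tendsto:
  assumes "unitary V" "(f \<longlongrightarrow> l) F" shows "((\<lambda>x. V (f x)) \<longlongrightarrow> V l) F"
  using assms(2) unfolding tendsto_dist_iff[of f] tendsto_dist_iff[of "\<lambda>x. V (f x)"]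
  by (simp add: dist_norm unitary_diff[OF assms(1), symmetric] unitary_norm[OF assms(1)])

text \<open>The least possible \<open>B\<close> is the squared norm of the analysis operator sending
  \<open>\<phi>\<close> to its pairings with all \<open>x n\<close>. Stated with finite partial
  sums, the bound survives limits taken separately in each \<open>x n\<close>.\<close>

definition bessel :: "real \<Rightarrow> (nat \<Rightarrow> 'a::complex_hilbert) \<Rightarrow> bool" where
  "bessel B x \<longleftrightarrow> (\<forall>\<phi> N. (\<Sum>n<N. (cmod (cinner \<phi> (x n)))\<^sup>2) \<le> B * (norm \<phi>)\<^sup>2)"

lemma besselD: "bessel B x \<Longrightarrow> (\<Sum>n<N. (cmod (cinner \<phi> (x n)))\<^sup>2) \<le> B * (norm \<phi>)\<^sup>2"
  by (simp add: bessel_def)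

lemma bessel_unitary:
  assumes V: "unitary V" and x: "bessel B x" shows "bessel B (\<lambda>n. V (x n))"
  unfolding bessel_def
proof (intro allI)
  fix \<phi> N
  show "(\<Sum>n<N. (cmod (cinner \<phi> (V (x n))))\<^sup>2) \<le> B * (norm \<phi>)\<^sup>2"
    using besselD[OF x, where \<phi> = "inv V \<phi>" and N = N]
    by (simp add: unitary_cinner_inv[OF V] unitary_norm[OF unitary_inv[OF V]])
qed

lemma bessel_shift:
  assumes x: "bessel B x" shows "bessel B (\<lambda>n. x (n + k))"
  unfolding bessel_def
proof (intro allI)
  fix \<phi> N
  have "(\<Sum>n<N. (cmod (cinner \<phi> (x (n + k))))\<^sup>2) = (\<Sum>n\<in>(\<lambda>n. n + k) ` {..<N}. (cmod (cinner \<phi> (x n)))\<^sup>2)"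
    by (simp add: sum.reindex)
  also have "\<dots> \<le> (\<Sum>n<N + k. (cmod (cinner \<phi> (x n)))\<^sup>2)"
    by (rule sum_mono2) auto
  also have "\<dots> \<le> B * (norm \<phi>)\<^sup>2"
    by (rule besselD[OF x])
  finally show "(\<Sum>n<N. (cmod (cinner \<phi> (x (n + k))))\<^sup>2) \<le> B * (norm \<phi>)\<^sup>2" .
qed

text \<open>The analysis operator and the synthesis operator
  \<open>b \<mapsto> \<Sum>n. b n x n\<close> are adjoint and so have the same norm. The synthesis
  side is the one accessible to the functional calculus, where it becomes multiplication by a
  trigonometric polynomial.\<close>

lemma bessel_iff_synthesis:
  assumes "B \<ge> 0"
  shows "bessel B x \<longleftrightarrow> (\<forall>b N. (norm (\<Sum>n<N. b n *\<^sub>C x n))\<^sup>2 \<le> B * (\<Sum>n<N. (cmod (b n))\<^sup>2))"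
proof (intro iffI allI)
  fix b :: "nat \<Rightarrow> complex" and N
  assume x: "bessel B x"
  let ?y = "\<Sum>n<N. b n *\<^sub>C x n" and ?b = "\<Sum>n<N. (cmod (b n))\<^sup>2"
  have "(norm ?y)\<^sup>2 = cmod (cinner ?y ?y)"
    unfolding cinner_self norm_of_real by simp
  also have "cinner ?y ?y = (\<Sum>n<N. b n * cinner ?y (x n))"
    unfolding cinner_sum_right[of "?y"] by (simp add: cinner_scaleC_right)
  also have "cmod \<dots> \<le> (\<Sum>n<N. \<bar>cmod (b n)\<bar> * \<bar>cmod (cinner ?y (x n))\<bar>)"
    by (rule order_trans[OF norm_sum]) (simp add: norm_mult)
  also have "\<dots> \<le> L2_set (\<lambda>n. cmod (b n)) {..<N} * L2_set (\<lambda>n. cmod (cinner ?y (x n))) {..<N}"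
    by (rule L2_set_mult_ineq)
  also have "\<dots> \<le> sqrt ?b * sqrt (B * (norm ?y)\<^sup>2)"
    unfolding L2_set_def
    by (intro mult_left_mono real_sqrt_le_mono besselD[OF x] real_sqrt_ge_zero sum_nonneg) auto
  also have "\<dots> = sqrt (B * ?b) * norm ?y"
    by (simp add: real_sqrt_mult mult.commute)
  finally have *: "(norm ?y)\<^sup>2 \<le> sqrt (B * ?b) * norm ?y" .
  have "norm ?y \<le> sqrt (B * ?b)"
  proof (cases "norm ?y = 0")
    case True then show ?thesis using assms by (simp add: sum_nonneg)
  next
    case False then show ?thesis using * by (simp add: power2_eq_square)
  qed
  then have "(norm ?y)\<^sup>2 \<le> (sqrt (B * ?b))\<^sup>2"
    by (rule power_mono) simp
  then show "(norm ?y)\<^sup>2 \<le> B * ?b"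
    using assms by (simp add: sum_nonneg)
next
  assume s: "\<forall>b N. (norm (\<Sum>n<N. b n *\<^sub>C x n))\<^sup>2 \<le> B * (\<Sum>n<N. (cmod (b n))\<^sup>2)"
  show "bessel B x"
    unfolding bessel_def
  proof (intro allI)
    fix \<phi> N
    \<comment> \<open>The extremal coefficients: pairing \<open>\<phi>\<close> with their synthesis
      reproduces the sum of squares, which can then be cancelled once.\<close>
    define b where "b n = cnj (cinner \<phi> (x n))" for n
    let ?s = "\<Sum>n<N. (cmod (cinner \<phi> (x n)))\<^sup>2"
    have "cinner \<phi> (\<Sum>n<N. b n *\<^sub>C x n) = complex_of_real ?s"
      by (simp add: cinner_sum_right cinner_scaleC_right b_def complex_norm_square[symmetric] mult.commute)
    then have "?s \<le> norm \<phi> * norm (\<Sum>n<N. b n *\<^sub>C x n)"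
      using norm_cinner_le[of \<phi> "\<Sum>n<N. b n *\<^sub>C x n"] complex_Re_le_cmod[of "complex_of_real ?s"]
      by (simp del: of_real_sum of_real_power)
    then have "?s\<^sup>2 \<le> (norm \<phi>)\<^sup>2 * (norm (\<Sum>n<N. b n *\<^sub>C x n))\<^sup>2"
      unfolding power_mult_distrib[symmetric] by (rule power_mono) (simp add: sum_nonneg)
    also have "\<dots> \<le> (norm \<phi>)\<^sup>2 * (B * ?s)"
      using s[rule_format, of b N] by (intro mult_left_mono) (auto simp: b_def)
    finally have *: "?s * ?s \<le> (B * (norm \<phi>)\<^sup>2) * ?s"
      by (simp add: power2_eq_square mult_ac)
    show "?s \<le> B * (norm \<phi>)\<^sup>2"
    proof (cases "?s = 0")
      case True then show ?thesis using assms by simp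
    next
      case False
      moreover have "?s \<ge> 0" by (simp add: sum_nonneg)
      ultimately have "?s > 0" by linarith
      then show ?thesis using * by simp
    qed
  qed
qed

text \<open>Forward powers alone control both directions: testing against
  \<open>(V ^^ m) \<phi>\<close>, which has the norm of \<open>\<phi>\<close>, moves the window of
  exponents down by \<open>m\<close> at no cost.\<close>

definition bessel_vectors :: "('a::complex_hilbert \<Rightarrow> 'a) \<Rightarrow> 'a set" where
  "bessel_vectors V = {\<psi>. \<exists>B\<ge>0. bessel B (\<lambda>n. (V ^^ n) \<psi>)}"

lemma bessel_vectors_subspace:
  assumes V: "unitary V"
  shows "0 \<in> bessel_vectors V"
    and "x \<in> bessel_vectors V \<Longrightarrow> y \<in> bessel_vectors V \<Longrightarrow> x + y \<in> bessel_vectors V"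
    and "x \<in> bessel_vectors V \<Longrightarrow> a *\<^sub>C x \<in> bessel_vectors V"
proof -
  show "0 \<in> bessel_vectors V"
    unfolding bessel_vectors_def bessel_def
    by (simp add: unitary_zero[OF unitary_funpow[OF V]]) (rule exI[of _ 0], simp)
next
  assume "x \<in> bessel_vectors V" "y \<in> bessel_vectors V"
  then obtain B B' where B: "B \<ge> 0" "bessel B (\<lambda>n. (V ^^ n) x)" and B': "B' \<ge> 0" "bessel B' (\<lambda>n. (V ^^ n) y)"
    by (auto simp: bessel_vectors_def)
  have "bessel (2 * B + 2 * B') (\<lambda>n. (V ^^ n) (x + y))"
    unfolding bessel_def
  proof (intro allI)
    fix \<phi> N
    have *: "(cmod (a + b))\<^sup>2 \<le> 2 * (cmod a)\<^sup>2 + 2 * (cmod b)\<^sup>2" for a b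
    proof -
      have "(cmod (a + b))\<^sup>2 \<le> (cmod a + cmod b)\<^sup>2"
        by (intro power_mono norm_triangle_ineq) auto
      also have "\<dots> \<le> 2 * (cmod a)\<^sup>2 + 2 * (cmod b)\<^sup>2"
        using sum_squares_bound[of "cmod a" "cmod b"] by (simp add: power2_sum)
      finally show ?thesis .
    qed
    have "(\<Sum>n<N. (cmod (cinner \<phi> ((V ^^ n) (x + y))))\<^sup>2) \<le>
        (\<Sum>n<N. 2 * (cmod (cinner \<phi> ((V ^^ n) x)))\<^sup>2 + 2 * (cmod (cinner \<phi> ((V ^^ n) y)))\<^sup>2)"
      by (intro sum_mono) (simp add: unitary_add[OF unitary_funpow[OF V]] cinner_add_right *)
    also have "\<dots> \<le> 2 * (B * (norm \<phi>)\<^sup>2) + 2 * (B' * (norm \<phi>)\<^sup>2)"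
      unfolding sum.distrib sum_distrib_left[symmetric]
      by (intro add_mono mult_left_mono besselD B B') auto
    finally show "(\<Sum>n<N. (cmod (cinner \<phi> ((V ^^ n) (x + y))))\<^sup>2) \<le> (2 * B + 2 * B') * (norm \<phi>)\<^sup>2"
      by (simp add: algebra_simps)
  qed
  then show "x + y \<in> bessel_vectors V"
    using B B' by (auto simp: bessel_vectors_def intro!: exI[of _ "2 * B + 2 * B'"])
next
  assume "x \<in> bessel_vectors V"
  then obtain B where B: "B \<ge> 0" "bessel B (\<lambda>n. (V ^^ n) x)"
    by (auto simp: bessel_vectors_def)
  have "bessel ((cmod a)\<^sup>2 * B) (\<lambda>n. (V ^^ n) (a *\<^sub>C x))"
    unfolding bessel_def
  proof (intro allI)
    fix \<phi> N
    have "(\<Sum>n<N. (cmod (cinner \<phi> ((V ^^ n) (a *\<^sub>C x))))\<^sup>2) =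
        (cmod a)\<^sup>2 * (\<Sum>n<N. (cmod (cinner \<phi> ((V ^^ n) x)))\<^sup>2)"
      by (simp add: unitary_scaleC[OF unitary_funpow[OF V]] cinner_scaleC_right norm_mult
          power_mult_distrib sum_distrib_left)
    also have "\<dots> \<le> (cmod a)\<^sup>2 * (B * (norm \<phi>)\<^sup>2)"
      by (intro mult_left_mono besselD[OF B(2)]) simp
    finally show "(\<Sum>n<N. (cmod (cinner \<phi> ((V ^^ n) (a *\<^sub>C x))))\<^sup>2) \<le> (cmod a)\<^sup>2 * B * (norm \<phi>)\<^sup>2"
      by (simp add: mult.assoc)
  qed
  then show "a *\<^sub>C x \<in> bessel_vectors V"
    using B by (auto simp: bessel_vectors_def intro!: exI[of _ "(cmod a)\<^sup>2 * B"])
qed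

lemma subspace_bessel_vectors: "unitary V \<Longrightarrow> subspace (bessel_vectors V)"
  using bessel_vectors_subspace(3)[of V _ "complex_of_real _"]
  by (simp add: subspace_def bessel_vectors_subspace(1,2) scaleC_of_real)

section \<open>Riesz representation on a subspace\<close>

lemma closure_seq_obtain:
  fixes x :: "'a::real_normed_vector"
  assumes "x \<in> closure S"
  obtains f where "\<And>n::nat. f n \<in> S" "f \<longlonglongrightarrow> x"
  using assms unfolding closure_sequential by blast

lemma closure_seqI:
  fixes x :: "'a::real_normed_vector"
  assumes "\<And>n::nat. f n \<in> S" "f \<longlonglongrightarrow> x"
  shows "x \<in> closure S"
  using assms unfolding closure_sequential by blast

lemma subspace_closure:
  fixes S :: "'a::real_normed_vector set"
  assumes "subspace S" shows "subspace (closure S)"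
proof (rule subspaceI)
  show "0 \<in> closure S"
    using subspace_0[OF assms] closure_subset by blast
  fix x y assume "x \<in> closure S" "y \<in> closure S"
  then obtain f g where fg: "\<And>n::nat. f n \<in> S" "f \<longlonglongrightarrow> x" "\<And>n::nat. g n \<in> S" "g \<longlonglongrightarrow> y"
    unfolding closure_sequential by blast
  show "x + y \<in> closure S"
    by (rule closure_seqI[of "\<lambda>n. f n + g n"]) (intro subspace_add[OF assms] tendsto_add fg)+
next
  fix c x assume "x \<in> closure S"
  then obtain f where f: "\<And>n::nat. f n \<in> S" "f \<longlonglongrightarrow> x"
    unfolding closure_sequential by blast
  show "c *\<^sub>R x \<in> closure S"
    by (rule closure_seqI[of "\<lambda>n. c *\<^sub>R f n"]) (intro subspace_scale[OF assms] tendsto_scaleR tendsto_const f)+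
qed

text \<open>The functional is given by its graph, which need not be known to be single-valued beforehand:
  this follows from the bound.\<close>
lemma riesz_subspace:
  fixes R :: "('a::{real_inner, complete_space} \<times> real) set"
  assumes R: "subspace R" and bound: "\<And>x r. (x, r) \<in> R \<Longrightarrow> \<bar>r\<bar> \<le> K * norm x"
  obtains \<phi> where "\<phi> \<in> closure (fst ` R)" "\<And>x r. (x, r) \<in> R \<Longrightarrow> inner \<phi> x = r"
proof -
  \<comment> \<open>If \<open>\<phi>\<close> represents the functional, then \<open>J (x, r)\<close>
    is the squared distance of \<open>x\<close> from \<open>\<phi>\<close> minus the squared norm of
    \<open>\<phi>\<close>. Minimising \<open>J\<close> therefore finds
    \<open>\<phi>\<close>.\<close>
  define J where "J p = (norm (fst p))\<^sup>2 - 2 * snd p" for p :: "'a \<times> real"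
  define m where "m = Inf (J ` R)"
  have R0: "(0, 0) \<in> R"
    using subspace_0[OF R] by (simp add: zero_prod_def)
  have low: "- (K\<^sup>2) \<le> J p" if "p \<in> R" for p
  proof -
    have "snd p \<le> K * norm (fst p)"
      using bound[of "fst p" "snd p"] that by simp
    moreover have "0 \<le> (norm (fst p) - K)\<^sup>2" by simp
    ultimately show ?thesis
      by (simp add: J_def power2_diff algebra_simps)
  qed
  then have bdd: "bdd_below (J ` R)" by (rule bdd_belowI2)
  have m: "m \<le> J p" if "p \<in> R" for p
    unfolding m_def using bdd that by (intro cINF_lower)
  have "\<exists>p\<in>R. J p < m + 1 / (Suc n)" for n
  proof -
    have "\<exists>y\<in>J ` R. y < m + 1 / (Suc n)"
      using R0 unfolding m_def by (intro cInf_lessD) auto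
    then show ?thesis by blast
  qed
  then obtain p where p: "\<And>n. p n \<in> R" "\<And>n. J (p n) < m + 1 / (Suc n)"
    by metis
  have Jp: "(\<lambda>n. J (p n)) \<longlonglongrightarrow> m"
  proof (rule tendsto_sandwich[of "\<lambda>_. m" _ _ "\<lambda>n. m + 1 / (Suc n)"])
    show "(\<lambda>n. m + 1 / real (Suc n)) \<longlonglongrightarrow> m"
      using tendsto_add[OF tendsto_const[of m] LIMSEQ_inverse_real_of_nat] by (simp add: divide_inverse)
  qed (use m p in \<open>auto intro!: always_eventually less_imp_le\<close>)
  \<comment> \<open>Parallelogram law: the midpoint of two pairs is again in \<open>R\<close>, so
    its value is at least \<open>m\<close>, which forces near-minimisers to be close
    together.\<close>
  have para: "(norm (fst q - fst q'))\<^sup>2 \<le> 2 * (J q - m) + 2 * (J q' - m)" if "q \<in> R" "q' \<in> R" for q q'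
  proof -
    have "(1/2) *\<^sub>R (q + q') \<in> R"
      using that by (intro subspace_scale[OF R] subspace_add[OF R])
    from m[OF this] have "m \<le> (1/4) * (norm (fst q + fst q'))\<^sup>2 - (snd q + snd q')"
      by (simp add: J_def power_mult_distrib power2_eq_square add_divide_distrib)
    moreover have "(norm (fst q - fst q'))\<^sup>2 + (norm (fst q + fst q'))\<^sup>2 = 2 * (norm (fst q))\<^sup>2 + 2 * (norm (fst q'))\<^sup>2"
      by (simp add: power2_norm_eq_inner inner_add_left inner_add_right inner_diff_left inner_diff_right inner_commute)
    moreover have "b \<le> 2 * (c - 2 * r - m) + 2 * (d - 2 * s - m)"
      if "m \<le> (1/4) * a - (r + s)" "b + a = 2 * c + 2 * d" for a b c d r s :: real
      using that by argo
    ultimately show ?thesis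
      unfolding J_def by blast
  qed
  have "Cauchy (\<lambda>n. fst (p n))"
  proof (rule metric_CauchyI)
    fix e :: real assume e: "e > 0"
    then have "\<forall>\<^sub>F n in sequentially. J (p n) < m + e\<^sup>2 / 4"
      using order_tendstoD(2)[OF Jp, of "m + e\<^sup>2 / 4"] by simp
    then obtain N where N: "\<And>n. n \<ge> N \<Longrightarrow> J (p n) < m + e\<^sup>2 / 4"
      by (auto simp: eventually_sequentially)
    have "dist (fst (p i)) (fst (p j)) < e" if "N \<le> i" "N \<le> j" for i j
    proof -
      have "(norm (fst (p i) - fst (p j)))\<^sup>2 < e\<^sup>2"
        using para[OF p(1) p(1), of i j] N[OF that(1)] N[OF that(2)] by argo
      then show ?thesis
        using e by (simp add: dist_norm power2_less_imp_less)
    qed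
    then show "\<exists>M. \<forall>i\<ge>M. \<forall>j\<ge>M. dist (fst (p i)) (fst (p j)) < e" by blast
  qed
  then obtain \<phi> where \<phi>: "(\<lambda>n. fst (p n)) \<longlonglongrightarrow> \<phi>"
    using Cauchy_convergent convergent_def by blast
  show ?thesis
  proof
    show "\<phi> \<in> closure (fst ` R)"
      using p(1) \<phi> by (intro closure_seqI[of "\<lambda>n. fst (p n)"]) auto
    fix x r assume xr: "(x, r) \<in> R"
    define a where "a = inner \<phi> x - r"
    have ineq: "0 \<le> 2 * t * a + t\<^sup>2 * (norm x)\<^sup>2" for t
    proof -
      have "m \<le> J (p n) + 2 * t * (inner (fst (p n)) x - r) + t\<^sup>2 * (norm x)\<^sup>2" for n
      proof -
        have "p n + t *\<^sub>R (x, r) \<in> R"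
          by (intro subspace_add[OF R] subspace_scale[OF R] p xr)
        moreover have "(norm (fst (p n) + t *\<^sub>R x))\<^sup>2 = (norm (fst (p n)))\<^sup>2 + 2 * t * inner (fst (p n)) x + t\<^sup>2 * (norm x)\<^sup>2"
          unfolding power2_norm_eq_inner inner_add_left inner_add_right inner_scaleR_left inner_scaleR_right
          by (simp add: inner_commute power2_eq_square algebra_simps)
        ultimately show ?thesis
          using m[of "p n + t *\<^sub>R (x, r)"] by (simp add: J_def algebra_simps)
      qed
      moreover have "(\<lambda>n. J (p n) + 2 * t * (inner (fst (p n)) x - r) + t\<^sup>2 * (norm x)\<^sup>2)
          \<longlonglongrightarrow> m + 2 * t * (inner \<phi> x - r) + t\<^sup>2 * (norm x)\<^sup>2"
        by (intro tendsto_intros Jp \<phi>)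
      ultimately have "m \<le> m + 2 * t * (inner \<phi> x - r) + t\<^sup>2 * (norm x)\<^sup>2"
        by (intro LIMSEQ_le_const) auto
      then show ?thesis by (simp add: a_def)
    qed
    \<comment> \<open>The optimal parameter would be \<open>- a / (norm x)\<^sup>2\<close>; adding
      one to the denominator covers \<open>x = 0\<close> without a case distinction.\<close>
    define s where "s = (norm x)\<^sup>2 + 1"
    have s: "s > 0" "(norm x)\<^sup>2 = s - 1" by (simp_all add: s_def add_nonneg_pos)
    have "0 \<le> s\<^sup>2 * (2 * (- a / s) * a + (- a / s)\<^sup>2 * (s - 1))"
      using ineq[of "- a / s"] s by simp
    also have "\<dots> = - (a\<^sup>2 * (s + 1))"
      using s by (simp add: power2_eq_square field_simps)
    finally have "a\<^sup>2 * (s + 1) \<le> 0" by simp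
    then have "a = 0"
      using s by (simp add: mult_le_0_iff)
    then show "inner \<phi> x = r" by (simp add: a_def)
  qed
qed

text \<open>The projection is the Riesz vector of the functional \<open>inner \<psi>\<close>
  restricted to \<open>S\<close>; closedness of \<open>S\<close> keeps that vector inside
  \<open>S\<close>.\<close>

lemma orthogonal_projection_exists:
  fixes S :: "'a::{real_inner, complete_space} set"
  assumes S: "subspace S" "closed S"
  obtains \<phi> where "\<phi> \<in> S" "\<And>x. x \<in> S \<Longrightarrow> inner (\<psi> - \<phi>) x = 0"
proof -
  define R where "R = (\<lambda>x. (x, inner \<psi> x)) ` S"
  have R: "subspace R"
    unfolding subspace_def
    using subspace_0[OF S(1)] subspace_add[OF S(1)] subspace_scale[OF S(1)]
    by (auto simp: R_def zero_prod_def image_iff inner_add_right)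
  obtain \<phi> where "\<phi> \<in> closure (fst ` R)" "\<And>x r. (x, r) \<in> R \<Longrightarrow> inner \<phi> x = r"
    by (rule riesz_subspace[OF R, of "norm \<psi>"]) (auto simp: R_def Cauchy_Schwarz_ineq2)
  moreover have "fst ` R = S" by (force simp: R_def)
  ultimately show ?thesis
    using S(2) by (intro that[of \<phi>]) (simp_all add: R_def inner_diff_left image_iff)
qed

text \<open>For vectors known only through their pairings with \<open>D\<close>. Since
  \<open>y\<close> is itself approximated from \<open>D\<close>, the test \<open>x = y\<close> is
  available in the limit.\<close>

lemma norm_le_by_testing:
  fixes y :: "'a::real_inner"
  assumes y: "y \<in> closure D" and le: "\<And>x. x \<in> D \<Longrightarrow> inner y x \<le> C * norm x"
    and C: "C \<ge> 0"
  shows "norm y \<le> C"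
proof -
  obtain f where f: "\<And>n. f n \<in> D" "f \<longlonglongrightarrow> y"
    using closure_seq_obtain[OF y] by blast
  have "inner y y \<le> C * norm y"
  proof (rule LIMSEQ_le)
    show "(\<lambda>n. inner y (f n)) \<longlonglongrightarrow> inner y y" "(\<lambda>n. C * norm (f n)) \<longlonglongrightarrow> C * norm y"
      by (intro tendsto_intros f)+
  qed (use le f in auto)
  then have "norm y * norm y \<le> C * norm y"
    by (simp add: power2_norm_eq_inner[symmetric] power2_eq_square)
  then show ?thesis
    using C by (cases "norm y = 0") auto
qed

section \<open>Trigonometric polynomials\<close>

lemma integral_Cauchy_Schwarz:
  fixes f g :: "'a \<Rightarrow> complex"
  assumes [measurable]: "f \<in> borel_measurable M" "g \<in> borel_measurable M"
    and f: "integrable M (\<lambda>x. (cmod (f x))\<^sup>2)" and g: "integrable M (\<lambda>x. (cmod (g x))\<^sup>2)"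
  shows "cmod (\<integral>x. f x * g x \<partial>M) \<le> sqrt (\<integral>x. (cmod (f x))\<^sup>2 \<partial>M) * sqrt (\<integral>x. (cmod (g x))\<^sup>2 \<partial>M)"
proof -
  let ?A = "\<integral>x. (cmod (f x))\<^sup>2 \<partial>M" and ?B = "\<integral>x. (cmod (g x))\<^sup>2 \<partial>M"
  have int: "integrable M (\<lambda>x. f x * g x)"
  proof (rule Bochner_Integration.integrable_bound[OF Bochner_Integration.integrable_add[OF f g]])
    show "AE x in M. norm (f x * g x) \<le> norm ((cmod (f x))\<^sup>2 + (cmod (g x))\<^sup>2)"
    proof (rule AE_I2)
      fix x
      have "2 * (cmod (f x) * cmod (g x)) \<le> (cmod (f x))\<^sup>2 + (cmod (g x))\<^sup>2"
        using sum_squares_bound[of "cmod (f x)" "cmod (g x)"] by simp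
      moreover have "0 \<le> cmod (f x) * cmod (g x)" by simp
      ultimately show "norm (f x * g x) \<le> norm ((cmod (f x))\<^sup>2 + (cmod (g x))\<^sup>2)"
        unfolding norm_mult real_norm_def by linarith
    qed
  qed simp
  have "(ennreal (cmod (\<integral>x. f x * g x \<partial>M)))\<^sup>2 \<le> (\<integral>\<^sup>+x. ennreal (cmod (f x)) * ennreal (cmod (g x)) \<partial>M)\<^sup>2"
    using integral_norm_bound_ennreal[OF int] by (intro power_mono) (simp_all add: norm_mult ennreal_mult')
  also have "\<dots> \<le> (\<integral>\<^sup>+x. (ennreal (cmod (f x)))\<^sup>2 \<partial>M) * (\<integral>\<^sup>+x. (ennreal (cmod (g x)))\<^sup>2 \<partial>M)"
    by (rule Cauchy_Schwarz_nn_integral) auto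
  also have "\<dots> = ennreal ?A * ennreal ?B"
    by (simp add: ennreal_power nn_integral_eq_integral[OF f] nn_integral_eq_integral[OF g])
  finally have "ennreal ((cmod (\<integral>x. f x * g x \<partial>M))\<^sup>2) \<le> ennreal (?A * ?B)"
    by (simp add: ennreal_power ennreal_mult')
  then have "(cmod (\<integral>x. f x * g x \<partial>M))\<^sup>2 \<le> ?A * ?B"
    by (simp add: ennreal_le_iff)
  then show ?thesis
    by (simp add: real_le_rsqrt real_sqrt_mult[symmetric])
qed

text \<open>The closed interval suits the fundamental theorem of calculus. It differs from the
  half-open support demanded of spectral measures by a Lebesgue null point.\<close>

definition circle :: "real measure" where
  "circle = restrict_space lborel {0..2 * pi}"

lemma measurable_circle:
  "f \<in> borel_measurable borel \<Longrightarrow> f \<in> borel_measurable circle"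
  unfolding circle_def by (rule measurable_restrict_space1) simp

lemma finite_measure_circle: "finite_measure circle"
  by (rule finite_measureI) (simp add: circle_def space_restrict_space emeasure_restrict_space)

lemma integrable_circle_bounded:
  fixes f :: "real \<Rightarrow> 'a::{banach, second_countable_topology}"
  assumes "f \<in> borel_measurable borel" "\<And>x. norm (f x) \<le> K"
  shows "integrable circle f"
  by (rule finite_measure.integrable_const_bound[OF finite_measure_circle AE_I2 measurable_circle]) (rule assms)+

lemma integral_circle_cis:
  "(\<integral>\<theta>. cis (of_int n * \<theta>) \<partial>circle) = (if n = 0 then 2 * pi else 0)"
proof (cases "n = 0")
  case True
  then show ?thesis
    by (simp add: circle_def measure_restrict_space space_restrict_space scaleR_conv_of_real)
next
  case False
  let ?F = "\<lambda>\<theta>::real. cis (of_int n * \<theta>) / (\<i> * of_int n)"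
  have "(\<integral>\<theta>. indicator {0..2 * pi} \<theta> *\<^sub>R cis (of_int n * \<theta>) \<partial>lborel) = ?F (2 * pi) - ?F 0"
  proof (rule integral_FTC_Icc)
    fix \<theta> :: real
    have "((\<lambda>\<theta>::real. cis (of_int n * \<theta>)) has_vector_derivative (of_int n *\<^sub>R (\<i> * cis (of_int n * \<theta>)))) (at \<theta> within {0..2 * pi})"
    proof -
      have "((\<lambda>z. exp (\<i> * (of_int n * z))) has_field_derivative (\<i> * of_int n * exp (\<i> * (of_int n * of_real \<theta>)))) (at (of_real \<theta>))"
        by (auto intro!: derivative_eq_intros)
      from has_vector_derivative_real_field[OF this] show ?thesis
        by (simp add: cis_conv_exp scaleR_conv_of_real mult_ac)
    qed
    then have "(?F has_vector_derivative (of_int n *\<^sub>R (\<i> * cis (of_int n * \<theta>)) / (\<i> * of_int n))) (at \<theta> within {0..2 * pi})"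
      by (rule has_vector_derivative_divide)
    then show "(?F has_vector_derivative cis (of_int n * \<theta>)) (at \<theta> within {0..2 * pi})"
      using False by (simp add: scaleR_conv_of_real)
  next
    show "continuous_on {0..2 * pi} (\<lambda>\<theta>::real. cis (of_int n * \<theta>))"
      by (intro continuous_intros)
  qed simp
  also have "\<dots> = 0"
    using cis_multiple_2pi[of "of_int n"] by (simp add: mult_ac)
  finally show ?thesis
    using False by (simp add: circle_def integral_restrict_space)
qed

lemma cis_measurable [measurable]: "(\<lambda>\<theta>. cis (c * \<theta>)) \<in> borel_measurable borel"
  by (intro borel_measurable_continuous_onI continuous_intros)

lemma trig_sum_measurable: "(\<lambda>\<theta>. \<Sum>n\<in>I. b n * cis (c n * \<theta>)) \<in> borel_measurable borel"
  by (intro borel_measurable_sum borel_measurable_times borel_measurable_const cis_measurable)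

lemma trig_sum_bound: "cmod (\<Sum>n\<in>I. b n * cis (c n * \<theta>)) \<le> (\<Sum>n\<in>I. cmod (b n))"
  by (rule order_trans[OF norm_sum]) (simp add: norm_mult)

text \<open>Distinct characters are orthogonal, so only the diagonal of the expanded square
  survives. The measure has total mass \<open>2 * pi\<close>, the origin of this factor in later
  bounds.\<close>

lemma parseval_trig:
  fixes I :: "int set"
  assumes "finite I"
  shows "(\<integral>\<theta>. (cmod (\<Sum>n\<in>I. b n * cis (of_int n * \<theta>)))\<^sup>2 \<partial>circle) = 2 * pi * (\<Sum>n\<in>I. (cmod (b n))\<^sup>2)"
proof -
  have int: "integrable circle (\<lambda>\<theta>. c * cis (of_int k * \<theta>))" for c k
    by (rule integrable_circle_bounded[of _ "cmod c"])
      (auto simp: norm_mult intro!: borel_measurable_times borel_measurable_const cis_measurable)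
  have "complex_of_real (\<integral>\<theta>. (cmod (\<Sum>n\<in>I. b n * cis (of_int n * \<theta>)))\<^sup>2 \<partial>circle)
      = (\<integral>\<theta>. (\<Sum>n\<in>I. \<Sum>m\<in>I. (b n * cnj (b m)) * cis (of_int (n - m) * \<theta>)) \<partial>circle)"
  proof -
    have "complex_of_real ((cmod (\<Sum>n\<in>I. b n * cis (of_int n * \<theta>)))\<^sup>2)
        = (\<Sum>n\<in>I. \<Sum>m\<in>I. (b n * cnj (b m)) * cis (of_int (n - m) * \<theta>))" for \<theta>
    proof -
      have *: "cis (of_int n * \<theta>) * cnj (cis (of_int m * \<theta>)) = cis (of_int (n - m) * \<theta>)" for n m
        by (simp add: cis_cnj cis_mult algebra_simps)
      have "complex_of_real ((cmod (\<Sum>n\<in>I. b n * cis (of_int n * \<theta>)))\<^sup>2)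
          = (\<Sum>n\<in>I. \<Sum>m\<in>I. (b n * cis (of_int n * \<theta>)) * cnj (b m * cis (of_int m * \<theta>)))"
        by (simp only: complex_norm_square cnj_sum sum_product)
      also have "\<dots> = (\<Sum>n\<in>I. \<Sum>m\<in>I. (b n * cnj (b m)) * (cis (of_int n * \<theta>) * cnj (cis (of_int m * \<theta>))))"
        by (intro sum.cong refl) (simp add: mult_ac)
      finally show ?thesis unfolding * .
    qed
    then show ?thesis
      unfolding integral_complex_of_real[symmetric] by simp
  qed
  also have "\<dots> = (\<Sum>n\<in>I. \<Sum>m\<in>I. (b n * cnj (b m)) * (if n = m then 2 * pi else 0))"
  proof -
    have "(\<integral>\<theta>. (\<Sum>n\<in>I. \<Sum>m\<in>I. (b n * cnj (b m)) * cis (of_int (n - m) * \<theta>)) \<partial>circle)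
        = (\<Sum>n\<in>I. \<Sum>m\<in>I. \<integral>\<theta>. (b n * cnj (b m)) * cis (of_int (n - m) * \<theta>) \<partial>circle)"
      by (subst Bochner_Integration.integral_sum) (intro Bochner_Integration.integrable_sum int sum.cong refl Bochner_Integration.integral_sum)+
    also have "\<dots> = (\<Sum>n\<in>I. \<Sum>m\<in>I. (b n * cnj (b m)) * (\<integral>\<theta>. cis (of_int (n - m) * \<theta>) \<partial>circle))"
      by (simp only: integral_mult_right_zero)
    finally show ?thesis
      unfolding integral_circle_cis by simp
  qed
  also have "\<dots> = (\<Sum>n\<in>I. 2 * pi * (b n * cnj (b n)))"
    using assms by (simp add: if_distrib sum.delta cong: if_cong) (simp add: mult_ac)
  also have "\<dots> = complex_of_real (2 * pi * (\<Sum>n\<in>I. (cmod (b n))\<^sup>2))"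
    by (simp add: complex_norm_square[symmetric] sum_distrib_left)
  finally show ?thesis
    using of_real_eq_iff by blast
qed

section \<open>Spectral calculus of a unitary operator\<close>

definition zpow :: "('a::complex_hilbert \<Rightarrow> 'a) \<Rightarrow> int \<Rightarrow> 'a \<Rightarrow> 'a" where
  "zpow V n = (if 0 \<le> n then V ^^ nat n else inv V ^^ nat (- n))"

lemma zpow_of_nat [simp]: "zpow V (int n) = V ^^ n"
  by (simp add: zpow_def)

lemma zpow_0 [simp]: "zpow V 0 x = x"
  by (simp add: zpow_def)

lemma zpow_uminus_of_nat: "zpow V (- int n) = inv V ^^ n"
  by (cases "n = 0") (simp_all add: zpow_def)

lemma zpow_succ:
  assumes V: "unitary V"
  shows "zpow V (n + 1) x = V (zpow V n x)"
proof (cases "0 \<le> n")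
  case True
  then show ?thesis by (simp add: zpow_def nat_add_distrib)
next
  case False
  define k where "k = nat (- n - 1)"
  have "n = - int (Suc k)" "n + 1 = - int k"
    using False by (simp_all add: k_def)
  then show ?thesis
    unfolding \<open>n + 1 = - int k\<close> unfolding \<open>n = - int (Suc k)\<close> zpow_uminus_of_nat
    by (simp add: unitary_f_inv[OF V])
qed

lemma unitary_zpow: "unitary V \<Longrightarrow> unitary (zpow V n)"
  by (simp add: zpow_def unitary_funpow unitary_inv)

text \<open>Gram matrices of orbits are Toeplitz, which turns all pairings within one orbit into
  moments of the spectral measure.\<close>

lemma zpow_cinner_shift:
  assumes V: "unitary V"
  shows "cinner (zpow V m x) (zpow V n y) = cinner x (zpow V (n - m) y)"
proof (induction m arbitrary: n rule: int_induct[where k = 0])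
  case base then show ?case by simp
next
  case (step1 i)
  show ?case
    using step1.IH[of "n - 1"] unitary_cinner[OF V, of "zpow V i x" "zpow V (n - 1) y"]
      zpow_succ[OF V, of "n - 1" y] zpow_succ[OF V, of i x]
    by (simp add: algebra_simps)
next
  case (step2 i)
  show ?case
    using step2.IH[of "n + 1"] unitary_cinner[OF V, of "zpow V (i - 1) x" "zpow V n y"]
      zpow_succ[OF V, of n y] zpow_succ[OF V, of "i - 1" x]
    by (simp add: algebra_simps)
qed

lemma zpow_zpow:
  assumes V: "unitary V"
  shows "zpow V m (zpow V n x) = zpow V (m + n) x"
proof (induction m rule: int_induct[where k = 0])
  case base then show ?case by simp
next
  case (step1 i)
  then show ?case
    using zpow_succ[OF V, of i "zpow V n x"] zpow_succ[OF V, of "i + n" x] by (simp add: algebra_simps)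
next
  case (step2 i)
  have "V (zpow V (i - 1) (zpow V n x)) = V (zpow V (i - 1 + n) x)"
    using step2 zpow_succ[OF V, of "i - 1" "zpow V n x"] zpow_succ[OF V, of "i - 1 + n" x] by (simp add: algebra_simps)
  then show ?case
    using unitary_inj[OF V] by (simp add: inj_eq)
qed

text \<open>A transcription of \<open>ac_subspace\<close> to the abstract Hilbert space, kept
  literal so that the two agree by unfolding on square summable states.\<close>

definition ac_vectors :: "('a::complex_hilbert \<Rightarrow> 'a) \<Rightarrow> 'a set" where
  "ac_vectors V = {\<psi>. \<exists>\<mu>. sets \<mu> = sets borel \<and> finite_measure \<mu> \<and>
      emeasure \<mu> (- {0..<2*pi}) = 0 \<and> absolutely_continuous lborel \<mu> \<and>
      (\<forall>n::nat. cinner \<psi> ((V ^^ n) \<psi>) =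
          integral\<^sup>L \<mu> (\<lambda>\<theta>::real. exp (\<i> * of_nat n * of_real \<theta>)))}"

text \<open>Functional calculus \<open>x = p(V) \<psi>\<close> for trigonometric polynomials, as a relation because \<open>x\<close> does not
  determine \<open>p\<close>.\<close>
inductive trig_calculus :: "('a::complex_hilbert \<Rightarrow> 'a) \<Rightarrow> 'a \<Rightarrow> 'a \<Rightarrow> (real \<Rightarrow> complex) \<Rightarrow> bool"
  for V :: "'a \<Rightarrow> 'a" and \<psi> :: 'a where
  monom: "trig_calculus V \<psi> (a *\<^sub>C zpow V n \<psi>) (\<lambda>\<theta>. a * cis (of_int n * \<theta>))"
| add: "trig_calculus V \<psi> x p \<Longrightarrow> trig_calculus V \<psi> y q \<Longrightarrow> trig_calculus V \<psi> (x + y) (\<lambda>\<theta>. p \<theta> + q \<theta>)"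

lemma trig_calculus_bounded:
  "trig_calculus V \<psi> x p \<Longrightarrow> p \<in> borel_measurable borel \<and> (\<exists>K. \<forall>\<theta>. cmod (p \<theta>) \<le> K)"
proof (induction rule: trig_calculus.induct)
  case (monom a n)
  then show ?case
    by (auto simp: norm_mult intro!: borel_measurable_times borel_measurable_const cis_measurable)
next
  case (add x p y q)
  then obtain K L where "\<forall>\<theta>. cmod (p \<theta>) \<le> K" "\<forall>\<theta>. cmod (q \<theta>) \<le> L"
    by blast
  then have "\<forall>\<theta>. cmod (p \<theta> + q \<theta>) \<le> K + L"
    by (meson add_mono norm_triangle_le)
  then show ?case
    using add by (auto intro!: borel_measurable_add)
qed

lemma trig_calculus_scaleC:
  assumes "trig_calculus V \<psi> x p"
  shows "trig_calculus V \<psi> (c *\<^sub>C x) (\<lambda>\<theta>. c * p \<theta>)"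
  using assms
proof (induction rule: trig_calculus.induct)
  case (monom a n)
  then show ?case
    using trig_calculus.monom[of V \<psi> "c * a" n] by (simp add: scaleC_scaleC mult.assoc)
next
  case (add x p y q)
  then show ?case
    using trig_calculus.add by (fastforce simp: scaleC_add_right distrib_left)
qed

lemma trig_calculus_zpow:
  assumes V: "unitary V" and "trig_calculus V \<psi> x p"
  shows "trig_calculus V \<psi> (zpow V m x) (\<lambda>\<theta>. cis (of_int m * \<theta>) * p \<theta>)"
  using assms(2)
proof (induction rule: trig_calculus.induct)
  case (monom a n)
  have "(\<lambda>\<theta>. cis (of_int m * \<theta>) * (a * cis (of_int n * \<theta>))) = (\<lambda>\<theta>. a * cis (of_int (m + n) * \<theta>))"
    by (simp add: fun_eq_iff cis_mult[symmetric] distrib_right)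
  then show ?case
    using trig_calculus.monom[of V \<psi> a "m + n"]
    by (simp add: unitary_scaleC[OF unitary_zpow[OF V]] zpow_zpow[OF V])
next
  case (add x p y q)
  then show ?case
    using trig_calculus.add by (fastforce simp: unitary_add[OF unitary_zpow[OF V]] distrib_left)
qed

lemma trig_calculus_zero: "trig_calculus V \<psi> 0 (\<lambda>\<theta>. 0)"
  using trig_calculus.monom[of V \<psi> 0 0] by simp

lemma trig_calculus_sum:
  assumes "\<And>i. i \<in> I \<Longrightarrow> trig_calculus V \<psi> (x i) (p i)"
  shows "trig_calculus V \<psi> (\<Sum>i\<in>I. x i) (\<lambda>\<theta>. \<Sum>i\<in>I. p i \<theta>)"
  using assms
  by (induction I rule: infinite_finite_induct) (auto simp: trig_calculus_zero intro: trig_calculus.add)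

lemma trig_calculus_self: "trig_calculus V \<psi> \<psi> (\<lambda>\<theta>. 1)"
  using trig_calculus.monom[of V \<psi> 1 0] by simp

lemma subspace_trig_calculus: "subspace {x. \<exists>p. trig_calculus V \<psi> x p}"
  unfolding subspace_def
  using trig_calculus_zero trig_calculus.add trig_calculus_scaleC
  by (fastforce simp: scaleC_of_real[symmetric])

lemma cnj_measurable [measurable]: "cnj \<in> borel_measurable borel"
  by (intro borel_measurable_continuous_onI continuous_intros)

text \<open>One absolutely continuous vector together with its spectral measure and a Radon-Nikodym
  density \<open>F\<close>, so that integrals against \<open>\<mu>\<close> can stand for functions
  of \<open>V\<close> applied to \<open>\<psi>\<close>.\<close>

locale ac_vector =
  fixes V :: "'a::complex_hilbert \<Rightarrow> 'a" and \<psi> :: 'a and \<mu> :: "real measure" and F :: "real \<Rightarrow> ennreal"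
  assumes V: "unitary V" and \<mu>: "sets \<mu> = sets borel" "finite_measure \<mu>"
    and supp: "emeasure \<mu> (- {0..<2 * pi}) = 0"
    and F: "F \<in> borel_measurable borel" "density lborel F = \<mu>"
    and moments: "cinner \<psi> ((V ^^ n) \<psi>) = (\<integral>\<theta>. cis (real n * \<theta>) \<partial>\<mu>)"
begin

lemma measurable_mu: "f \<in> borel_measurable borel \<Longrightarrow> f \<in> borel_measurable \<mu>"
  using measurable_cong_sets[OF \<mu>(1) refl] by blast

lemma integrable_bounded:
  fixes f :: "real \<Rightarrow> 'b::{banach, second_countable_topology}"
  assumes "f \<in> borel_measurable borel" "\<And>x. norm (f x) \<le> K"
  shows "integrable \<mu> f"
  by (rule finite_measure.integrable_const_bound[OF \<mu>(2) AE_I2 measurable_mu]) (rule assms)+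

lemma moments_int: "cinner \<psi> (zpow V n \<psi>) = (\<integral>\<theta>. cis (of_int n * \<theta>) \<partial>\<mu>)"
proof (cases "0 \<le> n")
  case True
  then show ?thesis
    using moments[of "nat n"] by (simp add: zpow_def)
next
  case False
  then have "cinner \<psi> (zpow V n \<psi>) = cinner (zpow V (- n) \<psi>) \<psi>"
    using zpow_cinner_shift[OF V, of "- n" \<psi> 0 \<psi>] by simp
  also have "\<dots> = cnj (cinner \<psi> ((V ^^ nat (- n)) \<psi>))"
    using False by (subst cinner_commute) (simp add: zpow_def)
  also have "\<dots> = (\<integral>\<theta>. cnj (cis (real (nat (- n)) * \<theta>)) \<partial>\<mu>)"
    by (simp only: moments Bochner_Integration.integral_cnj)
  finally show ?thesis
    using False by (simp add: cis_cnj)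
qed

lemma integrable_calculus:
  assumes "trig_calculus V \<psi> x p" "trig_calculus V \<psi> y q" "G \<in> sets borel"
  shows "integrable \<mu> (\<lambda>\<theta>. cnj (p \<theta>) * q \<theta>)" "integrable \<mu> (\<lambda>\<theta>. indicator G \<theta> * q \<theta>)"
    "integrable \<mu> (\<lambda>\<theta>. indicator G \<theta> * (cnj (p \<theta>) * q \<theta>))"
    "integrable \<mu> (\<lambda>\<theta>. (cmod (indicator G \<theta> * q \<theta>))\<^sup>2)" "integrable \<mu> (\<lambda>\<theta>. (cmod (q \<theta>))\<^sup>2)"
proof -
  obtain K where K: "p \<in> borel_measurable borel" "\<And>\<theta>. cmod (p \<theta>) \<le> K"
    using trig_calculus_bounded[OF assms(1)] by blast
  obtain L where L: "q \<in> borel_measurable borel" "\<And>\<theta>. cmod (q \<theta>) \<le> L"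
    using trig_calculus_bounded[OF assms(2)] by blast
  note [measurable] = K(1) L(1) assms(3)
  have pos: "0 \<le> K" "0 \<le> L"
    using K(2)[of 0] L(2)[of 0] by (meson norm_ge_zero order_trans)+
  have pq: "cmod (p \<theta>) * cmod (q \<theta>) \<le> K * L" for \<theta>
    by (intro mult_mono K L pos) auto
  have q2: "(cmod (q \<theta>))\<^sup>2 \<le> L\<^sup>2" for \<theta>
    by (intro power_mono L) auto
  show "integrable \<mu> (\<lambda>\<theta>. cnj (p \<theta>) * q \<theta>)"
    by (rule integrable_bounded[of _ "K * L"]) (simp_all add: norm_mult pq)
  show "integrable \<mu> (\<lambda>\<theta>. indicator G \<theta> * q \<theta>)"
    by (rule integrable_bounded[of _ L]) (auto simp: norm_mult L pos split: split_indicator)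
  show "integrable \<mu> (\<lambda>\<theta>. indicator G \<theta> * (cnj (p \<theta>) * q \<theta>))"
    by (rule integrable_bounded[of _ "K * L"]) (auto simp: norm_mult pq pos split: split_indicator)
  show "integrable \<mu> (\<lambda>\<theta>. (cmod (indicator G \<theta> * q \<theta>))\<^sup>2)"
    by (rule integrable_bounded[of _ "L\<^sup>2"]) (auto simp: norm_mult q2 split: split_indicator)
  show "integrable \<mu> (\<lambda>\<theta>. (cmod (q \<theta>))\<^sup>2)"
    by (rule integrable_bounded[of _ "L\<^sup>2"]) (auto simp: q2)
qed

text \<open>By sesquilinearity only monomials matter, and for these the claim is the moment
  identity. It makes the cyclic subspace of \<open>\<psi>\<close> isometric to trigonometric
  polynomials in \<open>L2(\<mu>)\<close>, so the ambiguity of \<open>p\<close> for given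
  \<open>x\<close> is invisible to \<open>\<mu>\<close>.\<close>

lemma cinner_calculus:
  assumes "trig_calculus V \<psi> x p" "trig_calculus V \<psi> y q"
  shows "cinner x y = (\<integral>\<theta>. cnj (p \<theta>) * q \<theta> \<partial>\<mu>)"
  using assms
proof (induction arbitrary: y q rule: trig_calculus.induct)
  case (monom a n)
  from monom.prems show ?case
  proof (induction rule: trig_calculus.induct)
    case (monom b m)
    have "cnj (a * cis (of_int n * \<theta>)) * (b * cis (of_int m * \<theta>)) = (cnj a * b) * cis (of_int (m - n) * \<theta>)" for \<theta>
    proof -
      have "cis (of_int (m - n) * \<theta>) = cnj (cis (of_int n * \<theta>)) * cis (of_int m * \<theta>)"
        by (simp add: cis_cnj cis_mult algebra_simps)
      then show ?thesis by (simp add: mult_ac)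
    qed
    then have "(\<integral>\<theta>. cnj (a * cis (of_int n * \<theta>)) * (b * cis (of_int m * \<theta>)) \<partial>\<mu>) = (cnj a * b) * (\<integral>\<theta>. cis (of_int (m - n) * \<theta>) \<partial>\<mu>)"
      by (simp only: integral_mult_right_zero)
    then show ?case
      by (simp add: cinner_scaleC_left cinner_scaleC_right zpow_cinner_shift[OF V] moments_int del: of_int_diff)
  next
    case (add x p y q)
    note i = integrable_calculus(1)[OF trig_calculus.monom _ sets.top]
    show ?case
      using Bochner_Integration.integral_add[OF i[OF add.hyps(1)] i[OF add.hyps(2)]] add.IH
      by (simp add: cinner_add_right distrib_left)
  qed
next
  case (add x p x' p')
  note i = integrable_calculus(1)[OF _ add.prems sets.top]
  show ?case
    using Bochner_Integration.integral_add[OF i[OF add.hyps(1)] i[OF add.hyps(2)]] add.IH[OF add.prems]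
    by (simp add: cinner_add_left distrib_right)
qed

lemma norm_calculus:
  assumes "trig_calculus V \<psi> x p"
  shows "(norm x)\<^sup>2 = (\<integral>\<theta>. (cmod (p \<theta>))\<^sup>2 \<partial>\<mu>)"
proof -
  have "complex_of_real ((norm x)\<^sup>2) = (\<integral>\<theta>. complex_of_real ((cmod (p \<theta>))\<^sup>2) \<partial>\<mu>)"
    unfolding cinner_self[symmetric] cinner_calculus[OF assms assms] complex_norm_square by (simp add: mult.commute)
  then show ?thesis
    unfolding integral_complex_of_real by (simp only: of_real_eq_iff)
qed

text \<open>The cutoff is attached to \<open>q\<close> before Cauchy-Schwarz is applied: one factor
  profits from the restriction to \<open>G\<close>, while \<open>p\<close> leaves the full
  \<open>norm x\<close>, the form needed for testing.\<close>

lemma calculus_Cauchy_Schwarz: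
  assumes p: "trig_calculus V \<psi> x p" and q: "trig_calculus V \<psi> y q" and G: "G \<in> sets borel"
  shows "cmod (\<integral>\<theta>. indicator G \<theta> * (cnj (q \<theta>) * p \<theta>) \<partial>\<mu>)
    \<le> sqrt (\<integral>\<theta>. (cmod (indicator G \<theta> * q \<theta>))\<^sup>2 \<partial>\<mu>) * norm x"
proof -
  note [measurable] = G measurable_mu[OF conjunct1[OF trig_calculus_bounded[OF p]]]
    measurable_mu[OF conjunct1[OF trig_calculus_bounded[OF q]]]
  have [measurable]: "G \<in> sets \<mu>" using G \<mu> by simp
  have "cmod (\<integral>\<theta>. cnj (indicator G \<theta> * q \<theta>) * p \<theta> \<partial>\<mu>)
      \<le> sqrt (\<integral>\<theta>. (cmod (cnj (indicator G \<theta> * q \<theta>)))\<^sup>2 \<partial>\<mu>) * sqrt (\<integral>\<theta>. (cmod (p \<theta>))\<^sup>2 \<partial>\<mu>)"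
    by (rule integral_Cauchy_Schwarz)
      (use integrable_calculus(4)[OF q q G] integrable_calculus(5)[OF p p G] in \<open>simp_all del: complex_cnj_mult\<close>)
  moreover have "cnj (indicator G \<theta> * q \<theta>) * p \<theta> = indicator G \<theta> * (cnj (q \<theta>) * p \<theta>)" for \<theta>
    by (simp split: split_indicator)
  ultimately show ?thesis
    by (simp add: norm_calculus[OF p, symmetric] del: complex_cnj_mult)
qed

text \<open>The representer plays the role of \<open>1\<^sub>G(V) \<psi>\<close>.\<close>
lemma spectral_cutoff:
  assumes G: "G \<in> sets borel"
  obtains \<phi> where "\<phi> \<in> closure {x. \<exists>p. trig_calculus V \<psi> x p}"
    "\<And>x p. trig_calculus V \<psi> x p \<Longrightarrow> cinner \<phi> x = (\<integral>\<theta>. indicator G \<theta> * p \<theta> \<partial>\<mu>)"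
proof -
  define R where "R = {(x, r). \<exists>p. trig_calculus V \<psi> x p \<and> r = Re (\<integral>\<theta>. indicator G \<theta> * p \<theta> \<partial>\<mu>)}"
  have sub: "subspace R"
  proof (rule subspaceI)
    show "0 \<in> R"
      using trig_calculus_zero by (force simp: R_def zero_prod_def)
    fix u v assume "u \<in> R" "v \<in> R"
    then obtain p q where p: "trig_calculus V \<psi> (fst u) p" "snd u = Re (\<integral>\<theta>. indicator G \<theta> * p \<theta> \<partial>\<mu>)"
      and q: "trig_calculus V \<psi> (fst v) q" "snd v = Re (\<integral>\<theta>. indicator G \<theta> * q \<theta> \<partial>\<mu>)"
      by (auto simp: R_def)
    have "(\<integral>\<theta>. indicator G \<theta> * (p \<theta> + q \<theta>) \<partial>\<mu>) = (\<integral>\<theta>. indicator G \<theta> * p \<theta> \<partial>\<mu>) + (\<integral>\<theta>. indicator G \<theta> * q \<theta> \<partial>\<mu>)"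
      using Bochner_Integration.integral_add[OF integrable_calculus(2)[OF p(1) p(1) G] integrable_calculus(2)[OF q(1) q(1) G]]
      by (simp add: distrib_left)
    then show "u + v \<in> R"
      using trig_calculus.add[OF p(1) q(1)] p(2) q(2) by (auto simp: R_def case_prod_beta intro!: exI)
  next
    fix c :: real and u assume "u \<in> R"
    then obtain p where p: "trig_calculus V \<psi> (fst u) p" "snd u = Re (\<integral>\<theta>. indicator G \<theta> * p \<theta> \<partial>\<mu>)"
      by (auto simp: R_def)
    have "(\<integral>\<theta>. indicator G \<theta> * (complex_of_real c * p \<theta>) \<partial>\<mu>) = complex_of_real c * (\<integral>\<theta>. indicator G \<theta> * p \<theta> \<partial>\<mu>)"
      by (simp only: mult.left_commute[of "indicator _ _"] integral_mult_right_zero)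
    then show "c *\<^sub>R u \<in> R"
      using trig_calculus_scaleC[OF p(1), of "complex_of_real c"] p(2)
      by (auto simp: R_def case_prod_beta scaleC_of_real intro!: exI)
  qed
  have bound: "\<bar>r\<bar> \<le> sqrt (\<integral>\<theta>. (cmod (indicator G \<theta> * 1))\<^sup>2 \<partial>\<mu>) * norm x" if "(x, r) \<in> R" for x r
  proof -
    from that obtain p where p: "trig_calculus V \<psi> x p" "r = Re (\<integral>\<theta>. indicator G \<theta> * p \<theta> \<partial>\<mu>)"
      by (auto simp: R_def)
    have "\<bar>r\<bar> \<le> cmod (\<integral>\<theta>. indicator G \<theta> * p \<theta> \<partial>\<mu>)"
      unfolding p(2) by (rule abs_Re_le_cmod)
    also have "\<dots> \<le> sqrt (\<integral>\<theta>. (cmod (indicator G \<theta> * 1))\<^sup>2 \<partial>\<mu>) * norm x"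
      using calculus_Cauchy_Schwarz[OF p(1) trig_calculus_self G] by simp
    finally show ?thesis .
  qed
  obtain \<phi> where \<phi>: "\<phi> \<in> closure (fst ` R)" "\<And>x r. (x, r) \<in> R \<Longrightarrow> inner \<phi> x = r"
    using riesz_subspace[OF sub bound] by blast
  have "fst ` R = {x. \<exists>p. trig_calculus V \<psi> x p}"
    by (force simp: R_def)
  moreover have "cinner \<phi> x = (\<integral>\<theta>. indicator G \<theta> * p \<theta> \<partial>\<mu>)" if p: "trig_calculus V \<psi> x p" for x p
  proof (rule complex_eqI)
    show "Re (cinner \<phi> x) = Re (\<integral>\<theta>. indicator G \<theta> * p \<theta> \<partial>\<mu>)"
      unfolding Re_cinner using p by (intro \<phi>(2)) (auto simp: R_def)
    \<comment> \<open>The real Riesz theorem yields real parts only; evaluating it at a rotated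
      vector, which is again in the calculus, gives the imaginary part.\<close>
    have "inner \<phi> ((- \<i>) *\<^sub>C x) = Re (\<integral>\<theta>. indicator G \<theta> * (- \<i> * p \<theta>) \<partial>\<mu>)"
      using trig_calculus_scaleC[OF p, of "- \<i>"] by (intro \<phi>(2)) (auto simp: R_def)
    also have "(\<integral>\<theta>. indicator G \<theta> * (- \<i> * p \<theta>) \<partial>\<mu>) = - \<i> * (\<integral>\<theta>. indicator G \<theta> * p \<theta> \<partial>\<mu>)"
      by (simp only: mult.left_commute[of "indicator _ _"] integral_mult_right_zero)
    finally show "Im (cinner \<phi> x) = Im (\<integral>\<theta>. indicator G \<theta> * p \<theta> \<partial>\<mu>)"
      by (simp only: Re_cinner[symmetric] cinner_scaleC_right) simp
  qed
  ultimately show ?thesis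
    using \<phi>(1) that by simp
qed

text \<open>On \<open>G\<close> the density is at most \<open>k\<close>, so there
  \<open>\<mu>\<close> is dominated by \<open>k\<close> times Lebesgue measure on the circle, for
  which Parseval evaluates the integral.\<close>

lemma cutoff_energy:
  fixes b :: "nat \<Rightarrow> complex"
  assumes k: "0 \<le> k"
  defines "G \<equiv> {\<theta>. F \<theta> \<le> ennreal k}"
  shows "(\<integral>\<theta>. (cmod (indicator G \<theta> * (\<Sum>n<N. b n * cis (real n * \<theta>))))\<^sup>2 \<partial>\<mu>) \<le> k * (2 * pi) * (\<Sum>n<N. (cmod (b n))\<^sup>2)"
proof -
  define q where "q = (\<lambda>\<theta>. \<Sum>n<N. b n * cis (real n * \<theta>))"
  have q [measurable]: "q \<in> borel_measurable borel"
    unfolding q_def by (rule trig_sum_measurable)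
  have G [measurable]: "G \<in> sets borel"
    using F(1) unfolding G_def by measurable
  note [measurable] = F(1)
  have par: "(\<integral>\<theta>. (cmod (q \<theta>))\<^sup>2 \<partial>circle) = 2 * pi * (\<Sum>n<N. (cmod (b n))\<^sup>2)"
    using parseval_trig[of "int ` {..<N}" "\<lambda>n. b (nat n)"] by (simp add: q_def sum.reindex)
  have q_bound: "(cmod (q \<theta>))\<^sup>2 \<le> (\<Sum>n<N. cmod (b n))\<^sup>2" for \<theta>
    unfolding q_def by (intro power_mono trig_sum_bound) simp
  have q_int: "integrable circle (\<lambda>\<theta>. (cmod (q \<theta>))\<^sup>2)"
    by (rule integrable_circle_bounded[of _ "(\<Sum>n<N. cmod (b n))\<^sup>2"]) (auto simp: q_bound)
  have AE_supp: "AE \<theta> in \<mu>. \<theta> \<in> {0..<2 * pi}"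
    using supp by (intro AE_I[of _ _ "- {0..<2 * pi}"]) (auto simp: \<mu>)
  have "(\<integral>\<^sup>+\<theta>. ennreal ((cmod (indicator G \<theta> * q \<theta>))\<^sup>2) \<partial>\<mu>)
      = (\<integral>\<^sup>+\<theta>. ennreal ((cmod (indicator G \<theta> * q \<theta>))\<^sup>2) * indicator {0..<2 * pi} \<theta> \<partial>\<mu>)"
    using AE_supp by (intro nn_integral_cong_AE) auto
  also have "\<dots> = (\<integral>\<^sup>+\<theta>. F \<theta> * (ennreal ((cmod (indicator G \<theta> * q \<theta>))\<^sup>2) * indicator {0..<2 * pi} \<theta>) \<partial>lborel)"
    unfolding F(2)[symmetric] by (rule nn_integral_density) auto
  also have "\<dots> \<le> (\<integral>\<^sup>+\<theta>. ennreal k * (ennreal ((cmod (q \<theta>))\<^sup>2) * indicator {0..2 * pi} \<theta>) \<partial>lborel)"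
    by (intro nn_integral_mono) (auto simp: G_def split: split_indicator intro!: mult_right_mono)
  also have "\<dots> = ennreal k * (\<integral>\<^sup>+\<theta>. ennreal ((cmod (q \<theta>))\<^sup>2) \<partial>circle)"
    by (simp add: circle_def nn_integral_restrict_space nn_integral_cmult)
  also have "\<dots> = ennreal (k * (2 * pi * (\<Sum>n<N. (cmod (b n))\<^sup>2)))"
    using k by (simp add: nn_integral_eq_integral[OF q_int] par ennreal_mult'[symmetric])
  finally have "(\<integral>\<^sup>+\<theta>. ennreal ((cmod (indicator G \<theta> * q \<theta>))\<^sup>2) \<partial>\<mu>) \<le> ennreal (k * (2 * pi * (\<Sum>n<N. (cmod (b n))\<^sup>2)))" .
  then show ?thesis
    unfolding q_def
    using k by (intro integral_real_bounded) (auto simp: sum_nonneg mult.assoc)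
qed

text \<open>Take the cutoff \<open>\<phi>\<close> of \<open>\<psi>\<close> to \<open>G\<close>. Its
  synthesis corresponds to a trigonometric polynomial multiplied by the indicator of
  \<open>G\<close>, which gives the Bessel bound \<open>k * (2 * pi)\<close>; the difference
  \<open>\<psi> - \<phi>\<close> corresponds to the indicator of the complement.\<close>

lemma approx_bessel:
  assumes k: "0 \<le> k"
  defines "G \<equiv> {\<theta>. F \<theta> \<le> ennreal k}"
  shows "\<exists>\<phi>\<in>bessel_vectors V. (norm (\<psi> - \<phi>))\<^sup>2 \<le> measure \<mu> (- G)"
proof -
  let ?D = "{x. \<exists>p. trig_calculus V \<psi> x p}"
  note [measurable] = F(1)
  have G [measurable]: "G \<in> sets borel"
    unfolding G_def by measurable
  obtain \<phi> where \<phi>: "\<phi> \<in> closure ?D"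
    "\<And>x p. trig_calculus V \<psi> x p \<Longrightarrow> cinner \<phi> x = (\<integral>\<theta>. indicator G \<theta> * p \<theta> \<partial>\<mu>)"
    using spectral_cutoff[OF G] by blast
  have bessel: "bessel (k * (2 * pi)) (\<lambda>n. (V ^^ n) \<phi>)"
  proof (subst bessel_iff_synthesis)
    show "0 \<le> k * (2 * pi)" using k by simp
    show "\<forall>b N. (norm (\<Sum>n<N. b n *\<^sub>C (V ^^ n) \<phi>))\<^sup>2 \<le> k * (2 * pi) * (\<Sum>n<N. (cmod (b n))\<^sup>2)"
    proof (intro allI)
      fix b :: "nat \<Rightarrow> complex" and N
      define T where "T x = (\<Sum>n<N. b n *\<^sub>C (V ^^ n) x)" for x
      define q where "q \<theta> = (\<Sum>n<N. b n * cis (real n * \<theta>))" for \<theta>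
      define C where "C = sqrt (k * (2 * pi) * (\<Sum>n<N. (cmod (b n))\<^sup>2))"
      have q: "trig_calculus V \<psi> (T \<psi>) q"
        unfolding T_def q_def
        by (intro trig_calculus_sum) (metis trig_calculus.monom of_int_of_nat_eq zpow_of_nat)
      have TD: "T x \<in> ?D" if "x \<in> ?D" for x
      proof -
        obtain p where p: "trig_calculus V \<psi> x p" using \<open>x \<in> ?D\<close> by blast
        have "trig_calculus V \<psi> (b n *\<^sub>C (V ^^ n) x) (\<lambda>\<theta>. b n * (cis (of_int (int n) * \<theta>) * p \<theta>))" for n
          using trig_calculus_scaleC[OF trig_calculus_zpow[OF V p]] by (metis zpow_of_nat)
        then show ?thesis
          unfolding T_def using trig_calculus_sum[of "{..<N}"] by fast
      qed
      have Tlim: "(\<lambda>n. T (f n)) \<longlonglongrightarrow> T l" if "f \<longlonglongrightarrow> l" for f l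
      proof -
        have "(\<lambda>m. b n *\<^sub>C (V ^^ n) (f m)) \<longlonglongrightarrow> b n *\<^sub>C (V ^^ n) l" for n
          by (intro tendsto_scaleC unitary_tendsto[OF unitary_funpow[OF V]] that)
        then show ?thesis
          unfolding T_def by (intro tendsto_sum)
      qed
      obtain f where f: "\<And>n. f n \<in> ?D" "f \<longlonglongrightarrow> \<phi>"
        using closure_seq_obtain[OF \<phi>(1)] by blast
      have "norm (T \<phi>) \<le> C"
      \<comment> \<open>The vector \<open>\<phi>\<close> is only a limit of vectors in the calculus,
        but \<open>T\<close> is continuous and preserves \<open>?D\<close>, so pairings with
        \<open>?D\<close> still determine the norm of \<open>T \<phi>\<close>.\<close>
      proof (rule norm_le_by_testing[of _ ?D])
        show "T \<phi> \<in> closure ?D"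
          using TD[OF f(1)] Tlim[OF f(2)] by (rule closure_seqI)
        show "0 \<le> C"
          using k by (simp add: C_def sum_nonneg)
        fix x assume "x \<in> ?D"
        then obtain p where p: "trig_calculus V \<psi> x p" by blast
        have coeff: "cinner ((V ^^ n) \<phi>) x = (\<integral>\<theta>. indicator G \<theta> * (cis (of_int (- int n) * \<theta>) * p \<theta>) \<partial>\<mu>)" for n
        proof -
          have "cinner ((V ^^ n) \<phi>) x = cinner \<phi> (zpow V (- int n) x)"
            using zpow_cinner_shift[OF V, of "int n" \<phi> 0 x] by simp
          then show ?thesis
            by (simp only: \<phi>(2)[OF trig_calculus_zpow[OF V p]])
        qed
        have int: "integrable \<mu> (\<lambda>\<theta>. cnj (b n) * (indicator G \<theta> * (cis (of_int (- int n) * \<theta>) * p \<theta>)))" for n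
          by (intro integrable_mult_right integrable_calculus(2)[OF trig_calculus_self trig_calculus_zpow[OF V p] G])
        have "cinner (T \<phi>) x = (\<Sum>n<N. \<integral>\<theta>. cnj (b n) * (indicator G \<theta> * (cis (of_int (- int n) * \<theta>) * p \<theta>)) \<partial>\<mu>)"
          by (simp only: T_def cinner_sum_left cinner_scaleC_left coeff integral_mult_right_zero)
        also have "\<dots> = (\<integral>\<theta>. (\<Sum>n<N. cnj (b n) * (indicator G \<theta> * (cis (of_int (- int n) * \<theta>) * p \<theta>))) \<partial>\<mu>)"
          by (rule Bochner_Integration.integral_sum[symmetric]) (rule int)
        also have "\<dots> = (\<integral>\<theta>. indicator G \<theta> * (cnj (q \<theta>) * p \<theta>) \<partial>\<mu>)"
          by (intro Bochner_Integration.integral_cong refl)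
            (simp add: q_def cis_cnj sum_distrib_left sum_distrib_right mult_ac)
        finally have "cmod (cinner (T \<phi>) x) \<le> sqrt (\<integral>\<theta>. (cmod (indicator G \<theta> * q \<theta>))\<^sup>2 \<partial>\<mu>) * norm x"
          using calculus_Cauchy_Schwarz[OF p q G] by simp
        also have "\<dots> \<le> C * norm x"
          unfolding C_def q_def G_def by (intro mult_right_mono real_sqrt_le_mono cutoff_energy[OF k]) simp
        finally show "inner (T \<phi>) x \<le> C * norm x"
          using complex_Re_le_cmod[of "cinner (T \<phi>) x"] by (simp add: Re_cinner)
      qed
      then have "(norm (T \<phi>))\<^sup>2 \<le> C\<^sup>2"
        by (rule power_mono) simp
      then show "(norm (\<Sum>n<N. b n *\<^sub>C (V ^^ n) \<phi>))\<^sup>2 \<le> k * (2 * pi) * (\<Sum>n<N. (cmod (b n))\<^sup>2)"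
        using k by (simp add: T_def C_def sum_nonneg)
    qed
  qed
  have "norm (\<psi> - \<phi>) \<le> sqrt (measure \<mu> (- G))"
  proof (rule norm_le_by_testing[of _ ?D])
    have "\<psi> \<in> closure ?D"
      by (rule subsetD[OF closure_subset]) (intro CollectI exI, rule trig_calculus_self)
    then show "\<psi> - \<phi> \<in> closure ?D"
      using \<phi>(1) by (intro subspace_diff subspace_closure subspace_trig_calculus)
    fix x assume "x \<in> ?D"
    then obtain p where p: "trig_calculus V \<psi> x p" by blast
    have "cinner (\<psi> - \<phi>) x = (\<integral>\<theta>. p \<theta> \<partial>\<mu>) - (\<integral>\<theta>. indicator G \<theta> * p \<theta> \<partial>\<mu>)"
      using cinner_calculus[OF trig_calculus_self p] \<phi>(2)[OF p] by (simp add: cinner_diff_left)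
    also have "\<dots> = (\<integral>\<theta>. p \<theta> - indicator G \<theta> * p \<theta> \<partial>\<mu>)"
      using integrable_calculus(1,2)[OF trig_calculus_self p G]
      by (intro Bochner_Integration.integral_diff[symmetric]) simp_all
    also have "\<dots> = (\<integral>\<theta>. indicator (- G) \<theta> * (cnj 1 * p \<theta>) \<partial>\<mu>)"
      by (intro Bochner_Integration.integral_cong refl) (auto split: split_indicator)
    finally have "cmod (cinner (\<psi> - \<phi>) x) \<le> sqrt (\<integral>\<theta>. (cmod (indicator (- G) \<theta> * 1))\<^sup>2 \<partial>\<mu>) * norm x"
      using calculus_Cauchy_Schwarz[OF p trig_calculus_self, of "- G"] G by simp
    also have "(\<integral>\<theta>. (cmod (indicator (- G) \<theta> * 1))\<^sup>2 \<partial>\<mu>) = (\<integral>\<theta>. indicator (- G) \<theta> \<partial>\<mu>)"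
      by (intro Bochner_Integration.integral_cong refl) (auto split: split_indicator)
    also have "\<dots> = measure \<mu> (- G)"
      using sets_eq_imp_space_eq[OF \<mu>(1)] by simp
    finally show "inner (\<psi> - \<phi>) x \<le> sqrt (measure \<mu> (- G)) * norm x"
      using complex_Re_le_cmod[of "cinner (\<psi> - \<phi>) x"] by (simp add: Re_cinner)
  qed simp
  then have "(norm (\<psi> - \<phi>))\<^sup>2 \<le> (sqrt (measure \<mu> (- G)))\<^sup>2"
    by (rule power_mono) simp
  moreover have "\<phi> \<in> bessel_vectors V"
    using bessel k by (auto simp: bessel_vectors_def intro!: exI[of _ "k * (2 * pi)"])
  ultimately show ?thesis by (intro bexI[of _ \<phi>]) auto
qed

text \<open>The sets discarded by the cutoffs decrease to the set where \<open>F\<close> is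
  infinite. It is \<open>\<mu>\<close>-null because \<open>F\<close> has finite integral, so the
  errors tend to zero by continuity from above.\<close>

lemma in_closure_bessel: "\<psi> \<in> closure (bessel_vectors V)"
proof -
  define A where "A k = - {\<theta>. F \<theta> \<le> ennreal (real k)}" for k :: nat
  note [measurable] = F(1)
  have A: "range A \<subseteq> sets \<mu>"
    unfolding \<mu>(1) A_def by (auto intro!: borel_comp) measurable
  have "(\<lambda>k. measure \<mu> (A k)) \<longlonglongrightarrow> measure \<mu> (\<Inter>k. A k)"
    by (rule finite_measure.finite_Lim_measure_decseq[OF \<mu>(2) A])
      (auto simp: A_def decseq_def not_le intro: order_trans[OF _ ennreal_leI])
  moreover have "measure \<mu> (\<Inter>k. A k) = 0"
  proof -
    have sp: "space lborel = space \<mu>" using sets_eq_imp_space_eq[OF \<mu>(1)] by simp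
    have fin: "(\<integral>\<^sup>+\<theta>. F \<theta> \<partial>lborel) \<noteq> \<infinity>"
    proof -
      have "emeasure \<mu> (space \<mu>) = (\<integral>\<^sup>+\<theta>. F \<theta> * indicator (space lborel) \<theta> \<partial>lborel)"
        unfolding F(2)[symmetric] by (subst emeasure_density) auto
      then show ?thesis
        using finite_measure.emeasure_finite[OF \<mu>(2), of "space \<mu>"] by simp
    qed
    have "AE \<theta> in lborel. F \<theta> \<noteq> \<infinity>"
      by (rule nn_integral_noteq_infinite[OF _ fin]) simp
    then have AE: "AE \<theta> in \<mu>. F \<theta> \<noteq> \<infinity>"
      unfolding F(2)[symmetric] by (subst AE_density) auto
    have "\<theta> \<notin> (\<Inter>k. A k)" if "F \<theta> \<noteq> \<infinity>" for \<theta>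
    proof -
      obtain r where "F \<theta> = ennreal r" "0 \<le> r"
        using \<open>F \<theta> \<noteq> \<infinity>\<close> by (cases "F \<theta>") auto
      moreover obtain k :: nat where "r \<le> real k" using real_arch_simple by blast
      ultimately show ?thesis by (auto simp: A_def intro!: exI[of _ k] ennreal_leI)
    qed
    then have "AE \<theta> in \<mu>. \<theta> \<notin> (\<Inter>k. A k)"
      using AE by (auto elim!: eventually_mono)
    then show ?thesis
      using A by (intro measure_eq_0_null_sets AE_iff_null_sets[THEN iffD2]) auto
  qed
  ultimately have lim: "(\<lambda>k. sqrt (measure \<mu> (A k))) \<longlonglongrightarrow> 0"
    using tendsto_real_sqrt by fastforce
  have "\<exists>\<phi>\<in>bessel_vectors V. (norm (\<psi> - \<phi>))\<^sup>2 \<le> measure \<mu> (A k)" for k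
    unfolding A_def by (rule approx_bessel) simp
  then obtain \<phi> where \<phi>: "\<And>k. \<phi> k \<in> bessel_vectors V" "\<And>k. (norm (\<psi> - \<phi> k))\<^sup>2 \<le> measure \<mu> (A k)"
    by metis
  have "norm (\<psi> - \<phi> k) \<le> sqrt (measure \<mu> (A k))" for k
    using \<phi>(2)[of k] by (rule real_le_rsqrt)
  then have "(\<lambda>k. dist (\<phi> k) \<psi>) \<longlonglongrightarrow> 0"
    by (intro tendsto_sandwich[OF _ _ tendsto_const lim] always_eventually)
      (simp_all add: dist_norm norm_minus_commute)
  then show ?thesis
    by (intro closure_seqI[OF \<phi>(1)]) (subst tendsto_dist_iff)
qed

end

lemma ac_vectors_subset:
  assumes V: "unitary V"
  shows "ac_vectors V \<subseteq> closure (bessel_vectors V)"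
proof
  fix \<psi> assume "\<psi> \<in> ac_vectors V"
  then obtain \<mu> where \<mu>: "sets \<mu> = sets borel" "finite_measure \<mu>" "emeasure \<mu> (- {0..<2*pi}) = 0"
    "absolutely_continuous lborel \<mu>"
    "\<And>n::nat. cinner \<psi> ((V ^^ n) \<psi>) = integral\<^sup>L \<mu> (\<lambda>\<theta>::real. exp (\<i> * of_nat n * of_real \<theta>))"
    unfolding ac_vectors_def by blast
  obtain F where "F \<in> borel_measurable borel" "density lborel F = \<mu>"
    using sigma_finite_measure.Radon_Nikodym[OF sigma_finite_lborel \<mu>(4)] \<mu>(1) by auto
  note F = this
  interpret ac_vector V \<psi> \<mu> F
  proof (rule ac_vector.intro[OF V \<mu>(1-3) F])
    show "cinner \<psi> ((V ^^ n) \<psi>) = (\<integral>\<theta>. cis (real n * \<theta>) \<partial>\<mu>)" for n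
      unfolding \<mu>(5) by (simp add: cis_conv_exp mult_ac)
  qed
  show "\<psi> \<in> closure (bessel_vectors V)"
    by (rule in_closure_bessel)
qed

section \<open>Densities as limits of Fejer means\<close>

lemma cesaro_null:
  fixes a :: "nat \<Rightarrow> real"
  assumes "a \<longlonglongrightarrow> 0"
  shows "(\<lambda>N. (\<Sum>m<N. a m) / N) \<longlonglongrightarrow> 0"
proof (rule LIMSEQ_I)
  fix e :: real assume e: "0 < e"
  then obtain M where M: "\<And>m. M \<le> m \<Longrightarrow> \<bar>a m\<bar> < e / 2"
    using LIMSEQ_D[OF assms, of "e / 2"] by auto
  define K where "K = (\<Sum>m<M. \<bar>a m\<bar>)"
  have K: "0 \<le> K" unfolding K_def by (rule sum_nonneg) simp
  obtain N0 :: nat where N0: "2 * K / e < real N0" using reals_Archimedean2 by blast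
  have "\<bar>(\<Sum>m<N. a m) / N\<bar> < e" if N: "max (Suc M) N0 \<le> N" for N
  proof -
    have "\<bar>\<Sum>m<N. a m\<bar> \<le> (\<Sum>m<N. \<bar>a m\<bar>)" by (rule sum_abs)
    also have "\<dots> = K + (\<Sum>m=M..<N. \<bar>a m\<bar>)"
      using N unfolding K_def atLeast0LessThan[symmetric] by (subst sum.atLeastLessThan_concat) auto
    also have "(\<Sum>m=M..<N. \<bar>a m\<bar>) \<le> (\<Sum>m=M..<N. e / 2)"
      using M by (intro sum_mono less_imp_le) auto
    also have "\<dots> \<le> real N * (e / 2)"
      using e by (simp add: mult_right_mono)
    finally have "\<bar>\<Sum>m<N. a m\<bar> \<le> K + real N * (e / 2)" by simp
    also have "K < real N * (e / 2)"
    proof -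
      have "2 * K < real N0 * e" using N0 e by (simp add: field_simps)
      also have "\<dots> \<le> real N * e" using N e by (intro mult_right_mono) auto
      finally show ?thesis by simp
    qed
    finally have "\<bar>\<Sum>m<N. a m\<bar> < e * real N" by (simp add: algebra_simps)
    then show ?thesis
      using N by (simp add: abs_divide divide_less_eq)
  qed
  then show "\<exists>no. \<forall>n\<ge>no. norm ((\<Sum>m<n. a m) / n - 0) < e"
    by (intro exI[of _ "max (Suc M) N0"]) auto
qed

text \<open>Riesz-Fischer: along a fast subsequence the telescoping series converges absolutely
  almost everywhere, and Fatou's lemma carries the Cauchy estimate of the whole sequence over to the
  limit.\<close>

lemma L1_complete:
  fixes f :: "nat \<Rightarrow> 'a \<Rightarrow> real"
  assumes f: "\<And>n. integrable M (f n)"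
    and Cauchy: "\<And>e. 0 < e \<Longrightarrow> \<exists>N. \<forall>m\<ge>N. \<forall>n\<ge>N. (\<integral>x. \<bar>f m x - f n x\<bar> \<partial>M) \<le> e"
  obtains g where "integrable M g" "(\<lambda>n. \<integral>x. \<bar>f n x - g x\<bar> \<partial>M) \<longlonglongrightarrow> 0"
proof -
  have [measurable]: "f n \<in> borel_measurable M" for n using f by auto
  obtain S where S: "\<And>k m n. S k \<le> m \<Longrightarrow> S k \<le> n \<Longrightarrow> (\<integral>x. \<bar>f m x - f n x\<bar> \<partial>M) \<le> (1/2)^k"
    using Cauchy[of "(1/2)^_"] by (metis zero_less_power half_gt_zero zero_less_one)
  \<comment> \<open>Summing the thresholds gives a monotone index sequence that still dominates
    every \<open>S k\<close>.\<close>
  define r where "r k = (\<Sum>i\<le>k. S i)" for k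
  have r: "S k \<le> r k" "r k \<le> r (Suc k)" for k
    by (simp_all add: r_def) (cases k, auto)
  define h where "h k x = f (r (Suc k)) x - f (r k) x" for k x
  have h_int: "(\<integral>x. \<bar>h k x\<bar> \<partial>M) \<le> (1/2)^k" for k
    unfolding h_def using r[of k] by (intro S) auto
  have hi: "integrable M (\<lambda>x. \<bar>h k x\<bar>)" for k
    unfolding h_def by (intro integrable_abs Bochner_Integration.integrable_diff f)
  have [measurable]: "h k \<in> borel_measurable M" for k
    unfolding h_def by measurable
  have "(\<integral>\<^sup>+x. (\<Sum>k. ennreal \<bar>h k x\<bar>) \<partial>M) = (\<Sum>k. \<integral>\<^sup>+x. ennreal \<bar>h k x\<bar> \<partial>M)"
    by (rule nn_integral_suminf) measurable
  also have "\<dots> \<le> (\<Sum>k. ennreal ((1/2)^k))"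
    by (intro suminf_le summableI) (simp add: nn_integral_eq_integral[OF hi] h_int ennreal_leI)
  also have "\<dots> = ennreal 2"
  proof -
    have "(\<Sum>k. ennreal ((1/2)^k)) = ennreal (\<Sum>k. (1/2)^k)"
      by (rule suminf_ennreal2) (auto intro: summable_geometric)
    moreover have "(\<Sum>k. (1/2)^k :: real) = 2"
      using suminf_geometric[of "1/2 :: real"] by simp
    ultimately show ?thesis by simp
  qed
  finally have "(\<integral>\<^sup>+x. (\<Sum>k. ennreal \<bar>h k x\<bar>) \<partial>M) \<noteq> \<infinity>"
    by (auto simp: top_unique)
  then have "AE x in M. (\<Sum>k. ennreal \<bar>h k x\<bar>) \<noteq> \<infinity>"
    by (intro nn_integral_noteq_infinite) measurable
  then have conv: "AE x in M. (\<lambda>k. f (r k) x) \<longlonglongrightarrow> lim (\<lambda>k. f (r k) x)"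
  proof (rule eventually_mono)
    fix x assume "(\<Sum>k. ennreal \<bar>h k x\<bar>) \<noteq> \<infinity>"
    then have "summable (\<lambda>k. \<bar>h k x\<bar>)"
      by (intro summable_suminf_not_top) (auto simp: infinity_ennreal_def)
    then have "summable (\<lambda>k. h k x)" by (rule summable_rabs_cancel)
    then have "convergent (\<lambda>n. f (r 0) x + (\<Sum>k<n. h k x))"
      by (intro convergent_add convergent_const) (simp add: summable_iff_convergent)
    moreover have "f (r 0) x + (\<Sum>k<n. h k x) = f (r n) x" for n
      unfolding h_def using sum_lessThan_telescope[of "\<lambda>k. f (r k) x" n] by simp
    ultimately show "(\<lambda>k. f (r k) x) \<longlonglongrightarrow> lim (\<lambda>k. f (r k) x)"
      by (simp add: convergent_LIMSEQ_iff)
  qed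
  \<comment> \<open>Where the subsequence diverges, \<open>lim\<close> is an unspecified value; this
    happens only on a null set.\<close>
  define g where "g x = lim (\<lambda>k. f (r k) x)" for x
  have [measurable]: "g \<in> borel_measurable M"
    unfolding g_def by measurable
  have rk: "k \<le> n \<Longrightarrow> r k \<le> r n" for k n
    using r(2) by (rule lift_Suc_mono_le)
  have le: "(\<integral>\<^sup>+x. ennreal \<bar>f n x - g x\<bar> \<partial>M) \<le> ennreal ((1/2)^k)" if n: "S k \<le> n" for n k
  proof -
    have "(\<integral>\<^sup>+x. ennreal \<bar>f n x - g x\<bar> \<partial>M) = (\<integral>\<^sup>+x. liminf (\<lambda>j. ennreal \<bar>f n x - f (r j) x\<bar>) \<partial>M)"
    proof (rule nn_integral_cong_AE, use conv in \<open>rule eventually_mono\<close>)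
      fix x assume "(\<lambda>k. f (r k) x) \<longlonglongrightarrow> lim (\<lambda>k. f (r k) x)"
      then have "(\<lambda>j. ennreal \<bar>f n x - f (r j) x\<bar>) \<longlonglongrightarrow> ennreal \<bar>f n x - g x\<bar>"
        unfolding g_def by (intro tendsto_ennrealI tendsto_rabs tendsto_diff tendsto_const)
      then show "ennreal \<bar>f n x - g x\<bar> = liminf (\<lambda>j. ennreal \<bar>f n x - f (r j) x\<bar>)"
        by (intro lim_imp_Liminf[symmetric]) simp_all
    qed
    also have "\<dots> \<le> liminf (\<lambda>j. \<integral>\<^sup>+x. ennreal \<bar>f n x - f (r j) x\<bar> \<partial>M)"
      by (rule nn_integral_liminf) measurable
    also have "\<dots> \<le> liminf (\<lambda>j. ennreal ((1/2)^k))"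
    proof (rule Liminf_mono, rule eventually_sequentiallyI[of k])
      fix j assume "k \<le> j"
      then have "S k \<le> r j" using r(1)[of k] rk by (meson order_trans)
      then show "(\<integral>\<^sup>+x. ennreal \<bar>f n x - f (r j) x\<bar> \<partial>M) \<le> ennreal ((1/2)^k)"
        using S[OF n, of "r j"] f by (subst nn_integral_eq_integral) (auto intro!: ennreal_leI)
    qed
    finally show ?thesis by (simp add: Liminf_const)
  qed
  have gi: "integrable M (\<lambda>x. f n x - g x)" if n: "S k \<le> n" for n k
    unfolding integrable_iff_bounded using le[OF n] by (auto simp: le_less_trans)
  have gI: "integrable M g"
    using Bochner_Integration.integrable_diff[OF f gi[OF order_refl], of "S 0" 0] by simp
  have bd: "(\<integral>x. \<bar>f n x - g x\<bar> \<partial>M) \<le> (1/2)^k" if n: "S k \<le> n" for n k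
  proof -
    have "ennreal (\<integral>x. \<bar>f n x - g x\<bar> \<partial>M) \<le> ennreal ((1/2)^k)"
      using le[OF n] by (subst nn_integral_eq_integral[symmetric]) (use gi[OF n] in auto)
    then show ?thesis by (simp add: ennreal_le_iff)
  qed
  have "(\<lambda>n. \<integral>x. \<bar>f n x - g x\<bar> \<partial>M) \<longlonglongrightarrow> 0"
  proof (rule LIMSEQ_I)
    fix e :: real assume "0 < e"
    then obtain k where k: "(1/2)^k < e"
      using real_arch_pow_inv[of e "1/2"] by auto
    have "norm ((\<integral>x. \<bar>f n x - g x\<bar> \<partial>M) - 0) < e" if "S k \<le> n" for n
      using bd[OF that] k by simp
    then show "\<exists>no. \<forall>n\<ge>no. norm ((\<integral>x. \<bar>f n x - g x\<bar> \<partial>M) - 0) < e"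
      by blast
  qed
  with gI that show thesis by blast
qed

text \<open>The two sums are arranged to be literally the cross terms that appear when the vector of
  index \<open>N\<close> is added to a trigonometric mean.\<close>

lemma sum_symmetric_interval:
  fixes g :: "int \<Rightarrow> 'b::comm_monoid_add"
  shows "(\<Sum>n\<in>{- int N..int N}. g n) = g 0 + ((\<Sum>j<N. g (int N - int j)) + (\<Sum>j<N. g (int j - int N)))"
proof -
  let ?A = "(\<lambda>j. int N - int j) ` {..<N}" and ?B = "(\<lambda>j. int j - int N) ` {..<N}"
  have "{- int N..int N} = insert 0 (?A \<union> ?B)"
  proof (intro equalityI subsetI)
    fix x assume x: "x \<in> {- int N..int N}"
    consider "x = 0" | "x > 0" | "x < 0" by linarith
    then show "x \<in> insert 0 (?A \<union> ?B)"
    proof cases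
      case 2
      then have "x \<in> ?A" using x by (intro image_eqI[of _ _ "nat (int N - x)"]) auto
      then show ?thesis by blast
    next
      case 3
      then have "x \<in> ?B" using x by (intro image_eqI[of _ _ "nat (int N + x)"]) auto
      then show ?thesis by blast
    qed simp
  qed auto
  then have "(\<Sum>n\<in>{- int N..int N}. g n) = (\<Sum>n\<in>insert 0 (?A \<union> ?B). g n)" by simp
  also have "\<dots> = g 0 + (\<Sum>n\<in>?A \<union> ?B. g n)"
    by (rule sum.insert) auto
  also have "(\<Sum>n\<in>?A \<union> ?B. g n) = sum g ?A + sum g ?B"
    by (rule sum.union_disjoint) auto
  finally show ?thesis
    by (simp add: sum.reindex inj_on_def)
qed

section \<open>Dirichlet and Fejer sums of an orbit\<close>

definition trig_mean :: "('a::complex_hilbert \<Rightarrow> 'a) \<Rightarrow> nat \<Rightarrow> 'a \<Rightarrow> real \<Rightarrow> 'a" where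
  "trig_mean V N \<psi> \<theta> = (\<Sum>j<N. cis (- real j * \<theta>) *\<^sub>C (V ^^ j) \<psi>)"

text \<open>Up to the factor \<open>2 * pi\<close>, the symmetric partial Fourier sum of the
  spectral measure. The minus sign reflects that the coefficient of
  \<open>cis (n * \<theta>)\<close> is the integral of its conjugate.\<close>

definition dirichlet :: "('a::complex_hilbert \<Rightarrow> 'a) \<Rightarrow> nat \<Rightarrow> 'a \<Rightarrow> real \<Rightarrow> complex" where
  "dirichlet V m \<psi> \<theta> = (\<Sum>n\<in>{- int m..int m}. cinner \<psi> (zpow V (- n) \<psi>) * cis (of_int n * \<theta>))"

text \<open>The Cesaro mean of the partial Fourier sums, written as a square so that it is visibly
  nonnegative. Positivity gives an \<open>L1\<close> bound independent of \<open>N\<close>.\<close>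

definition fejer :: "('a::complex_hilbert \<Rightarrow> 'a) \<Rightarrow> nat \<Rightarrow> 'a \<Rightarrow> real \<Rightarrow> real" where
  "fejer V N \<psi> \<theta> = (norm (trig_mean V N \<psi> \<theta>))\<^sup>2 / (2 * pi * N)"

context
  fixes V :: "'a::complex_hilbert \<Rightarrow> 'a"
  assumes V: "unitary V"
begin

text \<open>Adding the vector of index \<open>N\<close> contributes its own square and two cross
  terms, whose frequencies run through \<open>1..N\<close> and their negatives. Together these form
  the Dirichlet sum of order \<open>N\<close>.\<close>

lemma trig_mean_norm:
  "complex_of_real ((norm (trig_mean V N \<psi> \<theta>))\<^sup>2) = (\<Sum>m<N. dirichlet V m \<psi> \<theta>)"
proof (induction N)
  case 0
  then show ?case by (simp add: trig_mean_def)
next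
  case (Suc N)
  let ?S = "trig_mean V N \<psi> \<theta>" and ?w = "cis (- real N * \<theta>) *\<^sub>C (V ^^ N) \<psi>"
  have c: "cinner ((V ^^ i) \<psi>) ((V ^^ j) \<psi>) = cinner \<psi> (zpow V (int j - int i) \<psi>)" for i j
    using zpow_cinner_shift[OF V, of "int i" \<psi> "int j" \<psi>] by simp
  have ww: "cinner ?w ?w = cinner \<psi> \<psi>"
    using c[of N N] by (simp add: cinner_scaleC_left cinner_scaleC_right cis_cnj cis_mult)
  have Sw: "cinner ?S ?w = (\<Sum>j<N. cinner \<psi> (zpow V (- (int j - int N)) \<psi>) * cis (of_int (int j - int N) * \<theta>))"
    unfolding trig_mean_def cinner_sum_left cinner_scaleC_left cinner_scaleC_right c sum_distrib_left
    by (intro sum.cong refl) (simp add: cis_cnj cis_mult left_diff_distrib mult.assoc[symmetric])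
  have wS: "cinner ?w ?S = (\<Sum>j<N. cinner \<psi> (zpow V (- (int N - int j)) \<psi>) * cis (of_int (int N - int j) * \<theta>))"
    unfolding trig_mean_def cinner_sum_right cinner_scaleC_left cinner_scaleC_right c sum_distrib_left
    by (intro sum.cong refl) (simp add: cis_cnj cis_mult left_diff_distrib mult.assoc[symmetric])
  have "complex_of_real ((norm (trig_mean V (Suc N) \<psi> \<theta>))\<^sup>2) = cinner (?S + ?w) (?S + ?w)"
    unfolding cinner_self by (simp add: trig_mean_def)
  also have "\<dots> = cinner ?S ?S + (cinner ?w ?w + (cinner ?w ?S + cinner ?S ?w))"
    by (simp only: cinner_add_left cinner_add_right) (simp add: add_ac)
  also have "cinner ?w ?w + (cinner ?w ?S + cinner ?S ?w) = dirichlet V N \<psi> \<theta>"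
    unfolding ww wS Sw dirichlet_def sum_symmetric_interval by simp
  finally show ?case
    unfolding cinner_self[of ?S] using Suc by simp
qed

lemma fejer_eq: "fejer V N \<psi> \<theta> = (\<Sum>m<N. Re (dirichlet V m \<psi> \<theta>) / (2 * pi)) / N"
  using arg_cong[OF trig_mean_norm[of N \<psi> \<theta>], of Re]
  by (simp add: fejer_def sum_divide_distrib[symmetric])

lemma dirichlet_measurable [measurable]: "dirichlet V m \<psi> \<in> borel_measurable borel"
  unfolding dirichlet_def by (rule trig_sum_measurable)

lemma dirichlet_bounded: "cmod (dirichlet V m \<psi> \<theta>) \<le> (\<Sum>n\<in>{- int m..int m}. cmod (cinner \<psi> (zpow V (- n) \<psi>)))"
  unfolding dirichlet_def by (rule trig_sum_bound)

lemma integrable_dirichlet: "integrable circle (\<lambda>\<theta>. Re (dirichlet V m \<psi> \<theta>) / (2 * pi))"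
proof (intro integrable_divide integrable_Re)
  show "integrable circle (dirichlet V m \<psi>)"
    by (rule integrable_circle_bounded[OF dirichlet_measurable dirichlet_bounded])
qed

lemma integrable_fejer: "integrable circle (fejer V N \<psi>)"
  unfolding fejer_eq
  by (rule integrable_divide, rule Bochner_Integration.integrable_sum, rule integrable_dirichlet)

lemma dirichlet_coeff:
  "(\<integral>\<theta>. dirichlet V m \<psi> \<theta> * cis (real k * \<theta>) \<partial>circle) = (if k \<le> m then 2 * pi * cinner \<psi> ((V ^^ k) \<psi>) else 0)"
proof -
  let ?c = "\<lambda>n. cinner \<psi> (zpow V (- n) \<psi>)"
  have int: "integrable circle (\<lambda>\<theta>. ?c n * cis (of_int (n + int k) * \<theta>))" for n
    by (rule integrable_circle_bounded[of _ "cmod (?c n)"])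
      (auto simp: norm_mult intro!: borel_measurable_times borel_measurable_const cis_measurable)
  have "(\<integral>\<theta>. dirichlet V m \<psi> \<theta> * cis (real k * \<theta>) \<partial>circle)
      = (\<integral>\<theta>. (\<Sum>n\<in>{- int m..int m}. ?c n * cis (of_int (n + int k) * \<theta>)) \<partial>circle)"
    by (intro Bochner_Integration.integral_cong refl)
      (simp add: dirichlet_def sum_distrib_right mult.assoc cis_mult distrib_right)
  also have "\<dots> = (\<Sum>n\<in>{- int m..int m}. ?c n * (\<integral>\<theta>. cis (of_int (n + int k) * \<theta>) \<partial>circle))"
    by (subst Bochner_Integration.integral_sum[OF int]) (simp only: integral_mult_right_zero)
  also have "\<dots> = (\<Sum>n\<in>{- int m..int m}. if n = - int k then ?c n * complex_of_real (2 * pi) else 0)"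
    unfolding integral_circle_cis by (intro sum.cong refl) auto
  also have "\<dots> = (if k \<le> m then 2 * pi * cinner \<psi> ((V ^^ k) \<psi>) else 0)"
    by (simp add: sum.delta)
  finally show ?thesis .
qed

text \<open>Frequency \<open>k\<close> is present exactly in the Dirichlet sums of order
  \<open>k, ..., N - 1\<close>; truncated subtraction gives the correct value zero when
  \<open>N \<le> k\<close>.\<close>

lemma fejer_coeff:
  "(\<integral>\<theta>. complex_of_real (fejer V N \<psi> \<theta>) * cis (real k * \<theta>) \<partial>circle) = (real (N - k) / N) * cinner \<psi> ((V ^^ k) \<psi>)"
proof -
  have int: "integrable circle (\<lambda>\<theta>. dirichlet V m \<psi> \<theta> * cis (real k * \<theta>))" for m
    by (rule integrable_circle_bounded[of _ "\<Sum>n\<in>{- int m..int m}. cmod (cinner \<psi> (zpow V (- n) \<psi>))"])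
      (auto simp: norm_mult dirichlet_bounded intro!: borel_measurable_times dirichlet_measurable cis_measurable)
  have "complex_of_real (fejer V N \<psi> \<theta>) * cis (real k * \<theta>)
      = (1 / (2 * pi * N)) * (\<Sum>m<N. dirichlet V m \<psi> \<theta> * cis (real k * \<theta>))" for \<theta>
  proof -
    have "complex_of_real (fejer V N \<psi> \<theta>) = (1 / (2 * pi * N)) * complex_of_real ((norm (trig_mean V N \<psi> \<theta>))\<^sup>2)"
      by (simp add: fejer_def)
    then show ?thesis
      unfolding trig_mean_norm by (simp add: sum_distrib_right)
  qed
  then have "(\<integral>\<theta>. complex_of_real (fejer V N \<psi> \<theta>) * cis (real k * \<theta>) \<partial>circle)
      = (1 / (2 * pi * N)) * (\<integral>\<theta>. (\<Sum>m<N. dirichlet V m \<psi> \<theta> * cis (real k * \<theta>)) \<partial>circle)"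
    by (simp only: integral_mult_right_zero)
  also have "\<dots> = (1 / (2 * pi * N)) * (\<Sum>m<N. if k \<le> m then 2 * pi * cinner \<psi> ((V ^^ k) \<psi>) else 0)"
    by (simp only: Bochner_Integration.integral_sum[OF int] dirichlet_coeff)
  also have "(\<Sum>m<N. if k \<le> m then 2 * pi * cinner \<psi> ((V ^^ k) \<psi>) else 0) = (\<Sum>m=k..<N. 2 * pi * cinner \<psi> ((V ^^ k) \<psi>))"
    by (rule sum.mono_neutral_cong_right) auto
  finally show ?thesis by simp
qed

lemma fejer_integral: "0 < N \<Longrightarrow> (\<integral>\<theta>. fejer V N \<psi> \<theta> \<partial>circle) = (norm \<psi>)\<^sup>2"
  using fejer_coeff[of N \<psi> 0] unfolding cinner_self
  by (simp add: integral_complex_of_real cinner_self del: of_real_power)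

lemma fejer_nonneg: "0 \<le> fejer V N \<psi> \<theta>"
  by (simp add: fejer_def)

text \<open>The pointwise difference of squares is split by a weighted arithmetic-geometric
  inequality with weight \<open>d = norm (\<psi> - \<phi>)\<close>. Every resulting term is a Fejer
  mean of known integral, so \<open>N\<close> disappears; the \<open>1 / 2\<close> comes from
  \<open>d\<^sup>2 / (2 * d)\<close>.\<close>

lemma fejer_Lipschitz:
  assumes "0 < N"
  shows "(\<integral>\<theta>. \<bar>fejer V N \<psi> \<theta> - fejer V N \<phi> \<theta>\<bar> \<partial>circle) \<le> norm (\<psi> - \<phi>) * (1 / 2 + (norm \<psi>)\<^sup>2 + (norm \<phi>)\<^sup>2)"
proof (cases "\<psi> = \<phi>")
  case False
  define d where "d = norm (\<psi> - \<phi>)"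
  have d: "0 < d" using False by (simp add: d_def)
  have pt: "\<bar>fejer V N \<psi> \<theta> - fejer V N \<phi> \<theta>\<bar> \<le> 1 / (2 * d) * fejer V N (\<psi> - \<phi>) \<theta> + d * (fejer V N \<psi> \<theta> + fejer V N \<phi> \<theta>)" for \<theta>
  proof -
    let ?x = "norm (trig_mean V N \<psi> \<theta>)" and ?y = "norm (trig_mean V N \<phi> \<theta>)"
      and ?z = "norm (trig_mean V N (\<psi> - \<phi>) \<theta>)"
    have "trig_mean V N (\<psi> - \<phi>) \<theta> = trig_mean V N \<psi> \<theta> - trig_mean V N \<phi> \<theta>"
      by (simp add: trig_mean_def unitary_diff[OF unitary_funpow[OF V]] scaleC_diff_right sum_subtractf)
    then have z: "\<bar>?x - ?y\<bar> \<le> ?z"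
      by (simp add: norm_triangle_ineq3)
    have "\<bar>?x\<^sup>2 - ?y\<^sup>2\<bar> = \<bar>?x - ?y\<bar> * (?x + ?y)"
      by (simp add: power2_eq_square square_diff_square_factored abs_mult mult.commute)
    also have "\<dots> \<le> ?z * (?x + ?y)"
      using z by (intro mult_right_mono) auto
    also have "\<dots> \<le> 1 / (2 * d) * ?z\<^sup>2 + d * (?x\<^sup>2 + ?y\<^sup>2)"
    proof -
      \<comment> \<open>The second square supplies the remainder of
        \<open>(?x + ?y)\<^sup>2 \<le> 2 * (?x\<^sup>2 + ?y\<^sup>2)\<close>, so both estimates are
        made at once.\<close>
      have "0 \<le> (?z - d * (?x + ?y))\<^sup>2 + d\<^sup>2 * (?x - ?y)\<^sup>2" by simp
      then have "?z * (?x + ?y) * (2 * d) \<le> ?z\<^sup>2 + d * (?x\<^sup>2 + ?y\<^sup>2) * (2 * d)"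
        by (simp add: power2_eq_square algebra_simps)
      then show ?thesis using d by (simp add: field_simps)
    qed
    finally have "\<bar>?x\<^sup>2 - ?y\<^sup>2\<bar> / (2 * pi * N) \<le> (1 / (2 * d) * ?z\<^sup>2 + d * (?x\<^sup>2 + ?y\<^sup>2)) / (2 * pi * N)"
      by (intro divide_right_mono) auto
    moreover have "\<bar>?x\<^sup>2 - ?y\<^sup>2\<bar> / (2 * pi * N) = \<bar>fejer V N \<psi> \<theta> - fejer V N \<phi> \<theta>\<bar>"
      by (simp add: fejer_def diff_divide_distrib[symmetric] abs_divide)
    ultimately show ?thesis
      by (simp add: fejer_def add_divide_distrib distrib_left)
  qed
  have "(\<integral>\<theta>. \<bar>fejer V N \<psi> \<theta> - fejer V N \<phi> \<theta>\<bar> \<partial>circle)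
      \<le> (\<integral>\<theta>. 1 / (2 * d) * fejer V N (\<psi> - \<phi>) \<theta> + d * (fejer V N \<psi> \<theta> + fejer V N \<phi> \<theta>) \<partial>circle)"
    by (intro integral_mono integrable_abs Bochner_Integration.integrable_diff Bochner_Integration.integrable_add
        integrable_mult_right integrable_fejer pt)
  also have "\<dots> = 1 / (2 * d) * d\<^sup>2 + d * ((norm \<psi>)\<^sup>2 + (norm \<phi>)\<^sup>2)"
    using assms by (simp add: integrable_fejer fejer_integral d_def)
  also have "\<dots> = d * (1 / 2 + (norm \<psi>)\<^sup>2 + (norm \<phi>)\<^sup>2)"
    using d by (simp add: power2_eq_square field_simps)
  finally show ?thesis by (simp add: d_def)
qed simp

text \<open>The moments of order \<open>-m..m\<close> are the pairings of the single vector
  \<open>(V ^^ m) \<phi>\<close> with the first \<open>2 * m + 1\<close> orbit vectors. Its norm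
  does not depend on \<open>m\<close>, and one Bessel bound serves all partial sums.\<close>

lemma bessel_coeff_convergent:
  assumes "\<phi> \<in> bessel_vectors V"
  shows "convergent (\<lambda>m. \<Sum>n\<in>{- int m..int m}. (cmod (cinner \<phi> (zpow V (- n) \<phi>)))\<^sup>2)"
proof -
  obtain B where B: "B \<ge> 0" "bessel B (\<lambda>n. (V ^^ n) \<phi>)"
    using assms by (auto simp: bessel_vectors_def)
  let ?C = "\<lambda>m. \<Sum>n\<in>{- int m..int m}. (cmod (cinner \<phi> (zpow V (- n) \<phi>)))\<^sup>2"
  have "?C m \<le> B * (norm \<phi>)\<^sup>2" for m
  proof -
    have im: "{- int m..int m} = (\<lambda>j. int m - int j) ` {..<Suc (2 * m)}"
    proof (intro equalityI subsetI)
      fix x assume "x \<in> {- int m..int m}"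
      then show "x \<in> (\<lambda>j. int m - int j) ` {..<Suc (2 * m)}"
        by (intro image_eqI[of _ _ "nat (int m - x)"]) auto
    qed auto
    have "?C m = (\<Sum>j<Suc (2 * m). (cmod (cinner \<phi> (zpow V (- (int m - int j)) \<phi>)))\<^sup>2)"
      unfolding im by (subst sum.reindex) (auto simp: inj_on_def)
    also have "\<dots> = (\<Sum>j<Suc (2 * m). (cmod (cinner ((V ^^ m) \<phi>) ((V ^^ j) \<phi>)))\<^sup>2)"
      using zpow_cinner_shift[OF V, of "int m" \<phi> "int _" \<phi>] by simp
    also have "\<dots> \<le> B * (norm ((V ^^ m) \<phi>))\<^sup>2"
      by (rule besselD[OF B(2)])
    finally show ?thesis
      by (simp only: unitary_norm[OF unitary_funpow[OF V]])
  qed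
  moreover have "incseq ?C"
    by (intro incseq_SucI sum_mono2) auto
  ultimately show ?thesis
    using incseq_convergent[of ?C "B * (norm \<phi>)\<^sup>2"] convergentI by blast
qed

text \<open>Parseval measures the difference in \<open>L2\<close> by the moments in the band
  \<open>J\<close>, and the finite mass of the circle turns this into an \<open>L1\<close> estimate
  at the price of \<open>sqrt (2 * pi)\<close>.\<close>

lemma dirichlet_Cauchy:
  assumes "\<phi> \<in> bessel_vectors V" and e: "0 < e"
  shows "\<exists>N. \<forall>m\<ge>N. \<forall>l\<ge>N. (\<integral>\<theta>. \<bar>Re (dirichlet V m \<phi> \<theta>) / (2 * pi) - Re (dirichlet V l \<phi> \<theta>) / (2 * pi)\<bar> \<partial>circle) \<le> e"
proof -
  define C where "C m = (\<Sum>n\<in>{- int m..int m}. (cmod (cinner \<phi> (zpow V (- n) \<phi>)))\<^sup>2)" for m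
  let ?b = "\<lambda>n. cinner \<phi> (zpow V (- n) \<phi>)"
  let ?I = "\<lambda>m l. (\<integral>\<theta>. \<bar>Re (dirichlet V m \<phi> \<theta>) / (2 * pi) - Re (dirichlet V l \<phi> \<theta>) / (2 * pi)\<bar> \<partial>circle)"
  have "Cauchy C"
    using bessel_coeff_convergent[OF assms(1)] unfolding C_def by (rule convergent_Cauchy)
  then obtain N where N: "\<And>m l. N \<le> m \<Longrightarrow> N \<le> l \<Longrightarrow> \<bar>C m - C l\<bar> < e\<^sup>2"
    using e unfolding Cauchy_def dist_real_def by (meson zero_less_power)
  have main: "?I m l \<le> e" if "N \<le> l" "l \<le> m" for m l
  proof -
    define J where "J = {- int m..int m} - {- int l..int l}"
    have sub: "{- int l..int l} \<subseteq> {- int m..int m}" using that by auto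
    define D where "D \<theta> = dirichlet V m \<phi> \<theta> - dirichlet V l \<phi> \<theta>" for \<theta>
    have D: "D \<theta> = (\<Sum>n\<in>J. ?b n * cis (of_int n * \<theta>))" for \<theta>
      unfolding D_def dirichlet_def J_def by (subst sum_diff) (use sub in auto)
    have D_meas: "D \<in> borel_measurable borel"
      unfolding D_def by measurable
    have D_bd: "cmod (D \<theta>) \<le> (\<Sum>n\<in>J. cmod (?b n))" for \<theta>
      unfolding D by (rule trig_sum_bound)
    have D2: "integrable circle (\<lambda>\<theta>. (cmod (D \<theta>))\<^sup>2)"
      using D_meas by (intro integrable_circle_bounded[of _ "(\<Sum>n\<in>J. cmod (?b n))\<^sup>2"]) (auto intro!: power_mono D_bd)
    have one: "integrable circle (\<lambda>\<theta>. (cmod 1)\<^sup>2)"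
      by (rule integrable_circle_bounded[of _ 1]) auto
    have Di: "integrable circle (\<lambda>\<theta>. cmod (D \<theta>))"
      using D_meas by (intro integrable_circle_bounded[of _ "\<Sum>n\<in>J. cmod (?b n)"]) (auto intro!: D_bd)
    have "(\<integral>\<theta>. cmod (D \<theta>) \<partial>circle) = cmod (\<integral>\<theta>. complex_of_real (cmod (D \<theta>)) * 1 \<partial>circle)"
      by (simp add: integral_complex_of_real integral_nonneg_AE)
    also have "\<dots> \<le> sqrt (\<integral>\<theta>. (cmod (complex_of_real (cmod (D \<theta>))))\<^sup>2 \<partial>circle) * sqrt (\<integral>\<theta>. (cmod 1)\<^sup>2 \<partial>circle)"
      using D_meas by (intro integral_Cauchy_Schwarz measurable_circle) (use D2 one in auto)
    also have "\<dots> = sqrt (2 * pi * (\<Sum>n\<in>J. (cmod (?b n))\<^sup>2)) * sqrt (2 * pi)"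
    proof -
      have "(\<integral>\<theta>. (cmod (complex_of_real (cmod (D \<theta>))))\<^sup>2 \<partial>circle) = 2 * pi * (\<Sum>n\<in>J. (cmod (?b n))\<^sup>2)"
        using parseval_trig[of J ?b] by (simp add: D J_def)
      moreover have "(\<integral>\<theta>. (cmod 1)\<^sup>2 \<partial>circle) = 2 * pi"
        by (simp add: circle_def measure_restrict_space space_restrict_space)
      ultimately show ?thesis by simp
    qed
    also have "(\<Sum>n\<in>J. (cmod (?b n))\<^sup>2) = C m - C l"
      unfolding C_def J_def by (rule sum_diff) (use sub in auto)
    also have "sqrt (2 * pi * (C m - C l)) * sqrt (2 * pi) = 2 * pi * sqrt (C m - C l)"
    proof -
      have "sqrt (2 * pi * x) * sqrt (2 * pi) = 2 * pi * sqrt x" for x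
        using real_sqrt_mult_self[of "2 * pi"] unfolding real_sqrt_mult[of "2 * pi" x]
        by (metis abs_of_pos mult.assoc mult.commute pi_gt_zero zero_less_mult_iff zero_less_numeral)
      then show ?thesis .
    qed
    also have "\<dots> \<le> 2 * pi * e"
    proof -
      have "sqrt (C m - C l) \<le> sqrt (e\<^sup>2)"
        using N[of m l] that by (intro real_sqrt_le_mono) auto
      then show ?thesis using e by simp
    qed
    finally have cmodD: "(\<integral>\<theta>. cmod (D \<theta>) \<partial>circle) \<le> 2 * pi * e" .
    have "?I m l \<le> (\<integral>\<theta>. cmod (D \<theta>) / (2 * pi) \<partial>circle)"
    proof (intro integral_mono integrable_abs Bochner_Integration.integrable_diff integrable_dirichlet integrable_divide Di)
      fix \<theta>
      have "\<bar>Re (dirichlet V m \<phi> \<theta>) / (2 * pi) - Re (dirichlet V l \<phi> \<theta>) / (2 * pi)\<bar> = \<bar>Re (D \<theta>)\<bar> / (2 * pi)"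
        by (simp add: D_def diff_divide_distrib[symmetric] abs_divide)
      also have "\<dots> \<le> cmod (D \<theta>) / (2 * pi)"
        by (intro divide_right_mono abs_Re_le_cmod) simp
      finally show "\<bar>Re (dirichlet V m \<phi> \<theta>) / (2 * pi) - Re (dirichlet V l \<phi> \<theta>) / (2 * pi)\<bar> \<le> cmod (D \<theta>) / (2 * pi)" .
    qed
    also have "\<dots> \<le> e"
      using cmodD by (simp add: divide_le_eq mult.commute)
    finally show ?thesis .
  qed
  have sym: "?I m l = ?I l m" for m l
    by (simp only: abs_minus_commute)
  show ?thesis
  proof (intro exI allI impI)
    fix m l assume "N \<le> m" "N \<le> l"
    then show "?I m l \<le> e"
      using main[of l m] main[of m l] sym[of m l] by (cases "l \<le> m") auto
  qed
qed

text \<open>A Fejer mean averages Dirichlet sums, so its \<open>L1\<close> error is at most the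
  Cesaro mean of their errors.\<close>

lemma fejer_converges_bessel:
  assumes "\<phi> \<in> bessel_vectors V"
  obtains h where "integrable circle h" "(\<lambda>N. \<integral>\<theta>. \<bar>fejer V N \<phi> \<theta> - h \<theta>\<bar> \<partial>circle) \<longlonglongrightarrow> 0"
proof -
  let ?d = "\<lambda>m \<theta>. Re (dirichlet V m \<phi> \<theta>) / (2 * pi)"
  obtain h where h: "integrable circle h" "(\<lambda>m. \<integral>\<theta>. \<bar>?d m \<theta> - h \<theta>\<bar> \<partial>circle) \<longlonglongrightarrow> 0"
    using L1_complete[of circle ?d, OF integrable_dirichlet dirichlet_Cauchy[OF assms]] by blast
  have i: "integrable circle (\<lambda>\<theta>. \<bar>?d m \<theta> - h \<theta>\<bar>)" for m
    by (intro integrable_abs Bochner_Integration.integrable_diff integrable_dirichlet h)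
  have "(\<integral>\<theta>. \<bar>fejer V N \<phi> \<theta> - h \<theta>\<bar> \<partial>circle) \<le> (\<Sum>m<N. \<integral>\<theta>. \<bar>?d m \<theta> - h \<theta>\<bar> \<partial>circle) / N" if N: "1 \<le> N" for N
  proof -
    have "(\<integral>\<theta>. \<bar>fejer V N \<phi> \<theta> - h \<theta>\<bar> \<partial>circle) \<le> (\<integral>\<theta>. (\<Sum>m<N. \<bar>?d m \<theta> - h \<theta>\<bar>) / N \<partial>circle)"
    proof (intro integral_mono integrable_abs Bochner_Integration.integrable_diff integrable_fejer h)
      show "integrable circle (\<lambda>\<theta>. (\<Sum>m<N. \<bar>?d m \<theta> - h \<theta>\<bar>) / N)"
        by (rule integrable_divide, rule Bochner_Integration.integrable_sum, rule i)
      fix \<theta>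
      have "fejer V N \<phi> \<theta> - h \<theta> = (\<Sum>m<N. ?d m \<theta> - h \<theta>) / N"
        unfolding fejer_eq sum_subtractf using N by (simp add: diff_divide_distrib)
      also have "\<bar>\<dots>\<bar> \<le> (\<Sum>m<N. \<bar>?d m \<theta> - h \<theta>\<bar>) / N"
        unfolding abs_divide abs_of_nat by (intro divide_right_mono sum_abs) simp
      finally show "\<bar>fejer V N \<phi> \<theta> - h \<theta>\<bar> \<le> (\<Sum>m<N. \<bar>?d m \<theta> - h \<theta>\<bar>) / N" .
    qed
    also have "\<dots> = (\<Sum>m<N. \<integral>\<theta>. \<bar>?d m \<theta> - h \<theta>\<bar> \<partial>circle) / N"
      by (simp only: integral_divide_zero Bochner_Integration.integral_sum[OF i])
    finally show ?thesis .
  qed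
  then have "(\<lambda>N. \<integral>\<theta>. \<bar>fejer V N \<phi> \<theta> - h \<theta>\<bar> \<partial>circle) \<longlonglongrightarrow> 0"
    by (intro tendsto_sandwich[OF _ _ tendsto_const cesaro_null[OF h(2)]])
      (auto intro: eventually_sequentiallyI[of 1])
  with h(1) that show thesis by blast
qed

lemma L1_triangle:
  fixes f g h :: "real \<Rightarrow> real"
  assumes "integrable circle f" "integrable circle g" "integrable circle h"
  shows "(\<integral>\<theta>. \<bar>f \<theta> - h \<theta>\<bar> \<partial>circle) \<le> (\<integral>\<theta>. \<bar>f \<theta> - g \<theta>\<bar> \<partial>circle) + (\<integral>\<theta>. \<bar>g \<theta> - h \<theta>\<bar> \<partial>circle)"
proof -
  have "(\<integral>\<theta>. \<bar>f \<theta> - h \<theta>\<bar> \<partial>circle) \<le> (\<integral>\<theta>. \<bar>f \<theta> - g \<theta>\<bar> + \<bar>g \<theta> - h \<theta>\<bar> \<partial>circle)"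
    by (intro integral_mono Bochner_Integration.integrable_add integrable_abs Bochner_Integration.integrable_diff assms) argo
  then show ?thesis
    by (simp add: assms)
qed

text \<open>The limit \<open>h\<close> belonging to a nearby Bessel vector is the common reference
  point for all large \<open>N\<close>; the Lipschitz bound pays for replacing \<open>\<psi>\<close>
  by that vector uniformly in \<open>N\<close>. Completeness then gives a limit for
  \<open>\<psi>\<close> itself.\<close>

lemma fejer_converges:
  assumes "\<psi> \<in> closure (bessel_vectors V)"
  obtains g where "integrable circle g" "(\<lambda>N. \<integral>\<theta>. \<bar>fejer V N \<psi> \<theta> - g \<theta>\<bar> \<partial>circle) \<longlonglongrightarrow> 0"
proof (rule L1_complete[of circle "\<lambda>N. fejer V N \<psi>"])
  fix e :: real assume e: "0 < e"
  obtain \<phi> where \<phi>: "\<And>n::nat. \<phi> n \<in> bessel_vectors V" "\<phi> \<longlonglongrightarrow> \<psi>"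
    using closure_seq_obtain[OF assms] by blast
  have "(\<lambda>n. norm (\<psi> - \<phi> n) * (1 / 2 + (norm \<psi>)\<^sup>2 + (norm (\<phi> n))\<^sup>2)) \<longlonglongrightarrow> norm (\<psi> - \<psi>) * (1 / 2 + (norm \<psi>)\<^sup>2 + (norm \<psi>)\<^sup>2)"
    by (intro tendsto_intros \<phi>)
  then have "\<forall>\<^sub>F n in sequentially. norm (\<psi> - \<phi> n) * (1 / 2 + (norm \<psi>)\<^sup>2 + (norm (\<phi> n))\<^sup>2) < e / 4"
    using e by (intro order_tendstoD(2)) auto
  then obtain n where n: "norm (\<psi> - \<phi> n) * (1 / 2 + (norm \<psi>)\<^sup>2 + (norm (\<phi> n))\<^sup>2) < e / 4"
    by (auto simp: eventually_sequentially)
  obtain h where h: "integrable circle h" "(\<lambda>N. \<integral>\<theta>. \<bar>fejer V N (\<phi> n) \<theta> - h \<theta>\<bar> \<partial>circle) \<longlonglongrightarrow> 0"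
    using fejer_converges_bessel[OF \<phi>(1)] by blast
  have "\<forall>\<^sub>F N in sequentially. (\<integral>\<theta>. \<bar>fejer V N (\<phi> n) \<theta> - h \<theta>\<bar> \<partial>circle) < e / 4"
    using e by (intro order_tendstoD(2)[OF h(2)]) auto
  then obtain M where M: "\<And>N. M \<le> N \<Longrightarrow> (\<integral>\<theta>. \<bar>fejer V N (\<phi> n) \<theta> - h \<theta>\<bar> \<partial>circle) < e / 4"
    by (auto simp: eventually_sequentially)
  have near: "(\<integral>\<theta>. \<bar>fejer V N \<psi> \<theta> - h \<theta>\<bar> \<partial>circle) \<le> e / 2" if "Suc M \<le> N" for N
    using L1_triangle[OF integrable_fejer integrable_fejer h(1), of N \<psi> N "\<phi> n"]
      fejer_Lipschitz[of N \<psi> "\<phi> n"] n M[of N] that by simp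
  show "\<exists>N. \<forall>m\<ge>N. \<forall>k\<ge>N. (\<integral>\<theta>. \<bar>fejer V m \<psi> \<theta> - fejer V k \<psi> \<theta>\<bar> \<partial>circle) \<le> e"
  proof (intro exI allI impI)
    fix m k assume "Suc M \<le> m" "Suc M \<le> k"
    then show "(\<integral>\<theta>. \<bar>fejer V m \<psi> \<theta> - fejer V k \<psi> \<theta>\<bar> \<partial>circle) \<le> e"
      using L1_triangle[OF integrable_fejer h(1) integrable_fejer, of m \<psi> k \<psi>] near[of m] near[of k]
      by (simp add: abs_minus_commute[of "h _"])
  qed
qed (use integrable_fejer that in auto)

text \<open>Fourier coefficients are continuous in \<open>L1\<close>, so those of the limit of the
  Fejer means are the limits of \<open>(1 - k / N)\<close> times the moments. The limit is therefore
  a density of the spectral measure.\<close>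

lemma closure_bessel_subset: "closure (bessel_vectors V) \<subseteq> ac_vectors V"
proof
  fix \<psi> assume "\<psi> \<in> closure (bessel_vectors V)"
  then obtain g0 where g0: "integrable circle g0" "(\<lambda>N. \<integral>\<theta>. \<bar>fejer V N \<psi> \<theta> - g0 \<theta>\<bar> \<partial>circle) \<longlonglongrightarrow> 0"
    using fejer_converges by blast
  \<comment> \<open>A nonnegative representative, as a density requires. The Fejer means are
    nonnegative, so passing to the absolute value can only reduce the distance to them.\<close>
  define g where "g \<theta> = \<bar>g0 \<theta>\<bar>" for \<theta>
  have g: "integrable circle g"
    unfolding g_def by (intro integrable_abs g0)
  have lim: "(\<lambda>N. \<integral>\<theta>. \<bar>fejer V N \<psi> \<theta> - g \<theta>\<bar> \<partial>circle) \<longlonglongrightarrow> 0"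
  proof (rule tendsto_sandwich[OF _ _ tendsto_const g0(2)])
    show "\<forall>\<^sub>F N in sequentially. (\<integral>\<theta>. \<bar>fejer V N \<psi> \<theta> - g \<theta>\<bar> \<partial>circle) \<le> (\<integral>\<theta>. \<bar>fejer V N \<psi> \<theta> - g0 \<theta>\<bar> \<partial>circle)"
    proof (intro always_eventually allI integral_mono integrable_abs Bochner_Integration.integrable_diff integrable_fejer g g0)
      show "\<bar>fejer V N \<psi> \<theta> - g \<theta>\<bar> \<le> \<bar>fejer V N \<psi> \<theta> - g0 \<theta>\<bar>" for N \<theta>
        using fejer_nonneg[of N \<psi> \<theta>] by (simp add: g_def)
    qed
  qed (auto intro!: always_eventually integral_nonneg_AE)
  have coeff: "(\<integral>\<theta>. complex_of_real (g \<theta>) * cis (real k * \<theta>) \<partial>circle) = cinner \<psi> ((V ^^ k) \<psi>)" for k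
  proof (rule LIMSEQ_unique)
    let ?a = "\<lambda>N. \<integral>\<theta>. complex_of_real (fejer V N \<psi> \<theta>) * cis (real k * \<theta>) \<partial>circle"
    have ic: "integrable circle (\<lambda>\<theta>. complex_of_real (f \<theta>) * cis (real k * \<theta>))" if f: "integrable circle f" for f
    proof (rule Bochner_Integration.integrable_bound[OF f])
      show "(\<lambda>\<theta>. complex_of_real (f \<theta>) * cis (real k * \<theta>)) \<in> borel_measurable circle"
        using f by (intro borel_measurable_times measurable_circle[OF cis_measurable]) auto
    qed (simp add: norm_mult)
    have "norm (?a N - (\<integral>\<theta>. complex_of_real (g \<theta>) * cis (real k * \<theta>) \<partial>circle)) \<le> (\<integral>\<theta>. \<bar>fejer V N \<psi> \<theta> - g \<theta>\<bar> \<partial>circle)" for N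
    proof -
      have "?a N - (\<integral>\<theta>. complex_of_real (g \<theta>) * cis (real k * \<theta>) \<partial>circle)
          = (\<integral>\<theta>. complex_of_real (fejer V N \<psi> \<theta> - g \<theta>) * cis (real k * \<theta>) \<partial>circle)"
        by (subst Bochner_Integration.integral_diff[symmetric]) (simp_all add: ic integrable_fejer g left_diff_distrib)
      also have "norm \<dots> \<le> (\<integral>\<theta>. norm (complex_of_real (fejer V N \<psi> \<theta> - g \<theta>) * cis (real k * \<theta>)) \<partial>circle)"
        by (rule integral_norm_bound)
      also have "\<dots> = (\<integral>\<theta>. \<bar>fejer V N \<psi> \<theta> - g \<theta>\<bar> \<partial>circle)"
        by (simp add: norm_mult norm_of_real del: of_real_diff)
      finally show ?thesis .
    qed
    then have "(\<lambda>N. ?a N - (\<integral>\<theta>. complex_of_real (g \<theta>) * cis (real k * \<theta>) \<partial>circle)) \<longlonglongrightarrow> 0"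
      by (intro Lim_null_comparison[OF always_eventually lim]) blast
    then show "?a \<longlonglongrightarrow> (\<integral>\<theta>. complex_of_real (g \<theta>) * cis (real k * \<theta>) \<partial>circle)"
      by (simp add: LIM_zero_iff)
    have "(\<lambda>N. real (N - k) / N) \<longlonglongrightarrow> 1"
    proof (rule Lim_transform_eventually)
      show "(\<lambda>N. 1 - real k * inverse (real N)) \<longlonglongrightarrow> 1"
        using tendsto_diff[OF tendsto_const[of "1::real"] tendsto_mult_right_zero[OF lim_inverse_n, of "real k"]] by simp
      show "\<forall>\<^sub>F N in sequentially. 1 - real k * inverse (real N) = real (N - k) / N"
        by (rule eventually_sequentiallyI[of "Suc k"]) (simp add: of_nat_diff field_simps)
    qed
    then have "(\<lambda>N. complex_of_real (real (N - k) / N) * cinner \<psi> ((V ^^ k) \<psi>)) \<longlonglongrightarrow> complex_of_real 1 * cinner \<psi> ((V ^^ k) \<psi>)"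
      by (intro tendsto_mult tendsto_of_real tendsto_const)
    then show "?a \<longlonglongrightarrow> cinner \<psi> ((V ^^ k) \<psi>)"
      unfolding fejer_coeff by simp
  qed
  define G where "G \<theta> = indicator {0..2 * pi} \<theta> * g \<theta>" for \<theta> :: real
  have G: "integrable lborel G" "\<And>\<theta>. 0 \<le> G \<theta>"
    using g by (simp_all add: G_def[abs_def] circle_def integrable_restrict_space g_def)
  have Gm [measurable]: "G \<in> borel_measurable borel"
    using G(1) by auto
  define \<mu> where "\<mu> = density lborel (\<lambda>\<theta>. ennreal (G \<theta>))"
  have "finite_measure \<mu>"
    unfolding \<mu>_def
    by (rule finite_measureI) (simp add: emeasure_density nn_integral_eq_integral[OF G(1)] G(2))
  moreover have "emeasure \<mu> (- {0..<2 * pi}) = 0"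
  proof -
    \<comment> \<open>The extended density lives on the closed interval; the excess endpoint
      \<open>2 * pi\<close> is the only exceptional point.\<close>
    have "AE \<theta> in lborel. ennreal (G \<theta>) * indicator (- {0..<2 * pi}) \<theta> = 0"
      using AE_lborel_singleton[of "2 * pi"] by eventually_elim (auto simp: G_def split: split_indicator)
    then show ?thesis
      unfolding \<mu>_def by (simp add: emeasure_density nn_integral_0_iff_AE)
  qed
  moreover have "absolutely_continuous lborel \<mu>"
    unfolding \<mu>_def by (rule absolutely_continuousI_density) measurable
  moreover have "cinner \<psi> ((V ^^ k) \<psi>) = (\<integral>\<theta>. exp (\<i> * of_nat k * of_real \<theta>) \<partial>\<mu>)" for k
  proof -
    have "(\<integral>\<theta>. exp (\<i> * of_nat k * of_real \<theta>) \<partial>\<mu>) = (\<integral>\<theta>. cis (real k * \<theta>) \<partial>\<mu>)"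
      by (simp add: cis_conv_exp mult_ac)
    also have "\<dots> = (\<integral>\<theta>. G \<theta> *\<^sub>R cis (real k * \<theta>) \<partial>lborel)"
      unfolding \<mu>_def using G(2) by (intro integral_density) (auto intro: cis_measurable)
    also have "\<dots> = (\<integral>\<theta>. complex_of_real (g \<theta>) * cis (real k * \<theta>) \<partial>circle)"
      by (simp add: circle_def integral_restrict_space G_def scaleR_conv_of_real) (simp add: indicator_def of_bool_def mult_ac)
    finally show ?thesis using coeff by simp
  qed
  moreover have "sets \<mu> = sets borel"
    by (simp add: \<mu>_def)
  ultimately show "\<psi> \<in> ac_vectors V"
    unfolding ac_vectors_def by blast
qed

lemma ac_vectors_eq: "ac_vectors V = closure (bessel_vectors V)"
  using ac_vectors_subset[OF V] closure_bessel_subset by blast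

end

section \<open>The trace class perturbation argument\<close>

text \<open>Abstracts \<open>\<alpha> u = \<parallel>A u\<parallel>\<close> with \<open>A\<close> Hilbert-Schmidt.\<close>
definition hilbert_schmidt_weight :: "('a::complex_hilbert \<Rightarrow> real) \<Rightarrow> bool" where
  "hilbert_schmidt_weight \<alpha> \<longleftrightarrow> (\<forall>u. 0 \<le> \<alpha> u) \<and>
     (\<exists>A\<ge>0. \<forall>x B N. 0 \<le> B \<longrightarrow> bessel B x \<longrightarrow> (\<Sum>n<N. (\<alpha> (x n))\<^sup>2) \<le> A * B)"

lemma hs_summable:
  assumes "hilbert_schmidt_weight \<alpha>" "0 \<le> B" "bessel B x"
  shows "summable (\<lambda>n. (\<alpha> (x n))\<^sup>2)"
proof -
  obtain A where "\<forall>N. (\<Sum>n<N. (\<alpha> (x n))\<^sup>2) \<le> A * B"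
    using assms unfolding hilbert_schmidt_weight_def by blast
  then show ?thesis
    by (intro bounded_imp_summable[of _ "A * B"])
      (auto simp: lessThan_Suc_atMost[symmetric] simp del: sum.lessThan_Suc)
qed

lemma hs_tendsto_0:
  assumes "hilbert_schmidt_weight \<alpha>" "0 \<le> B" "bessel B x"
  shows "(\<lambda>n. \<alpha> (x n)) \<longlonglongrightarrow> 0"
proof -
  have "(\<lambda>n. sqrt ((\<alpha> (x n))\<^sup>2)) \<longlonglongrightarrow> sqrt 0"
    by (intro tendsto_real_sqrt summable_LIMSEQ_zero hs_summable[OF assms])
  then show ?thesis
    using assms(1) by (simp add: hilbert_schmidt_weight_def)
qed

lemma convergent_by_parts:
  fixes f :: "nat \<Rightarrow> 'a::{real_normed_vector, complete_space}"
  assumes "\<And>e. e > 0 \<Longrightarrow> \<exists>N. \<forall>s\<ge>N. \<forall>m. norm (f (s + m) - f s) \<le> e"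
  shows "convergent f"
  unfolding Cauchy_convergent_iff[symmetric]
proof (rule metric_CauchyI)
  fix e :: real assume "e > 0"
  then obtain N where N: "\<forall>s\<ge>N. \<forall>m. norm (f (s + m) - f s) \<le> e / 2"
    using assms[of "e / 2"] by auto
  have *: "dist (f t) (f s) < e" if "N \<le> s" "s \<le> t" for s t
    using N[rule_format, of s "t - s"] that \<open>e > 0\<close> by (simp add: dist_norm)
  show "\<exists>M. \<forall>m\<ge>M. \<forall>n\<ge>M. dist (f m) (f n) < e"
    using * by (intro exI[of _ N]) (metis dist_commute nle_le)
qed

text \<open>The assumption \<open>factor\<close> replaces a factorisation \<open>U - U0 = A\<^sup>* B\<close> of a trace class operator into
  Hilbert-Schmidt operators.\<close>
locale trace_class_pair =
  fixes U U0 :: "'a::complex_hilbert \<Rightarrow> 'a" and \<alpha> \<beta> :: "'a \<Rightarrow> real"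
  assumes U: "unitary U" and U0: "unitary U0"
    and hs\<alpha>: "hilbert_schmidt_weight \<alpha>" and hs\<beta>: "hilbert_schmidt_weight \<beta>"
    and factor: "cmod (cinner u (U v - U0 v)) \<le> \<alpha> u * \<beta> v"
begin

abbreviation wave :: "nat \<Rightarrow> 'a \<Rightarrow> 'a" where
  "wave t \<psi> \<equiv> (inv U ^^ t) ((U0 ^^ t) \<psi>)"

lemma unitary_wave: "unitary (wave t)"
  by (rule unitary_comp[OF unitary_funpow[OF unitary_inv[OF U]] unitary_funpow[OF U0]])

lemma \<alpha>_nonneg: "0 \<le> \<alpha> u" and \<beta>_nonneg: "0 \<le> \<beta> u"
  using hs\<alpha> hs\<beta> by (auto simp: hilbert_schmidt_weight_def)

text \<open>Replacing one factor \<open>U\<close> by \<open>U0\<close> costs a perturbation term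
  between two Bessel sequences in \<open>n\<close>, and Hilbert-Schmidt weights tend to zero along
  these. After all \<open>m\<close> replacements both arguments are the same orbit vector. Each
  replacement raises \<open>s\<close> by one, hence the generalisation over
  \<open>s\<close>.\<close>

lemma overlap_tendsto:
  assumes B: "0 \<le> B" "bessel B (\<lambda>n. (U0 ^^ n) \<psi>)"
  shows "(\<lambda>n. cinner ((U0 ^^ (n + s + m)) \<psi>) ((U ^^ m) ((U0 ^^ (n + s)) \<psi>))) \<longlonglongrightarrow> cinner \<psi> \<psi>"
proof (induction m arbitrary: s)
  case 0
  then show ?case by (simp add: unitary_cinner_funpow[OF U0])
next
  case (Suc m)
  define v where "v n = (U0 ^^ (n + s)) \<psi>" for n
  \<comment> \<open>The remaining \<open>m\<close> factors \<open>U\<close> are moved to the left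
    argument; the sequence stays Bessel with the same bound because it is a unitary image of a
    shifted orbit.\<close>
  define w where "w n = (inv U ^^ m) ((U0 ^^ (n + (s + Suc m))) \<psi>)" for n
  have bv: "bessel B v" and bw: "bessel B w"
    unfolding v_def w_def
    by (rule bessel_shift[OF B(2)], rule bessel_unitary[OF unitary_funpow[OF unitary_inv[OF U]] bessel_shift[OF B(2)]])
  have eq: "cinner ((U0 ^^ (n + s + Suc m)) \<psi>) ((U ^^ Suc m) ((U0 ^^ (n + s)) \<psi>))
      = cinner ((U0 ^^ (n + Suc s + m)) \<psi>) ((U ^^ m) ((U0 ^^ (n + Suc s)) \<psi>)) + cinner (w n) (U (v n) - U0 (v n))" for n
  proof -
    have "(U ^^ Suc m) ((U0 ^^ (n + s)) \<psi>) = (U ^^ m) (U0 (v n) + (U (v n) - U0 (v n)))"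
      by (simp add: v_def funpow_swap1)
    also have "\<dots> = (U ^^ m) (U0 (v n)) + (U ^^ m) (U (v n) - U0 (v n))"
      by (rule unitary_add[OF unitary_funpow[OF U]])
    finally show ?thesis
      by (simp only: cinner_add_right unitary_cinner_inv_funpow[OF U, of "(U0 ^^ (n + s + Suc m)) \<psi>" m "U (v n) - U0 (v n)"])
        (simp add: v_def w_def add.assoc)
  qed
  have "(\<lambda>n. \<alpha> (w n) * \<beta> (v n)) \<longlonglongrightarrow> 0 * 0"
    by (intro tendsto_mult hs_tendsto_0[OF hs\<alpha> B(1) bw] hs_tendsto_0[OF hs\<beta> B(1) bv])
  then have "(\<lambda>n. cinner (w n) (U (v n) - U0 (v n))) \<longlonglongrightarrow> 0"
    by (intro tendsto_0_le[where K = 1 and g = "\<lambda>n. cinner (w n) (U (v n) - U0 (v n))" and f = "\<lambda>n. \<alpha> (w n) * \<beta> (v n)"])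
      (auto intro!: eventuallyI simp: factor \<alpha>_nonneg \<beta>_nonneg abs_mult)
  from tendsto_add[OF Suc.IH[of "Suc s"] this] show ?case
    unfolding eq by simp
qed

text \<open>The commutator of \<open>U0\<close> with \<open>U ^^ m\<close> only involves the perturbation at the two ends.\<close>
lemma overlap_step:
  "cmod (cinner ((U0 ^^ Suc k) \<psi>) ((U ^^ m) (U0 v)) - cinner ((U0 ^^ k) \<psi>) ((U ^^ m) v))
    \<le> \<alpha> ((inv U ^^ m) ((U0 ^^ Suc k) \<psi>)) * \<beta> v + \<alpha> ((U0 ^^ Suc k) \<psi>) * \<beta> ((U ^^ m) v)"
proof -
  let ?u = "(U0 ^^ Suc k) \<psi>"
  have "(U ^^ m) (U0 v) = (U ^^ m) (U v) - (U ^^ m) (U v - U0 v)"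
    by (simp add: unitary_diff[OF unitary_funpow[OF U], symmetric])
  also have "(U ^^ m) (U v) = U0 ((U ^^ m) v) + (U ((U ^^ m) v) - U0 ((U ^^ m) v))"
    by (simp add: funpow_swap1)
  finally have "cinner ?u ((U ^^ m) (U0 v)) = cinner ?u (U0 ((U ^^ m) v))
      + cinner ?u (U ((U ^^ m) v) - U0 ((U ^^ m) v)) - cinner ?u ((U ^^ m) (U v - U0 v))"
    by (simp only: cinner_diff_right cinner_add_right)
  moreover have "cinner ?u (U0 ((U ^^ m) v)) = cinner ((U0 ^^ k) \<psi>) ((U ^^ m) v)"
    by (simp add: unitary_cinner[OF U0])
  moreover have "cinner ?u ((U ^^ m) (U v - U0 v)) = cinner ((inv U ^^ m) ?u) (U v - U0 v)"
    by (rule unitary_cinner_inv_funpow[OF U])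
  ultimately have "cinner ?u ((U ^^ m) (U0 v)) - cinner ((U0 ^^ k) \<psi>) ((U ^^ m) v)
    = cinner ?u (U ((U ^^ m) v) - U0 ((U ^^ m) v)) - cinner ((inv U ^^ m) ?u) (U v - U0 v)"
    by simp
  then show ?thesis
    using norm_triangle_ineq4[of "cinner ?u (U ((U ^^ m) v) - U0 ((U ^^ m) v))" "cinner ((inv U ^^ m) ?u) (U v - U0 v)"]
      factor[of ?u "(U ^^ m) v"] factor[of "(inv U ^^ m) ?u" v]
    by simp
qed

lemma wave_convergent_bessel:
  assumes "\<psi> \<in> bessel_vectors U0"
  shows "convergent (\<lambda>t. wave t \<psi>)"
proof (rule convergent_by_parts)
  fix e :: real assume e: "e > 0"
  define x where "x n = (U0 ^^ n) \<psi>" for n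
  obtain B where B: "B \<ge> 0" "bessel B x"
    using assms unfolding bessel_vectors_def x_def by blast
  obtain A where A: "A \<ge> 0" "\<And>y N. bessel B y \<Longrightarrow> (\<Sum>n<N. (\<alpha> (y n))\<^sup>2) \<le> A * B"
    using hs\<alpha> B(1) unfolding hilbert_schmidt_weight_def by blast
  obtain A' where A': "A' \<ge> 0" "\<And>y N. bessel B y \<Longrightarrow> (\<Sum>n<N. (\<beta> (y n))\<^sup>2) \<le> A' * B"
    using hs\<beta> B(1) unfolding hilbert_schmidt_weight_def by blast
  define a where "a s = (\<Sum>n. (\<alpha> (x (n + s)))\<^sup>2)" for s
  define b where "b s = (\<Sum>n. (\<beta> (x (n + s)))\<^sup>2)" for s
  have sa: "summable (\<lambda>n. (\<alpha> (x (n + s)))\<^sup>2)" and sb: "summable (\<lambda>n. (\<beta> (x (n + s)))\<^sup>2)" for s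
    using hs_summable[OF hs\<alpha> B(1) bessel_shift[OF B(2)]] hs_summable[OF hs\<beta> B(1) bessel_shift[OF B(2)]] by auto
  \<comment> \<open>In each product one factor involves powers of \<open>U\<close> and is merely
    bounded, uniformly in \<open>m\<close>; the other is the tail of a fixed convergent series along
    the free orbit. One small factor per product is enough.\<close>
  define \<delta> where "\<delta> s k = sqrt (A * B) * sqrt (b s) + sqrt (a k) * sqrt (A' * B)" for s k
  have bound: "(norm (wave (s + m) \<psi> - wave s \<psi>))\<^sup>2 \<le> 2 * \<delta> s (Suc (s + m))" for s m
  proof -
    \<comment> \<open>At \<open>n = 0\<close> this is the overlap of the waves at times
      \<open>s + m\<close> and \<open>s\<close>, and in the limit it is the squared norm.
      Telescoping thus measures how far the two waves are apart.\<close>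
    define E where "E n = cinner (x (n + s + m)) ((U ^^ m) (x (n + s)))" for n
    have E: "E \<longlonglongrightarrow> cinner \<psi> \<psi>"
      using overlap_tendsto[of B \<psi> s m] B unfolding E_def x_def by simp
    have step: "cmod (E (Suc n) - E n) \<le> \<alpha> ((inv U ^^ m) (x (n + Suc (s + m)))) * \<beta> (x (n + s))
        + \<alpha> (x (n + Suc (s + m))) * \<beta> ((U ^^ m) (x (n + s)))" for n
      using overlap_step[of "n + s + m" \<psi> m "x (n + s)"] by (simp add: E_def x_def add.assoc)
    have "cmod (E N - E 0) \<le> \<delta> s (Suc (s + m))" for N
    proof -
      have "cmod (E N - E 0) = cmod (\<Sum>n<N. E (Suc n) - E n)"
        by (simp add: sum_lessThan_telescope)
      also have "\<dots> \<le> (\<Sum>n<N. \<alpha> ((inv U ^^ m) (x (n + Suc (s + m)))) * \<beta> (x (n + s))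
          + \<alpha> (x (n + Suc (s + m))) * \<beta> ((U ^^ m) (x (n + s))))"
        by (intro order_trans[OF norm_sum] sum_mono step)
      also have "\<dots> \<le> (\<Sum>n<N. \<bar>\<alpha> ((inv U ^^ m) (x (n + Suc (s + m))))\<bar> * \<bar>\<beta> (x (n + s))\<bar>)
          + (\<Sum>n<N. \<bar>\<alpha> (x (n + Suc (s + m)))\<bar> * \<bar>\<beta> ((U ^^ m) (x (n + s)))\<bar>)"
        by (simp add: sum.distrib \<alpha>_nonneg \<beta>_nonneg)
      also have "\<dots> \<le> L2_set (\<lambda>n. \<alpha> ((inv U ^^ m) (x (n + Suc (s + m))))) {..<N} * L2_set (\<lambda>n. \<beta> (x (n + s))) {..<N}
          + L2_set (\<lambda>n. \<alpha> (x (n + Suc (s + m)))) {..<N} * L2_set (\<lambda>n. \<beta> ((U ^^ m) (x (n + s)))) {..<N}"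
        by (intro add_mono L2_set_mult_ineq)
      also have "\<dots> \<le> \<delta> s (Suc (s + m))"
        unfolding \<delta>_def L2_set_def a_def b_def
        using A(1) A'(1) B(1)
        by (intro add_mono mult_mono real_sqrt_le_mono real_sqrt_ge_zero sum_nonneg zero_le_power2
            A(2)[OF bessel_unitary[OF unitary_funpow[OF unitary_inv[OF U]] bessel_shift[OF B(2)]]]
            A'(2)[OF bessel_unitary[OF unitary_funpow[OF U] bessel_shift[OF B(2)]]]
            sum_le_suminf sa sb suminf_nonneg mult_nonneg_nonneg) auto
      finally show ?thesis .
    qed
    moreover have "(\<lambda>N. cmod (E N - E 0)) \<longlonglongrightarrow> cmod (cinner \<psi> \<psi> - E 0)"
      by (intro tendsto_intros E)
    ultimately have d: "cmod (cinner \<psi> \<psi> - E 0) \<le> \<delta> s (Suc (s + m))"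
      by (intro LIMSEQ_le_const2) auto
    have "cinner (wave (s + m) \<psi>) (wave s \<psi>) = E 0"
    proof -
      have "(U ^^ (s + m)) (wave s \<psi>) = (U ^^ m) (x s)"
        by (simp add: x_def add.commute[of s m] funpow_add U)
      moreover have "(U ^^ (s + m)) (wave (s + m) \<psi>) = x (s + m)"
        by (simp add: x_def U)
      ultimately show ?thesis
        using unitary_cinner_funpow[OF U, of "s + m" "wave (s + m) \<psi>" "wave s \<psi>"] by (simp add: E_def)
    qed
    then have "inner (wave (s + m) \<psi>) (wave s \<psi>) = Re (E 0)"
      by (simp only: Re_cinner[symmetric])
    then have "(norm (wave (s + m) \<psi> - wave s \<psi>))\<^sup>2 = 2 * Re (cinner \<psi> \<psi> - E 0)"
      using unitary_norm[OF unitary_wave, of "s + m" \<psi>] unitary_norm[OF unitary_wave, of s \<psi>]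
      by (simp add: power2_norm_eq_inner[of "_ - _"] inner_diff_left inner_diff_right inner_commute cinner_self)
        (simp add: power2_norm_eq_inner[symmetric])
    also have "\<dots> \<le> 2 * \<delta> s (Suc (s + m))"
      using d complex_Re_le_cmod[of "cinner \<psi> \<psi> - E 0"] by simp
    finally show ?thesis .
  qed
  have "(\<lambda>s. a s) \<longlonglongrightarrow> 0" "(\<lambda>s. b s) \<longlonglongrightarrow> 0"
    unfolding a_def b_def
    using suminf_exist_split2[OF sa[of 0, simplified]] suminf_exist_split2[OF sb[of 0, simplified]] by simp_all
  then have ab: "(\<lambda>s. sqrt (a s)) \<longlonglongrightarrow> 0" "(\<lambda>s. sqrt (b s)) \<longlonglongrightarrow> 0"
    using tendsto_real_sqrt by fastforce+
  \<comment> \<open>The added one keeps \<open>c\<close> positive even if both Hilbert-Schmidt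
    bounds vanish.\<close>
  define c where "c = 2 * (sqrt (A * B) + sqrt (A' * B)) + 1"
  have c: "c > 0" using A A' B by (simp add: c_def add_nonneg_pos)
  have "\<forall>\<^sub>F s in sequentially. sqrt (a s) < e\<^sup>2 / c \<and> sqrt (b s) < e\<^sup>2 / c"
    using order_tendstoD(2)[OF ab(1), of "e\<^sup>2 / c"] order_tendstoD(2)[OF ab(2), of "e\<^sup>2 / c"] e c
    by (simp add: eventually_conj_iff)
  then obtain N where N: "\<And>s. s \<ge> N \<Longrightarrow> sqrt (a s) < e\<^sup>2 / c \<and> sqrt (b s) < e\<^sup>2 / c"
    by (auto simp: eventually_sequentially)
  show "\<exists>N. \<forall>s\<ge>N. \<forall>m. norm (wave (s + m) \<psi> - wave s \<psi>) \<le> e"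
  proof (intro exI allI impI)
    fix s m assume s: "N \<le> s"
    have "2 * \<delta> s (Suc (s + m)) \<le> 2 * (sqrt (A * B) * (e\<^sup>2 / c) + (e\<^sup>2 / c) * sqrt (A' * B))"
      unfolding \<delta>_def using N[of s] N[of "Suc (s + m)"] s A A' B
      by (intro mult_left_mono add_mono mult_right_mono) auto
    also have "\<dots> = (c - 1) * (e\<^sup>2 / c)"
    proof -
      have "2 * (p * k + k * q) = (2 * (p + q) + 1 - 1) * k" for p q k :: real
        by (simp add: algebra_simps)
      then show ?thesis unfolding c_def by blast
    qed
    also have "\<dots> \<le> c * (e\<^sup>2 / c)"
      using c by (intro mult_right_mono) auto
    also have "\<dots> = e\<^sup>2"
      using c by simp
    finally have "(norm (wave (s + m) \<psi> - wave s \<psi>))\<^sup>2 \<le> e\<^sup>2"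
      using bound[of s m] by simp
    then show "norm (wave (s + m) \<psi> - wave s \<psi>) \<le> e"
      using e by (simp add: abs_le_square_iff[symmetric])
  qed
qed

lemma wave_convergent:
  assumes "\<psi> \<in> closure (bessel_vectors U0)"
  shows "convergent (\<lambda>t. wave t \<psi>)"
  unfolding Cauchy_convergent_iff[symmetric]
proof (rule metric_CauchyI)
  fix e :: real assume e: "e > 0"
  obtain \<phi> where \<phi>: "\<phi> \<in> bessel_vectors U0" "dist \<phi> \<psi> < e / 3"
    using assms[unfolded closure_approachable, rule_format, of "e / 3"] e by auto
  have d: "dist (wave t \<psi>) (wave t \<phi>) < e / 3" for t
    using \<phi>(2) unitary_norm[OF unitary_wave, of t "\<psi> - \<phi>"] unitary_diff[OF unitary_wave, of t \<psi> \<phi>]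
    by (simp add: dist_norm norm_minus_commute)
  have "Cauchy (\<lambda>t. wave t \<phi>)"
    using wave_convergent_bessel[OF \<phi>(1)] by (simp add: Cauchy_convergent_iff)
  then obtain N where N: "\<And>s t. s \<ge> N \<Longrightarrow> t \<ge> N \<Longrightarrow> dist (wave s \<phi>) (wave t \<phi>) < e / 3"
    using e unfolding Cauchy_def by (meson divide_pos_pos zero_less_numeral)
  show "\<exists>N. \<forall>s\<ge>N. \<forall>t\<ge>N. dist (wave s \<psi>) (wave t \<psi>) < e"
  proof (intro exI allI impI)
    fix s t assume st: "N \<le> s" "N \<le> t"
    have "dist (wave s \<psi>) (wave t \<psi>) \<le> dist (wave s \<psi>) (wave s \<phi>) + dist (wave s \<phi>) (wave t \<phi>) + dist (wave t \<psi>) (wave t \<phi>)"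
      using dist_triangle[of "wave s \<psi>" "wave t \<psi>" "wave s \<phi>"] dist_triangle[of "wave s \<phi>" "wave t \<psi>" "wave t \<phi>"]
      by (simp add: dist_commute)
    then show "dist (wave s \<psi>) (wave t \<psi>) < e"
      using d[of s] d[of t] N[OF st] by linarith
  qed
qed

text \<open>Meaningful where the waves converge, in particular on the closure of the Bessel vectors;
  elsewhere \<open>lim\<close> may be an unspecified value.\<close>

definition W :: "'a \<Rightarrow> 'a" where
  "W \<psi> = lim (\<lambda>t. wave t \<psi>)"

lemma W_tendsto: "\<psi> \<in> closure (bessel_vectors U0) \<Longrightarrow> (\<lambda>t. wave t \<psi>) \<longlonglongrightarrow> W \<psi>"
  unfolding W_def using wave_convergent convergent_LIMSEQ_iff by blast

lemma W_norm: "\<psi> \<in> closure (bessel_vectors U0) \<Longrightarrow> norm (W \<psi>) = norm \<psi>"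
  using tendsto_norm[OF W_tendsto] unitary_norm[OF unitary_wave] by (simp add: LIMSEQ_const_iff)

lemma W_diff:
  assumes "\<psi> \<in> closure (bessel_vectors U0)" "\<phi> \<in> closure (bessel_vectors U0)"
  shows "W (\<psi> - \<phi>) = W \<psi> - W \<phi>"
proof (rule LIMSEQ_unique)
  have "\<psi> - \<phi> \<in> closure (bessel_vectors U0)"
    using assms by (intro subspace_diff subspace_closure subspace_bessel_vectors U0)
  then show "(\<lambda>t. wave t (\<psi> - \<phi>)) \<longlonglongrightarrow> W (\<psi> - \<phi>)"
    by (rule W_tendsto)
  show "(\<lambda>t. wave t (\<psi> - \<phi>)) \<longlonglongrightarrow> W \<psi> - W \<phi>"
    unfolding unitary_diff[OF unitary_wave] by (intro tendsto_diff W_tendsto assms)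
qed

text \<open>The intertwining relation makes the \<open>U\<close>-orbit of \<open>W \<psi>\<close>
  the limit of unitary images of the \<open>U0\<close>-orbit of \<open>\<psi>\<close>. The finite
  Bessel sums pass to the limit with the same \<open>B\<close>.\<close>

lemma W_bessel:
  assumes "\<psi> \<in> bessel_vectors U0"
  shows "W \<psi> \<in> bessel_vectors U"
proof -
  obtain B where B: "B \<ge> 0" "bessel B (\<lambda>n. (U0 ^^ n) \<psi>)"
    using assms by (auto simp: bessel_vectors_def)
  have lim: "(\<lambda>t. wave t \<psi>) \<longlonglongrightarrow> W \<psi>"
    using W_tendsto assms closure_subset by blast
  have inter: "(\<lambda>t. wave t ((U0 ^^ n) \<psi>)) \<longlonglongrightarrow> (U ^^ n) (W \<psi>)" for n
  proof -
    \<comment> \<open>With time advanced by \<open>n\<close>, the outer \<open>U ^^ n\<close>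
      cancels \<open>n\<close> of the inverse steps and leaves the wave at time \<open>t\<close> of
      the advanced vector.\<close>
    have "(\<lambda>t. (U ^^ n) (wave (t + n) \<psi>)) \<longlonglongrightarrow> (U ^^ n) (W \<psi>)"
      by (intro unitary_tendsto[OF unitary_funpow[OF U]] LIMSEQ_ignore_initial_segment lim)
    moreover have "(U ^^ n) (wave (t + n) \<psi>) = wave t ((U0 ^^ n) \<psi>)" for t
    proof -
      have "(inv U ^^ (t + n)) y = (inv U ^^ n) ((inv U ^^ t) y)" for y
        by (subst add.commute) (simp add: funpow_add)
      then show ?thesis
        by (simp add: unitary_funpow_inv[OF U] funpow_add)
    qed
    ultimately show ?thesis by simp
  qed
  have "bessel B (\<lambda>n. (U ^^ n) (W \<psi>))"
    unfolding bessel_def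
  proof (intro allI)
    fix \<phi> N
    have "(\<lambda>t. \<Sum>n<N. (cmod (cinner \<phi> (wave t ((U0 ^^ n) \<psi>))))\<^sup>2) \<longlonglongrightarrow> (\<Sum>n<N. (cmod (cinner \<phi> ((U ^^ n) (W \<psi>))))\<^sup>2)"
      by (intro tendsto_sum tendsto_power tendsto_norm tendsto_cinner tendsto_const inter)
    moreover have "(\<Sum>n<N. (cmod (cinner \<phi> (wave t ((U0 ^^ n) \<psi>))))\<^sup>2) \<le> B * (norm \<phi>)\<^sup>2" for t
      by (rule besselD[OF bessel_unitary[OF unitary_wave B(2)]])
    ultimately show "(\<Sum>n<N. (cmod (cinner \<phi> ((U ^^ n) (W \<psi>))))\<^sup>2) \<le> B * (norm \<phi>)\<^sup>2"
      by (intro LIMSEQ_le_const2) auto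
  qed
  then show ?thesis
    using B by (auto simp: bessel_vectors_def)
qed

lemma W_closure:
  assumes "\<psi> \<in> closure (bessel_vectors U0)"
  shows "W \<psi> \<in> closure (bessel_vectors U)"
  unfolding closure_approachable
proof (intro allI impI)
  fix e :: real assume "e > 0"
  then obtain \<phi> where \<phi>: "\<phi> \<in> bessel_vectors U0" "dist \<phi> \<psi> < e"
    using assms[unfolded closure_approachable, rule_format, of e] by auto
  have c: "\<phi> \<in> closure (bessel_vectors U0)"
    using \<phi> closure_subset by blast
  have "\<phi> - \<psi> \<in> closure (bessel_vectors U0)"
    using assms c by (intro subspace_diff subspace_closure subspace_bessel_vectors U0)
  then have "dist (W \<phi>) (W \<psi>) = dist \<phi> \<psi>"
    by (simp add: dist_norm W_diff[OF c assms, symmetric] W_norm)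
  then show "\<exists>y\<in>bessel_vectors U. dist y (W \<psi>) < e"
    using \<phi> W_bessel by (intro bexI[of _ "W \<phi>"]) auto
qed

text \<open>The reverse evolution at time \<open>t\<close> is unitary and inverts
  \<open>wave t\<close>, so its error at \<open>W \<psi>\<close> equals the error of the wave
  itself.\<close>

lemma W_reverse:
  assumes "\<psi> \<in> closure (bessel_vectors U0)"
  shows "(\<lambda>t. (inv U0 ^^ t) ((U ^^ t) (W \<psi>))) \<longlonglongrightarrow> \<psi>"
proof -
  have "norm ((inv U0 ^^ t) ((U ^^ t) (W \<psi>)) - \<psi>) = norm (W \<psi> - wave t \<psi>)" for t
  proof -
    let ?V = "\<lambda>x. (inv U0 ^^ t) ((U ^^ t) x)"
    have V: "unitary ?V"
      by (rule unitary_comp[OF unitary_funpow[OF unitary_inv[OF U0]] unitary_funpow[OF U]])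
    have "?V (wave t \<psi>) = \<psi>"
      by (simp add: unitary_funpow_inv[OF U] unitary_inv_funpow[OF U0])
    then have "?V (W \<psi>) - \<psi> = ?V (W \<psi> - wave t \<psi>)"
      using unitary_diff[OF V, of "W \<psi>" "wave t \<psi>"] by simp
    then show ?thesis
      by (simp only: unitary_norm[OF V])
  qed
  moreover have "(\<lambda>t. norm (W \<psi> - wave t \<psi>)) \<longlonglongrightarrow> 0"
  proof -
    have "(\<lambda>t. norm (W \<psi> - wave t \<psi>)) \<longlonglongrightarrow> norm (W \<psi> - W \<psi>)"
      by (intro tendsto_norm tendsto_diff tendsto_const W_tendsto assms)
    then show ?thesis by simp
  qed
  ultimately show ?thesis
    by (subst tendsto_dist_iff) (simp add: dist_norm)
qed

text \<open>The hypotheses are symmetric in \<open>U\<close> and \<open>U0\<close> up to a sign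
  inside the modulus. This symmetry is the source of completeness.\<close>

lemma swapped: "trace_class_pair U0 U \<alpha> \<beta>"
proof (rule trace_class_pair.intro[OF U0 U hs\<alpha> hs\<beta>])
  show "cmod (cinner u (U0 v - U v)) \<le> \<alpha> u * \<beta> v" for u v
    using factor[of u v] cinner_minus_right[of u "U v - U0 v"] by simp
qed

end

section \<open>The Hilbert space of the quantum walk\<close>

lemma summable_on_le:
  fixes f g :: "'a \<Rightarrow> real"
  assumes "g summable_on A" "\<And>x. x \<in> A \<Longrightarrow> 0 \<le> f x" "\<And>x. x \<in> A \<Longrightarrow> f x \<le> g x"
  shows "f summable_on A"
proof -
  have g0: "0 \<le> g x" if "x \<in> A" for x using assms(2,3)[OF that] by linarith
  have "(\<lambda>x. norm (g x)) summable_on A"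
    using assms(1) g0 by (subst summable_on_cong[where g = g]) auto
  then have "(\<lambda>x. norm (f x)) summable_on A"
    by (rule Infinite_Sum.abs_summable_on_comparison_test) (use assms(2,3) g0 in auto)
  then show ?thesis by (rule abs_summable_summable)
qed

definition cdot :: "complex^2 \<Rightarrow> complex^2 \<Rightarrow> complex" where
  "cdot v w = (\<Sum>j\<in>UNIV. cnj (v $ j) * (w $ j))"

lemma Re_cdot: "Re (cdot v w) = inner v w"
  by (simp add: cdot_def inner_vec_def inner_complex_def)

lemma cdot_self: "cdot v v = complex_of_real ((norm v)\<^sup>2)"
proof (rule complex_eqI)
  show "Re (cdot v v) = Re (complex_of_real ((norm v)\<^sup>2))"
    by (simp add: Re_cdot power2_norm_eq_inner)
  show "Im (cdot v v) = Im (complex_of_real ((norm v)\<^sup>2))"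
    by (simp add: cdot_def)
qed

lemma norm_cdot_le: "cmod (cdot v w) \<le> norm v * norm w"
proof -
  have "cmod (cdot v w) \<le> (\<Sum>j\<in>UNIV. \<bar>norm (v $ j)\<bar> * \<bar>norm (w $ j)\<bar>)"
    unfolding cdot_def by (rule order_trans[OF norm_sum]) (simp add: norm_mult)
  also have "\<dots> \<le> norm v * norm w"
    unfolding norm_vec_def by (rule L2_set_mult_ineq)
  finally show ?thesis .
qed

lemma norm2_eq: "(norm (v :: complex^2))\<^sup>2 = (norm (v $ 1))\<^sup>2 + (norm (v $ 2))\<^sup>2"
  by (simp add: norm_vec_def L2_set_def sum_2)

lemma norm_smult_vec: "norm (a *s v) = cmod a * norm (v :: complex^2)"
proof (rule power2_eq_imp_eq)
  show "(norm (a *s v))\<^sup>2 = (cmod a * norm v)\<^sup>2"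
    by (simp add: norm2_eq norm_mult power_mult_distrib distrib_left)
qed auto

lemma l2inner_cdot: "l2inner \<phi> \<psi> = infsum (\<lambda>x. cdot (\<phi> x) (\<psi> x)) UNIV"
  by (simp add: l2inner_def cdot_def)

lemma ell2_iff: "\<psi> \<in> ell2 \<longleftrightarrow> (\<lambda>x. (norm (\<psi> x))\<^sup>2) summable_on UNIV"
  by (simp add: ell2_def)

lemma ell2_add:
  assumes "\<phi> \<in> ell2" "\<psi> \<in> ell2" shows "(\<lambda>x. \<phi> x + \<psi> x) \<in> ell2"
  unfolding ell2_iff
proof (rule summable_on_le)
  show "(\<lambda>x. 2 * (norm (\<phi> x))\<^sup>2 + 2 * (norm (\<psi> x))\<^sup>2) summable_on UNIV"
    using assms unfolding ell2_iff by (intro summable_on_add summable_on_cmult_right)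
  show "(norm (\<phi> x + \<psi> x))\<^sup>2 \<le> 2 * (norm (\<phi> x))\<^sup>2 + 2 * (norm (\<psi> x))\<^sup>2" for x
  proof -
    have "(norm (\<phi> x + \<psi> x))\<^sup>2 \<le> (norm (\<phi> x) + norm (\<psi> x))\<^sup>2"
      by (intro power_mono norm_triangle_ineq) auto
    also have "\<dots> \<le> 2 * (norm (\<phi> x))\<^sup>2 + 2 * (norm (\<psi> x))\<^sup>2"
      using sum_squares_bound[of "norm (\<phi> x)" "norm (\<psi> x)"] by (simp add: power2_sum)
    finally show ?thesis .
  qed
qed simp

lemma ell2_smult: assumes "\<psi> \<in> ell2" shows "(\<lambda>x. a *s \<psi> x) \<in> ell2"
  using assms unfolding ell2_iff by (simp add: norm_smult_vec power_mult_distrib summable_on_cmult_right)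

lemma ell2_scaleR: assumes "\<psi> \<in> ell2" shows "(\<lambda>x. a *\<^sub>R \<psi> x) \<in> ell2"
  using assms unfolding ell2_iff by (simp add: power_mult_distrib summable_on_cmult_right)

lemma ell2_uminus: assumes "\<psi> \<in> ell2" shows "(\<lambda>x. - \<psi> x) \<in> ell2"
  using assms unfolding ell2_iff by simp

lemma ell2_diff: "\<phi> \<in> ell2 \<Longrightarrow> \<psi> \<in> ell2 \<Longrightarrow> (\<lambda>x. \<phi> x - \<psi> x) \<in> ell2"
  using ell2_add[of \<phi> "\<lambda>x. - \<psi> x"] ell2_uminus[of \<psi>] by simp

lemma ell2_zero: "(\<lambda>x. 0) \<in> ell2"
  by (simp add: ell2_iff)

lemma cdot_summable:
  assumes "\<phi> \<in> ell2" "\<psi> \<in> ell2" shows "(\<lambda>x. cdot (\<phi> x) (\<psi> x)) summable_on UNIV"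
proof (rule abs_summable_summable, rule summable_on_le)
  show "(\<lambda>x. (norm (\<phi> x))\<^sup>2 + (norm (\<psi> x))\<^sup>2) summable_on UNIV"
    using assms unfolding ell2_iff by (intro summable_on_add)
  show "norm (cdot (\<phi> x) (\<psi> x)) \<le> (norm (\<phi> x))\<^sup>2 + (norm (\<psi> x))\<^sup>2" for x
  proof -
    have "2 * (norm (\<phi> x) * norm (\<psi> x)) \<le> (norm (\<phi> x))\<^sup>2 + (norm (\<psi> x))\<^sup>2"
      using sum_squares_bound[of "norm (\<phi> x)" "norm (\<psi> x)"] by simp
    moreover have "0 \<le> norm (\<phi> x) * norm (\<psi> x)" by simp
    ultimately show ?thesis
      using norm_cdot_le[of "\<phi> x" "\<psi> x"] by linarith
  qed
qed simp

lemma l2inner_add_right: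
  assumes "\<phi> \<in> ell2" "\<psi> \<in> ell2" "\<psi>' \<in> ell2"
  shows "l2inner \<phi> (\<lambda>x. \<psi> x + \<psi>' x) = l2inner \<phi> \<psi> + l2inner \<phi> \<psi>'"
proof -
  have "cdot (\<phi> x) (\<psi> x + \<psi>' x) = cdot (\<phi> x) (\<psi> x) + cdot (\<phi> x) (\<psi>' x)" for x
    by (simp add: cdot_def distrib_left sum.distrib)
  then show ?thesis
    using infsum_add[OF cdot_summable[OF assms(1,2)] cdot_summable[OF assms(1,3)]] by (simp add: l2inner_cdot)
qed

lemma l2inner_smult_right: "l2inner \<phi> (\<lambda>x. a *s \<psi> x) = a * l2inner \<phi> \<psi>"
proof -
  have "cdot (\<phi> x) (a *s \<psi> x) = a * cdot (\<phi> x) (\<psi> x)" for x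
    by (simp add: cdot_def sum_distrib_left mult_ac)
  then show ?thesis
    by (simp add: l2inner_cdot infsum_cmult_right')
qed

lemma l2inner_commute: "l2inner \<phi> \<psi> = cnj (l2inner \<psi> \<phi>)"
proof -
  have "cdot (\<phi> x) (\<psi> x) = cnj (cdot (\<psi> x) (\<phi> x))" for x
    by (simp add: cdot_def mult.commute)
  then show ?thesis
    unfolding l2inner_cdot infsum_cnj[symmetric] by simp
qed

lemma l2inner_self:
  assumes "\<psi> \<in> ell2" shows "l2inner \<psi> \<psi> = complex_of_real ((l2norm \<psi>)\<^sup>2)"
proof -
  have "((\<lambda>x. complex_of_real ((norm (\<psi> x))\<^sup>2)) has_sum complex_of_real (infsum (\<lambda>x. (norm (\<psi> x))\<^sup>2) UNIV)) UNIV"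
    using assms unfolding ell2_iff by (intro has_sum_of_real has_sum_infsum)
  then show ?thesis
    unfolding l2inner_cdot cdot_self l2norm_def by (simp add: infsumI infsum_nonneg del: of_real_power)
qed

section \<open>The type of square summable states as a complex Hilbert space\<close>

typedef l2 = ell2
  using ell2_zero by blast

setup_lifting type_definition_l2

instantiation l2 :: real_inner
begin

lift_definition zero_l2 :: l2 is "\<lambda>x. 0" by (rule ell2_zero)
lift_definition plus_l2 :: "l2 \<Rightarrow> l2 \<Rightarrow> l2" is "\<lambda>\<phi> \<psi> x. \<phi> x + \<psi> x" by (rule ell2_add)
lift_definition minus_l2 :: "l2 \<Rightarrow> l2 \<Rightarrow> l2" is "\<lambda>\<phi> \<psi> x. \<phi> x - \<psi> x" by (rule ell2_diff)
lift_definition uminus_l2 :: "l2 \<Rightarrow> l2" is "\<lambda>\<psi> x. - \<psi> x" by (rule ell2_uminus)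
lift_definition scaleR_l2 :: "real \<Rightarrow> l2 \<Rightarrow> l2" is "\<lambda>a \<psi> x. a *\<^sub>R \<psi> x" by (rule ell2_scaleR)
lift_definition norm_l2 :: "l2 \<Rightarrow> real" is l2norm .
lift_definition inner_l2 :: "l2 \<Rightarrow> l2 \<Rightarrow> real" is "\<lambda>\<phi> \<psi>. Re (l2inner \<phi> \<psi>)" .

definition dist_l2 :: "l2 \<Rightarrow> l2 \<Rightarrow> real" where "dist_l2 x y = norm (x - y)"
definition sgn_l2 :: "l2 \<Rightarrow> l2" where "sgn_l2 x = inverse (norm x) *\<^sub>R x"
definition uniformity_l2 :: "(l2 \<times> l2) filter" where
  "uniformity_l2 = (INF e\<in>{0<..}. principal {(x, y). dist x y < e})"
definition open_l2 :: "l2 set \<Rightarrow> bool" where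
  "open_l2 S \<longleftrightarrow> (\<forall>x\<in>S. \<forall>\<^sub>F (x', y) in uniformity. x' = x \<longrightarrow> y \<in> S)"

instance
proof
  fix x y z :: l2 and a b :: real and A :: "l2 set"
  show "x + y + z = x + (y + z)" "x + y = y + x" "0 + x = x" "- x + x = 0" "x - y = x + - y"
    by (transfer, simp add: fun_eq_iff)+
  show "a *\<^sub>R (x + y) = a *\<^sub>R x + a *\<^sub>R y" "(a + b) *\<^sub>R x = a *\<^sub>R x + b *\<^sub>R x"
    "a *\<^sub>R b *\<^sub>R x = (a * b) *\<^sub>R x" "1 *\<^sub>R x = x"
    by (transfer, simp add: fun_eq_iff scaleR_add_left scaleR_add_right)+
  show "dist x y = norm (x - y)" "sgn x = inverse (norm x) *\<^sub>R x"
    by (simp_all add: dist_l2_def sgn_l2_def)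
  show "uniformity = (INF e\<in>{0<..}. principal {(x, y). dist x y < (e::real)} :: (l2 \<times> l2) filter)"
    by (simp add: uniformity_l2_def)
  show "open A \<longleftrightarrow> (\<forall>x\<in>A. \<forall>\<^sub>F (x', y) in uniformity. x' = x \<longrightarrow> y \<in> A)"
    by (simp add: open_l2_def)
  show "inner x y = inner y x"
  proof transfer
    fix \<phi> \<psi> :: state
    show "Re (l2inner \<phi> \<psi>) = Re (l2inner \<psi> \<phi>)"
      by (subst l2inner_commute) simp
  qed
  show "inner (x + y) z = inner x z + inner y z"
  proof transfer
    fix \<phi> \<phi>' \<psi> :: state assume *: "\<phi> \<in> ell2" "\<phi>' \<in> ell2" "\<psi> \<in> ell2"
    show "Re (l2inner (\<lambda>x. \<phi> x + \<phi>' x) \<psi>) = Re (l2inner \<phi> \<psi>) + Re (l2inner \<phi>' \<psi>)"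
      unfolding l2inner_commute[of _ \<psi>] l2inner_add_right[OF *(3,1,2)] by simp
  qed
  show "inner (a *\<^sub>R x) y = a * inner x y"
  proof transfer
    fix \<phi> \<psi> :: state and a :: real
    have "(\<lambda>x. a *\<^sub>R \<phi> x) = (\<lambda>x. complex_of_real a *s \<phi> x)"
      by (simp add: vec_eq_iff fun_eq_iff scaleR_conv_of_real[where 'a = complex])
    then show "Re (l2inner (\<lambda>x. a *\<^sub>R \<phi> x) \<psi>) = a * Re (l2inner \<phi> \<psi>)"
      unfolding l2inner_commute[of _ \<psi>] by (simp add: l2inner_smult_right)
  qed
  show "0 \<le> inner x x"
    by transfer (simp add: l2inner_self del: of_real_power)
  show "norm x = sqrt (inner x x)"
    by transfer (simp add: l2inner_self l2norm_def infsum_nonneg del: of_real_power)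
  show "(inner x x = 0) = (x = 0)"
  proof transfer
    fix \<psi> :: state assume \<psi>: "\<psi> \<in> ell2"
    have "\<psi> x = 0" if "l2norm \<psi> = 0" for x
    proof -
      have "(norm (\<psi> x))\<^sup>2 = 0"
        using that \<psi> unfolding ell2_iff l2norm_def
        by (intro nonneg_infsum_le_0D[of "\<lambda>x. (norm (\<psi> x))\<^sup>2" UNIV]) auto
      then show ?thesis by simp
    qed
    then have "l2norm \<psi> = 0 \<Longrightarrow> \<psi> = (\<lambda>x. 0)"
      by (intro ext)
    moreover have "l2norm (\<lambda>x. 0) = 0"
      by (simp add: l2norm_def)
    ultimately have "l2norm \<psi> = 0 \<longleftrightarrow> \<psi> = (\<lambda>x. 0)"
      by metis
    then show "(Re (l2inner \<psi> \<psi>) = 0) = (\<psi> = (\<lambda>x. 0))"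
      using l2inner_self[OF \<psi>] by simp
  qed
qed

end

lemma l2_component_le: "norm (Rep_l2 v x) \<le> norm v"
proof transfer
  fix \<psi> :: state and x assume "\<psi> \<in> ell2"
  then have "sum (\<lambda>x. (norm (\<psi> x))\<^sup>2) {x} \<le> infsum (\<lambda>x. (norm (\<psi> x))\<^sup>2) UNIV"
    unfolding ell2_iff by (intro finite_sum_le_infsum) auto
  then show "norm (\<psi> x) \<le> l2norm \<psi>"
    unfolding l2norm_def by (intro real_le_rsqrt) simp
qed

lemma l2_finite_sum_le: "finite F \<Longrightarrow> (\<Sum>x\<in>F. (norm (Rep_l2 v x))\<^sup>2) \<le> (norm v)\<^sup>2"
proof transfer
  fix \<psi> :: state and F :: "int set" assume "\<psi> \<in> ell2" "finite F"
  then have "sum (\<lambda>x. (norm (\<psi> x))\<^sup>2) F \<le> infsum (\<lambda>x. (norm (\<psi> x))\<^sup>2) UNIV"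
    unfolding ell2_iff by (intro finite_sum_le_infsum) auto
  then show "(\<Sum>x\<in>F. (norm (\<psi> x))\<^sup>2) \<le> (l2norm \<psi>)\<^sup>2"
    by (simp add: l2norm_def infsum_nonneg)
qed

text \<open>Finite sums over sites decide membership and the norm bound together, and they pass to
  pointwise limits; completeness rests on this.\<close>

lemma l2_bounded_sums:
  fixes \<psi> :: state
  assumes "\<And>F. finite F \<Longrightarrow> (\<Sum>x\<in>F. (norm (\<psi> x))\<^sup>2) \<le> e\<^sup>2" "0 \<le> e"
  shows "\<psi> \<in> ell2" "l2norm \<psi> \<le> e"
proof -
  show 1: "\<psi> \<in> ell2"
    unfolding ell2_iff
    by (rule nonneg_bdd_above_summable_on) (use assms in \<open>auto intro!: bdd_aboveI\<close>)
  then have "infsum (\<lambda>x. (norm (\<psi> x))\<^sup>2) UNIV \<le> e\<^sup>2"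
    unfolding ell2_iff by (rule infsum_le_finite_sums) (use assms in auto)
  then show "l2norm \<psi> \<le> e"
    unfolding l2norm_def using assms(2) real_sqrt_le_mono by fastforce
qed

lemma Rep_l2_minus: "Rep_l2 (v - w) x = Rep_l2 v x - Rep_l2 w x"
  by transfer simp

instance l2 :: complete_space
proof
  fix X :: "nat \<Rightarrow> l2" assume "Cauchy X"
  then have C: "\<And>e. 0 < e \<Longrightarrow> \<exists>M. \<forall>m\<ge>M. \<forall>n\<ge>M. norm (X m - X n) < e"
    unfolding Cauchy_def dist_norm by blast
  have "Cauchy (\<lambda>n. Rep_l2 (X n) x)" for x
  proof (rule metric_CauchyI)
    fix e :: real assume "0 < e"
    then obtain M where "\<forall>m\<ge>M. \<forall>n\<ge>M. norm (X m - X n) < e" using C by blast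
    then show "\<exists>M. \<forall>m\<ge>M. \<forall>n\<ge>M. dist (Rep_l2 (X m) x) (Rep_l2 (X n) x) < e"
      unfolding dist_norm Rep_l2_minus[symmetric] by (meson l2_component_le le_less_trans)
  qed
  then have "\<forall>x. \<exists>l. (\<lambda>n. Rep_l2 (X n) x) \<longlonglongrightarrow> l"
    by (metis Cauchy_convergent convergent_def)
  then obtain L where L: "\<And>x. (\<lambda>n. Rep_l2 (X n) x) \<longlonglongrightarrow> L x" by metis
  \<comment> \<open>For a fixed finite set of sites the Cauchy bound survives letting the second
    index tend to infinity, and it does not depend on that set.\<close>
  have key: "\<exists>M. \<forall>n\<ge>M. (\<lambda>x. Rep_l2 (X n) x - L x) \<in> ell2 \<and> l2norm (\<lambda>x. Rep_l2 (X n) x - L x) \<le> e" if e: "0 < e" for e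
  proof -
    obtain M where M: "\<And>m n. M \<le> m \<Longrightarrow> M \<le> n \<Longrightarrow> norm (X m - X n) < e" using C[OF e] by blast
    have "(\<Sum>x\<in>F. (norm (Rep_l2 (X n) x - L x))\<^sup>2) \<le> e\<^sup>2" if F: "finite F" and n: "M \<le> n" for F n
    proof (rule LIMSEQ_le_const2)
      show "(\<lambda>m. \<Sum>x\<in>F. (norm (Rep_l2 (X n) x - Rep_l2 (X m) x))\<^sup>2) \<longlonglongrightarrow> (\<Sum>x\<in>F. (norm (Rep_l2 (X n) x - L x))\<^sup>2)"
        by (intro tendsto_intros L)
      have "(\<Sum>x\<in>F. (norm (Rep_l2 (X n) x - Rep_l2 (X m) x))\<^sup>2) \<le> e\<^sup>2" if m: "M \<le> m" for m
      proof -
        have "(\<Sum>x\<in>F. (norm (Rep_l2 (X n) x - Rep_l2 (X m) x))\<^sup>2) \<le> (norm (X n - X m))\<^sup>2"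
          unfolding Rep_l2_minus[symmetric] by (rule l2_finite_sum_le[OF F])
        also have "\<dots> \<le> e\<^sup>2"
          using M[OF n m] by (intro power_mono) simp_all
        finally show ?thesis .
      qed
      then show "\<exists>N. \<forall>m\<ge>N. (\<Sum>x\<in>F. (norm (Rep_l2 (X n) x - Rep_l2 (X m) x))\<^sup>2) \<le> e\<^sup>2" by blast
    qed
    then show ?thesis
      using l2_bounded_sums[of "\<lambda>x. Rep_l2 (X _) x - L x" e] e by (intro exI[of _ M]) auto
  qed
  obtain M where "(\<lambda>x. Rep_l2 (X M) x - L x) \<in> ell2"
    using key[of 1] by auto
  then have "L \<in> ell2"
    using ell2_diff[OF Rep_l2[of "X M"]] by fastforce
  then have Rep: "Rep_l2 (Abs_l2 L) = L" by (rule Abs_l2_inverse)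
  have nd: "norm (X n - Abs_l2 L) = l2norm (\<lambda>x. Rep_l2 (X n) x - L x)" for n
    unfolding norm_l2.rep_eq minus_l2.rep_eq Rep ..
  have "X \<longlonglongrightarrow> Abs_l2 L"
  proof (rule LIMSEQ_I)
    fix e :: real assume e: "0 < e"
    then obtain M where "\<forall>n\<ge>M. l2norm (\<lambda>x. Rep_l2 (X n) x - L x) \<le> e / 2"
      using key[of "e / 2"] by auto
    then show "\<exists>M. \<forall>n\<ge>M. norm (X n - Abs_l2 L) < e"
      unfolding nd using e by (intro exI[of _ M]) force
  qed
  then show "convergent X" by (rule convergentI)
qed

instantiation l2 :: complex_hilbert
begin

lift_definition scaleC_l2 :: "complex \<Rightarrow> l2 \<Rightarrow> l2" is "\<lambda>a \<psi> x. a *s \<psi> x" by (rule ell2_smult)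
lift_definition cinner_l2 :: "l2 \<Rightarrow> l2 \<Rightarrow> complex" is l2inner .

instance
proof
  fix x y z :: l2 and a :: complex
  show "cinner x (y + z) = cinner x y + cinner x z"
    by transfer (rule l2inner_add_right)
  show "cinner x (a *\<^sub>C y) = a * cinner x y"
    by transfer (rule l2inner_smult_right)
  show "cinner x y = cnj (cinner y x)"
    by transfer (rule l2inner_commute)
  show "Re (cinner x y) = inner x y"
    by transfer (rule refl)
qed

end

section \<open>Walk operators on the Hilbert space\<close>

lemma shift_cdot:
  "cdot (shift_op \<phi> x) (shift_op \<psi> x) = cnj (\<phi> (x + 1) $ 1) * \<psi> (x + 1) $ 1 + cnj (\<phi> (x - 1) $ 2) * \<psi> (x - 1) $ 2"
  by (simp add: shift_op_def cdot_def sum_2 vector_2)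

lemma bij_add_int: "bij (\<lambda>x::int. x + c)"
  by (rule o_bij[of "\<lambda>x. x - c"]) auto

lemma component_summable:
  assumes "\<psi> \<in> ell2" shows "(\<lambda>x. (norm (\<psi> x $ j))\<^sup>2) summable_on UNIV"
proof (rule summable_on_le)
  show "(\<lambda>x. (norm (\<psi> x))\<^sup>2) summable_on UNIV" using assms by (simp add: ell2_iff)
  show "(norm (\<psi> x $ j))\<^sup>2 \<le> (norm (\<psi> x))\<^sup>2" for x
    by (intro power_mono Finite_Cartesian_Product.norm_nth_le norm_ge_zero)
qed simp

lemma component_product_summable:
  assumes "\<phi> \<in> ell2" "\<psi> \<in> ell2" shows "(\<lambda>x. cnj (\<phi> x $ j) * \<psi> x $ j) summable_on UNIV"
proof (rule abs_summable_summable, rule summable_on_le)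
  show "(\<lambda>x. (norm (\<phi> x $ j))\<^sup>2 + (norm (\<psi> x $ j))\<^sup>2) summable_on UNIV"
    by (intro summable_on_add component_summable assms)
  show "norm (cnj (\<phi> x $ j) * \<psi> x $ j) \<le> (norm (\<phi> x $ j))\<^sup>2 + (norm (\<psi> x $ j))\<^sup>2" for x
  proof -
    have "2 * (norm (\<phi> x $ j) * norm (\<psi> x $ j)) \<le> (norm (\<phi> x $ j))\<^sup>2 + (norm (\<psi> x $ j))\<^sup>2"
      using sum_squares_bound[of "norm (\<phi> x $ j)" "norm (\<psi> x $ j)"] by simp
    moreover have "0 \<le> norm (\<phi> x $ j) * norm (\<psi> x $ j)" by simp
    ultimately show ?thesis unfolding norm_mult complex_mod_cnj by linarith
  qed
qed simp

lemma shift_ell2: assumes "\<psi> \<in> ell2" shows "shift_op \<psi> \<in> ell2"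
proof -
  have "(\<lambda>x. (norm (\<psi> (x + 1) $ 1))\<^sup>2) summable_on UNIV" "(\<lambda>x. (norm (\<psi> (x + - 1) $ 2))\<^sup>2) summable_on UNIV"
    using summable_on_reindex_bij_betw[OF bij_add_int, where f = "\<lambda>x. (norm (\<psi> x $ _))\<^sup>2"] component_summable[OF assms]
    by blast+
  from summable_on_add[OF this] show ?thesis
    by (simp add: ell2_iff norm2_eq shift_op_def vector_2)
qed

lemma shift_inv_ell2: assumes "\<psi> \<in> ell2" shows "shift_inv \<psi> \<in> ell2"
proof -
  have "(\<lambda>x. (norm (\<psi> (x + - 1) $ 1))\<^sup>2) summable_on UNIV" "(\<lambda>x. (norm (\<psi> (x + 1) $ 2))\<^sup>2) summable_on UNIV"
    using summable_on_reindex_bij_betw[OF bij_add_int, where f = "\<lambda>x. (norm (\<psi> x $ _))\<^sup>2"] component_summable[OF assms]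
    by blast+
  from summable_on_add[OF this] show ?thesis
    by (simp add: ell2_iff norm2_eq shift_inv_def vector_2)
qed

text \<open>The shift translates the two components in opposite directions. Each component is
  summable on its own, so the sum can be split and each part reindexed by a translation of the
  integers.\<close>

lemma shift_l2inner:
  assumes "\<phi> \<in> ell2" "\<psi> \<in> ell2"
  shows "l2inner (shift_op \<phi>) (shift_op \<psi>) = l2inner \<phi> \<psi>"
proof -
  let ?p = "\<lambda>j x. cnj (\<phi> x $ j) * \<psi> x $ j"
  have s: "(\<lambda>x. ?p j x) summable_on UNIV" for j
    by (rule component_product_summable[OF assms])
  have s': "(\<lambda>x. ?p j (x + c)) summable_on UNIV" for j c
    using summable_on_reindex_bij_betw[OF bij_add_int, where f = "?p j"] s by blast
  have "l2inner (shift_op \<phi>) (shift_op \<psi>) = infsum (\<lambda>x. ?p 1 (x + 1) + ?p 2 (x + - 1)) UNIV"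
    unfolding l2inner_cdot shift_cdot by simp
  also have "\<dots> = infsum (\<lambda>x. ?p 1 (x + 1)) UNIV + infsum (\<lambda>x. ?p 2 (x + - 1)) UNIV"
    by (rule infsum_add[OF s' s'])
  also have "\<dots> = infsum (?p 1) UNIV + infsum (?p 2) UNIV"
    by (simp only: infsum_reindex_bij_betw[OF bij_add_int, where f = "?p _"])
  also have "\<dots> = infsum (\<lambda>x. ?p 1 x + ?p 2 x) UNIV"
    by (rule infsum_add[OF s s, symmetric])
  also have "\<dots> = l2inner \<phi> \<psi>"
    by (simp add: l2inner_def sum_2)
  finally show ?thesis .
qed

lemma shift_inv_shift: "shift_inv (shift_op \<psi>) = \<psi>" "shift_op (shift_inv \<psi>) = \<psi>"
  by (simp_all add: shift_op_def shift_inv_def fun_eq_iff vec_eq_iff forall_2 vector_2)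

lemma cdot_adjm: "cdot (A *v v) w = cdot v (adjm A *v w)"
  by (simp add: cdot_def adjm_def matrix_vector_mult_def sum_2 algebra_simps)

lemma unitary2_cdot: "unitary2 A \<Longrightarrow> cdot (A *v v) (A *v w) = cdot v w"
  by (simp add: cdot_adjm matrix_vector_mul_assoc unitary2_def)

lemma unitary2_norm: assumes "unitary2 A" shows "norm (A *v v) = norm v"
proof -
  have "complex_of_real ((norm (A *v v))\<^sup>2) = complex_of_real ((norm v)\<^sup>2)"
    unfolding cdot_self[symmetric] by (rule unitary2_cdot[OF assms])
  then show ?thesis
    unfolding of_real_eq_iff by (rule power2_eq_imp_eq) auto
qed

lemma unitary2_adjm: "unitary2 A \<Longrightarrow> unitary2 (adjm A)"
proof -
  have "adjm (adjm A) = A" for A by (simp add: adjm_def vec_eq_iff)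
  then show "unitary2 A \<Longrightarrow> unitary2 (adjm A)" by (simp add: unitary2_def)
qed

lemma unitary2_mat1: "unitary2 (mat 1)"
proof -
  have "adjm (mat 1) = mat 1" by (simp add: adjm_def mat_def vec_eq_iff)
  then show ?thesis by (simp add: unitary2_def)
qed

lemma qw_ell2: "\<forall>x. unitary2 (C x) \<Longrightarrow> \<psi> \<in> ell2 \<Longrightarrow> qw C \<psi> \<in> ell2"
  unfolding qw_def comp_def by (intro shift_ell2) (simp add: ell2_iff coin_op_def unitary2_norm)

lemma qw_inv_ell2: "\<forall>x. unitary2 (C x) \<Longrightarrow> \<psi> \<in> ell2 \<Longrightarrow> qw_inv C \<psi> \<in> ell2"
  using shift_inv_ell2[of \<psi>] by (simp add: qw_inv_def ell2_iff coin_op_def unitary2_norm[OF unitary2_adjm])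

lemma qw_qw_inv:
  assumes "\<forall>x. unitary2 (C x)"
  shows "qw C (qw_inv C \<psi>) = \<psi>" "qw_inv C (qw C \<psi>) = \<psi>"
  using assms
  by (simp_all add: qw_def qw_inv_def coin_op_def shift_inv_shift matrix_vector_mul_assoc unitary2_def)

lemma qw_l2inner:
  assumes "\<forall>x. unitary2 (C x)" "\<phi> \<in> ell2" "\<psi> \<in> ell2"
  shows "l2inner (qw C \<phi>) (qw C \<psi>) = l2inner \<phi> \<psi>"
proof -
  have "coin_op C \<phi> \<in> ell2" "coin_op C \<psi> \<in> ell2"
    using assms by (simp_all add: ell2_iff coin_op_def unitary2_norm)
  then have "l2inner (qw C \<phi>) (qw C \<psi>) = l2inner (coin_op C \<phi>) (coin_op C \<psi>)"
    by (simp add: qw_def shift_l2inner)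
  also have "\<dots> = l2inner \<phi> \<psi>"
    using assms(1) by (simp add: l2inner_cdot coin_op_def unitary2_cdot)
  finally show ?thesis .
qed

definition walk :: "(int \<Rightarrow> complex^2^2) \<Rightarrow> l2 \<Rightarrow> l2" where
  "walk C v = Abs_l2 (qw C (Rep_l2 v))"

context
  fixes C :: "int \<Rightarrow> complex^2^2"
  assumes C: "\<forall>x. unitary2 (C x)"
begin

lemma Rep_walk: "Rep_l2 (walk C v) = qw C (Rep_l2 v)"
  unfolding walk_def by (rule Abs_l2_inverse) (rule qw_ell2[OF C Rep_l2])

lemma unitary_walk: "unitary (walk C)"
  unfolding unitary_def
proof (intro conjI allI)
  show "cinner (walk C v) (walk C w) = cinner v w" for v w
    unfolding cinner_l2.rep_eq Rep_walk by (rule qw_l2inner[OF C Rep_l2 Rep_l2])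
  show "surj (walk C)"
  proof (rule surjI)
    fix v
    have "Rep_l2 (Abs_l2 (qw_inv C (Rep_l2 v))) = qw_inv C (Rep_l2 v)"
      by (rule Abs_l2_inverse) (rule qw_inv_ell2[OF C Rep_l2])
    then show "walk C (Abs_l2 (qw_inv C (Rep_l2 v))) = v"
      by (simp add: walk_def qw_qw_inv[OF C] Rep_l2_inverse)
  qed
qed

lemma Rep_inv_walk: "Rep_l2 (inv (walk C) v) = qw_inv C (Rep_l2 v)"
  using arg_cong[OF Rep_walk[of "inv (walk C) v"], of "qw_inv C"]
  by (simp add: unitary_f_inv[OF unitary_walk] qw_qw_inv[OF C])

lemma Rep_walk_funpow: "Rep_l2 ((walk C ^^ n) v) = (qw C ^^ n) (Rep_l2 v)"
  by (induction n) (simp_all add: Rep_walk)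

lemma Rep_inv_walk_funpow: "Rep_l2 ((inv (walk C) ^^ n) v) = (qw_inv C ^^ n) (Rep_l2 v)"
  by (induction n) (simp_all add: Rep_inv_walk)

lemma ac_subspace_walk: "ac_subspace (qw C) = Rep_l2 ` ac_vectors (walk C)"
proof -
  have iff: "Rep_l2 v \<in> ac_subspace (qw C) \<longleftrightarrow> v \<in> ac_vectors (walk C)" for v
    unfolding ac_subspace_def ac_vectors_def mem_Collect_eq cinner_l2.rep_eq Rep_walk_funpow
    using Rep_l2[of v] by (simp only: simp_thms)
  show ?thesis
  proof (intro equalityI subsetI)
    fix \<psi> assume \<psi>: "\<psi> \<in> ac_subspace (qw C)"
    then have "\<psi> \<in> ell2" unfolding ac_subspace_def by blast
    then obtain v where "\<psi> = Rep_l2 v" using Abs_l2_inverse by metis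
    then show "\<psi> \<in> Rep_l2 ` ac_vectors (walk C)" using \<psi> iff by blast
  qed (use iff in blast)
qed

end

section \<open>Site weights and the perturbation of the coin\<close>

definition delta :: "int \<Rightarrow> 2 \<Rightarrow> state" where
  "delta x j = (\<lambda>y. if y = x then axis j 1 else 0)"

lemma delta_l2: "delta x j \<in> ell2" "l2norm (delta x j) = 1"
proof -
  have "(\<lambda>y. (norm (delta x j y))\<^sup>2) = (\<lambda>y. if y = x then 1 else 0)"
    by (simp add: delta_def fun_eq_iff)
  moreover have "((\<lambda>y. if y = x then 1 else (0::real)) has_sum 1) UNIV"
    by (rule has_sum_finite_neutralI[of "{x}"]) auto
  ultimately show "delta x j \<in> ell2" "l2norm (delta x j) = 1"
    by (auto simp: ell2_iff l2norm_def summable_on_def infsumI)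
qed

lemma l2inner_delta: "l2inner (delta x j) \<psi> = \<psi> x $ j"
proof -
  have "cdot (axis j 1) v = v $ j" for v
    by (simp add: cdot_def axis_def if_distrib[of cnj] if_distrib[of "\<lambda>a. a * _"] cong: if_cong)
  then show ?thesis
    unfolding l2inner_cdot
    by (intro infsumI has_sum_finite_neutralI[of "{x}"]) (auto simp: delta_def cdot_def)
qed

lemma infsum_finite_sum:
  fixes f :: "nat \<Rightarrow> 'a \<Rightarrow> real"
  assumes "\<And>n. f n summable_on A"
  shows "(\<lambda>x. \<Sum>n<N. f n x) summable_on A" "infsum (\<lambda>x. \<Sum>n<N. f n x) A = (\<Sum>n<N. infsum (f n) A)"
  using assms by (induction N) (simp_all add: summable_on_add infsum_add)

text \<open>For nonnegative summable \<open>d\<close> this is the norm of the state after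
  multiplication by the square root of \<open>d\<close>, a Hilbert-Schmidt multiplication
  operator.\<close>

definition site_weight :: "(int \<Rightarrow> real) \<Rightarrow> l2 \<Rightarrow> real" where
  "site_weight d v = sqrt (infsum (\<lambda>x. d x * (norm (Rep_l2 v x))\<^sup>2) UNIV)"

context
  fixes d :: "int \<Rightarrow> real"
  assumes d: "\<And>x. 0 \<le> d x" and sum_d: "d summable_on UNIV"
begin

lemma site_weight_summable: "(\<lambda>x. d x * (norm (Rep_l2 v x))\<^sup>2) summable_on UNIV"
proof (rule summable_on_le)
  show "(\<lambda>x. (norm v)\<^sup>2 * d x) summable_on UNIV"
    by (intro summable_on_cmult_right sum_d)
  show "d x * (norm (Rep_l2 v x))\<^sup>2 \<le> (norm v)\<^sup>2 * d x" for x
    using d[of x] l2_component_le[of v x] by (subst mult.commute) (intro mult_right_mono power_mono, auto)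
qed (simp add: d)

lemma site_weight_square: "(site_weight d v)\<^sup>2 = infsum (\<lambda>x. d x * (norm (Rep_l2 v x))\<^sup>2) UNIV"
  by (simp add: site_weight_def infsum_nonneg d)

text \<open>Testing the Bessel bound against the two unit vectors at a site gives at most
  \<open>2 * B\<close> there; summing over sites with weight \<open>d\<close> finishes. The constant
  is the squared Hilbert-Schmidt norm, with \<open>2\<close> the dimension of the coin
  space.\<close>

lemma hilbert_schmidt_site_weight: "hilbert_schmidt_weight (site_weight d)"
  unfolding hilbert_schmidt_weight_def
proof (intro conjI allI exI[of _ "2 * infsum d UNIV"] impI)
  show "0 \<le> site_weight d u" for u
    by (simp add: site_weight_def infsum_nonneg d)
  show "0 \<le> 2 * infsum d UNIV"
    by (simp add: infsum_nonneg d)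
  fix v :: "nat \<Rightarrow> l2" and B N
  assume B: "0 \<le> B" "bessel B v"
  have site: "(\<Sum>n<N. (norm (Rep_l2 (v n) x))\<^sup>2) \<le> 2 * B" for x
  proof -
    have comp: "(\<Sum>n<N. (cmod (Rep_l2 (v n) x $ j))\<^sup>2) \<le> B" for j
    proof -
      define e where "e = Abs_l2 (delta x j)"
      have e: "Rep_l2 e = delta x j"
        unfolding e_def by (rule Abs_l2_inverse) (rule delta_l2)
      have "norm e = 1" by (simp add: norm_l2.rep_eq e delta_l2)
      moreover have "cinner e (v n) = Rep_l2 (v n) x $ j" for n
        by (simp add: cinner_l2.rep_eq e l2inner_delta)
      ultimately show ?thesis
        using besselD[OF B(2), of e N] by simp
    qed
    show ?thesis
      unfolding norm2_eq sum.distrib using comp[of 1] comp[of 2] by simp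
  qed
  have "(\<Sum>n<N. (site_weight d (v n))\<^sup>2) = infsum (\<lambda>x. \<Sum>n<N. d x * (norm (Rep_l2 (v n) x))\<^sup>2) UNIV"
    unfolding site_weight_square by (rule infsum_finite_sum(2)[symmetric]) (rule site_weight_summable)
  also have "\<dots> \<le> infsum (\<lambda>x. (2 * B) * d x) UNIV"
  proof (rule infsum_mono)
    show "(\<lambda>x. \<Sum>n<N. d x * (norm (Rep_l2 (v n) x))\<^sup>2) summable_on UNIV"
      by (rule infsum_finite_sum(1)) (rule site_weight_summable)
    show "(\<lambda>x. (2 * B) * d x) summable_on UNIV"
      by (intro summable_on_cmult_right sum_d)
    show "(\<Sum>n<N. d x * (norm (Rep_l2 (v n) x))\<^sup>2) \<le> (2 * B) * d x" for x
      unfolding sum_distrib_left[symmetric] using site[of x] d[of x] by (subst mult.commute) (rule mult_right_mono)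
  qed
  also have "\<dots> = 2 * infsum d UNIV * B"
    by (simp add: infsum_cmult_right')
  finally show "(\<Sum>n<N. (site_weight d (v n))\<^sup>2) \<le> 2 * infsum d UNIV * B" .
qed

text \<open>Write \<open>d x\<close> as the product of two square roots, give one to each state and
  apply Cauchy-Schwarz over the sites. This is the factorisation of the perturbation into two
  Hilbert-Schmidt operators.\<close>

lemma weighted_cdot_le:
  assumes D: "\<And>x v. norm (D x *v v) \<le> d x * norm v"
  shows "cmod (infsum (\<lambda>x. cdot (Rep_l2 u x) (D x *v Rep_l2 v x)) UNIV) \<le> site_weight d u * site_weight d v"
proof -
  let ?u = "\<lambda>x. norm (Rep_l2 u x)" and ?v = "\<lambda>x. norm (Rep_l2 v x)"
  have le: "cmod (cdot (Rep_l2 u x) (D x *v Rep_l2 v x)) \<le> d x * (?u x * ?v x)" for x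
  proof -
    have "cmod (cdot (Rep_l2 u x) (D x *v Rep_l2 v x)) \<le> ?u x * (d x * ?v x)"
      by (rule order_trans[OF norm_cdot_le]) (intro mult_left_mono D, simp)
    then show ?thesis by (simp add: mult_ac)
  qed
  have sm: "(\<lambda>x. cmod (cdot (Rep_l2 u x) (D x *v Rep_l2 v x))) summable_on UNIV"
  proof (rule summable_on_le)
    show "(\<lambda>x. (norm u * norm v) * d x) summable_on UNIV"
      by (intro summable_on_cmult_right sum_d)
    show "cmod (cdot (Rep_l2 u x) (D x *v Rep_l2 v x)) \<le> (norm u * norm v) * d x" for x
      using le[of x] mult_left_mono[OF mult_mono[OF l2_component_le[of u x] l2_component_le[of v x]] d[of x]]
      by (simp add: mult_ac)
  qed simp
  have "cmod (infsum (\<lambda>x. cdot (Rep_l2 u x) (D x *v Rep_l2 v x)) UNIV)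
      \<le> infsum (\<lambda>x. cmod (cdot (Rep_l2 u x) (D x *v Rep_l2 v x))) UNIV"
    by (rule norm_infsum_bound[OF sm])
  also have "\<dots> \<le> site_weight d u * site_weight d v"
  proof (rule infsum_le_finite_sums[OF sm])
    fix F :: "int set" assume F: "finite F"
    have part: "L2_set (\<lambda>x. sqrt (d x) * norm (Rep_l2 w x)) F \<le> site_weight d w" for w
    proof -
      have "(\<Sum>x\<in>F. (sqrt (d x) * norm (Rep_l2 w x))\<^sup>2) = (\<Sum>x\<in>F. d x * (norm (Rep_l2 w x))\<^sup>2)"
        by (simp add: power_mult_distrib d)
      also have "\<dots> \<le> infsum (\<lambda>x. d x * (norm (Rep_l2 w x))\<^sup>2) UNIV"
        by (rule finite_sum_le_infsum[OF site_weight_summable F]) (auto simp: d)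
      finally show ?thesis
        unfolding L2_set_def site_weight_def by (rule real_sqrt_le_mono)
    qed
    have "(\<Sum>x\<in>F. cmod (cdot (Rep_l2 u x) (D x *v Rep_l2 v x)))
        \<le> (\<Sum>x\<in>F. \<bar>sqrt (d x) * ?u x\<bar> * \<bar>sqrt (d x) * ?v x\<bar>)"
    proof (rule sum_mono)
      fix x
      have "\<bar>sqrt (d x) * ?u x\<bar> * \<bar>sqrt (d x) * ?v x\<bar> = (sqrt (d x) * sqrt (d x)) * (?u x * ?v x)"
        using d[of x] by (simp only: abs_mult abs_norm_cancel abs_of_nonneg[OF real_sqrt_ge_zero] mult_ac)
      also have "\<dots> = d x * (?u x * ?v x)"
        using d[of x] by simp
      finally show "cmod (cdot (Rep_l2 u x) (D x *v Rep_l2 v x)) \<le> \<bar>sqrt (d x) * ?u x\<bar> * \<bar>sqrt (d x) * ?v x\<bar>"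
        using le[of x] by (simp only:)
    qed
    also have "\<dots> \<le> L2_set (\<lambda>x. sqrt (d x) * ?u x) F * L2_set (\<lambda>x. sqrt (d x) * ?v x) F"
      by (rule L2_set_mult_ineq)
    also have "\<dots> \<le> site_weight d u * site_weight d v"
      by (intro mult_mono part) (auto simp: site_weight_def infsum_nonneg d)
    finally show "(\<Sum>x\<in>F. cmod (cdot (Rep_l2 u x) (D x *v Rep_l2 v x))) \<le> site_weight d u * site_weight d v" .
  qed
  finally show ?thesis .
qed

end

lemma hilbert_schmidt_weight_unitary:
  assumes "hilbert_schmidt_weight \<alpha>" "unitary V"
  shows "hilbert_schmidt_weight (\<lambda>v. \<alpha> (V v))"
proof -
  obtain A where "A \<ge> 0" "\<And>x B N. 0 \<le> B \<Longrightarrow> bessel B x \<Longrightarrow> (\<Sum>n<N. (\<alpha> (x n))\<^sup>2) \<le> A * B" "\<And>u. 0 \<le> \<alpha> u"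
    using assms(1) unfolding hilbert_schmidt_weight_def by blast
  then show ?thesis
    unfolding hilbert_schmidt_weight_def using bessel_unitary[OF assms(2)] by blast
qed

lemma powr_summable_int:
  assumes "0 < \<epsilon>"
  shows "(\<lambda>x::int. \<bar>real_of_int x\<bar> powr (-1 - \<epsilon>)) summable_on UNIV"
proof -
  let ?f = "\<lambda>x::int. \<bar>real_of_int x\<bar> powr (-1 - \<epsilon>)"
  have "summable (\<lambda>n. real n powr (-1 - \<epsilon>))"
    using assms by (subst summable_real_powr_iff) simp
  then have nat: "(\<lambda>n. real n powr (-1 - \<epsilon>)) summable_on UNIV"
    by (intro norm_summable_imp_summable_on) simp
  have pos: "?f summable_on range int"
    using nat by (subst summable_on_reindex) (simp_all add: comp_def)
  have "?f summable_on range (\<lambda>n. - int n)"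
    using nat by (subst summable_on_reindex) (simp_all add: comp_def inj_on_def)
  then have neg: "?f summable_on (range (\<lambda>n. - int n) - range int)"
    by (rule summable_on_subset) auto
  have "UNIV = range int \<union> (range (\<lambda>n. - int n) - range int)"
  proof (intro equalityI subsetI UnCI)
    fix x :: int assume "x \<notin> range (\<lambda>n. - int n) - range int"
    then show "x \<in> range int"
      by (metis DiffI int_cases2 rangeI)
  qed auto
  then show ?thesis
    using summable_on_Un_disjoint[OF pos neg] by auto
qed

text \<open>The walk with coin \<open>mat 1\<close> is the bare shift. Moving it to the left
  argument leaves the local multiplication by \<open>C x - C0\<close>, which explains the inverse
  shift in the first weight.\<close>

lemma walk_trace_class_pair:
  fixes C :: "int \<Rightarrow> complex^2^2" and C0 :: "complex^2^2"
  assumes C: "\<forall>x. unitary2 (C x)" and C0: "unitary2 C0"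
    and decay: "\<exists>c1>0. \<exists>\<epsilon>>0. \<forall>x::int. x \<noteq> 0 \<longrightarrow>
           onorm (\<lambda>v. (C x - C0) *v v) \<le> c1 * \<bar>real_of_int x\<bar> powr (-1 - \<epsilon>)"
  defines "d \<equiv> \<lambda>x. onorm (\<lambda>v. (C x - C0) *v v)"
  shows "trace_class_pair (walk C) (walk (\<lambda>_. C0))
    (\<lambda>u. site_weight d (inv (walk (\<lambda>_. mat 1)) u)) (site_weight d)"
proof -
  have bl: "bounded_linear (\<lambda>v. (C x - C0) *v v)" for x
    by (rule matrix_vector_mul_bounded_linear)
  have d: "0 \<le> d x" for x
    unfolding d_def by (rule onorm_pos_le[OF bl])
  have D: "norm ((C x - C0) *v v) \<le> d x * norm v" for x v
    unfolding d_def by (rule onorm[OF bl])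
  obtain c1 \<epsilon> where c: "0 < c1" "0 < \<epsilon>" "\<And>x. x \<noteq> 0 \<Longrightarrow> d x \<le> c1 * \<bar>real_of_int x\<bar> powr (-1 - \<epsilon>)"
    using decay unfolding d_def by blast
  have sum_d: "d summable_on UNIV"
  proof -
    \<comment> \<open>The decay hypothesis says nothing at the origin; a single site is added back
      afterwards.\<close>
    have "d summable_on (UNIV - {0})"
      by (rule summable_on_le[OF summable_on_subset[OF summable_on_cmult_right[OF powr_summable_int[OF c(2)], of c1]]])
        (use d c in auto)
    then have "d summable_on ({0} \<union> (UNIV - {0}))"
      by (intro summable_on_Un_disjoint) auto
    then show ?thesis by simp
  qed
  have C0': "\<forall>x::int. unitary2 C0" and I: "\<forall>x::int. unitary2 (mat 1)"
    using C0 unitary2_mat1 by auto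
  note S = unitary_walk[OF I]
  show ?thesis
  proof (rule trace_class_pair.intro)
    show "unitary (walk C)" "unitary (walk (\<lambda>_. C0))"
      by (rule unitary_walk[OF C], rule unitary_walk[OF C0'])
    show hs: "hilbert_schmidt_weight (site_weight d)"
      by (rule hilbert_schmidt_site_weight[OF d sum_d])
    show "hilbert_schmidt_weight (\<lambda>u. site_weight d (inv (walk (\<lambda>_. mat 1)) u))"
      by (rule hilbert_schmidt_weight_unitary[OF hs unitary_inv[OF S]])
    fix u v :: l2
    define w where "w = inv (walk (\<lambda>_. mat 1)) (walk C v - walk (\<lambda>_. C0) v)"
    have w: "Rep_l2 w = (\<lambda>x. (C x - C0) *v Rep_l2 v x)"
    proof -
      have "adjm (mat 1) *v a = a" for a :: "complex^2"
        using unitary2_mat1 unfolding unitary2_def by simp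
      then have "qw_inv (\<lambda>_. mat 1) \<phi> = shift_inv \<phi>" for \<phi>
        by (simp add: qw_inv_def coin_op_def)
      moreover have "Rep_l2 (walk C v - walk (\<lambda>_. C0) v) = shift_op (\<lambda>x. (C x - C0) *v Rep_l2 v x)"
        unfolding minus_l2.rep_eq Rep_walk[OF C] Rep_walk[OF C0']
        by (simp add: fun_eq_iff qw_def coin_op_def shift_op_def vec_eq_iff forall_2 vector_2 matrix_vector_mult_diff_rdistrib)
      ultimately show ?thesis
        unfolding w_def Rep_inv_walk[OF I] by (simp add: shift_inv_shift)
    qed
    have "cinner u (walk C v - walk (\<lambda>_. C0) v) = cinner (inv (walk (\<lambda>_. mat 1)) u) w"
      unfolding w_def by (simp add: unitary_cinner[OF unitary_inv[OF S]])
    also have "\<dots> = infsum (\<lambda>x. cdot (Rep_l2 (inv (walk (\<lambda>_. mat 1)) u) x) ((C x - C0) *v Rep_l2 v x)) UNIV"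
      by (simp only: cinner_l2.rep_eq l2inner_cdot w)
    finally show "cmod (cinner u (walk C v - walk (\<lambda>_. C0) v)) \<le> site_weight d (inv (walk (\<lambda>_. mat 1)) u) * site_weight d v"
      using weighted_cdot_le[OF d sum_d D, of "inv (walk (\<lambda>_. mat 1)) u" v] by simp
  qed
qed

section \<open>Orthogonal projection and completeness of the wave operators\<close>

definition closed_csubspace :: "'a::complex_hilbert set \<Rightarrow> bool" where
  "closed_csubspace S \<longleftrightarrow> subspace S \<and> closed S \<and> (\<forall>a. \<forall>x\<in>S. a *\<^sub>C x \<in> S)"

lemma closed_csubspace_ac_vectors:
  assumes V: "unitary V" shows "closed_csubspace (ac_vectors V)"
  unfolding closed_csubspace_def ac_vectors_eq[OF V]
proof (intro conjI allI ballI)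
  show "subspace (closure (bessel_vectors V))"
    by (intro subspace_closure subspace_bessel_vectors V)
  fix a x assume "x \<in> closure (bessel_vectors V)"
  then obtain f where f: "\<And>n. f n \<in> bessel_vectors V" "f \<longlonglongrightarrow> x"
    using closure_seq_obtain by blast
  show "a *\<^sub>C x \<in> closure (bessel_vectors V)"
    by (rule closure_seqI[OF bessel_vectors_subspace(3)[OF V f(1)] tendsto_scaleC[OF f(2)]])
qed simp

definition cproj :: "'a::complex_hilbert set \<Rightarrow> 'a \<Rightarrow> 'a" where
  "cproj S \<psi> = (SOME \<phi>. \<phi> \<in> S \<and> (\<forall>x\<in>S. cinner x (\<psi> - \<phi>) = 0))"

context
  fixes S :: "'a::complex_hilbert set"
  assumes S: "closed_csubspace S"
begin

text \<open>A subspace stable under multiplication by the imaginary unit is complex orthogonal to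
  whatever it is real orthogonal to, so the real projection suffices.\<close>

lemma cproj: "cproj S \<psi> \<in> S" "x \<in> S \<Longrightarrow> cinner x (\<psi> - cproj S \<psi>) = 0"
proof -
  obtain \<phi> where \<phi>: "\<phi> \<in> S" "\<And>x. x \<in> S \<Longrightarrow> inner (\<psi> - \<phi>) x = 0"
    using orthogonal_projection_exists[of S] S unfolding closed_csubspace_def by metis
  have "cinner x (\<psi> - \<phi>) = 0" if x: "x \<in> S" for x
  proof (rule complex_eqI)
    show "Re (cinner x (\<psi> - \<phi>)) = Re 0"
      using \<phi>(2)[OF x] by (simp add: Re_cinner inner_commute)
    have "\<i> *\<^sub>C x \<in> S" using S x by (simp add: closed_csubspace_def)
    then show "Im (cinner x (\<psi> - \<phi>)) = Im 0"
      using \<phi>(2) by (metis Im_cinner inner_commute zero_complex.sel(2))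
  qed
  then have "\<exists>\<phi>. \<phi> \<in> S \<and> (\<forall>x\<in>S. cinner x (\<psi> - \<phi>) = 0)"
    using \<phi>(1) by blast
  then have *: "cproj S \<psi> \<in> S \<and> (\<forall>x\<in>S. cinner x (\<psi> - cproj S \<psi>) = 0)"
    unfolding cproj_def by (rule someI_ex)
  show "cproj S \<psi> \<in> S" "x \<in> S \<Longrightarrow> cinner x (\<psi> - cproj S \<psi>) = 0"
    using * by auto
qed

lemma cproj_unique:
  assumes "\<phi> \<in> S" "\<And>x. x \<in> S \<Longrightarrow> cinner x (\<psi> - \<phi>) = 0"
  shows "\<phi> = cproj S \<psi>"
proof -
  let ?x = "\<phi> - cproj S \<psi>"
  have x: "?x \<in> S"
    using S assms(1) cproj(1) unfolding closed_csubspace_def by (blast intro: subspace_diff)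
  have "cinner ?x ?x = cinner ?x (\<psi> - cproj S \<psi>) - cinner ?x (\<psi> - \<phi>)"
    by (simp add: cinner_diff_right)
  also have "\<dots> = 0"
    using assms(2)[OF x] cproj(2)[OF x] by simp
  finally show ?thesis by (simp add: cinner_self)
qed

lemma cproj_id: "\<psi> \<in> S \<Longrightarrow> cproj S \<psi> = \<psi>"
  using cproj_unique[of \<psi> \<psi>] by simp

lemma cinner_cproj_right: "x \<in> S \<Longrightarrow> cinner x (cproj S \<psi>) = cinner x \<psi>"
  using cproj(2)[of x \<psi>] by (simp add: cinner_diff_right)

lemma cinner_cproj_left: "x \<in> S \<Longrightarrow> cinner (cproj S \<psi>) x = cinner \<psi> x"
  using cinner_cproj_right[of x \<psi>] cinner_commute[of "cproj S \<psi>" x] cinner_commute[of \<psi> x] by simp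

end

text \<open>Existence and uniqueness of the projection on the abstract side are what give the
  definite description in \<open>proj_onto\<close> its intended value.\<close>

lemma proj_onto_Rep:
  assumes S: "closed_csubspace S"
  shows "proj_onto (Rep_l2 ` S) (Rep_l2 \<psi>) = Rep_l2 (cproj S \<psi>)"
proof -
  have minus: "Rep_l2 \<psi> - Rep_l2 \<phi> = Rep_l2 (\<psi> - \<phi>)" for \<phi>
    by (simp add: minus_l2.rep_eq fun_diff_def)
  have iff: "Rep_l2 \<phi> \<in> Rep_l2 ` S \<and> (\<forall>\<eta>\<in>Rep_l2 ` S. l2inner \<eta> (Rep_l2 \<psi> - Rep_l2 \<phi>) = 0)
      \<longleftrightarrow> \<phi> \<in> S \<and> (\<forall>x\<in>S. cinner x (\<psi> - \<phi>) = 0)" for \<phi>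
    unfolding minus cinner_l2.rep_eq by (auto simp: Rep_l2_inject inj_image_mem_iff)
  show ?thesis
    unfolding proj_onto_def
  proof (rule the_equality)
    show "Rep_l2 (cproj S \<psi>) \<in> Rep_l2 ` S \<and> (\<forall>\<eta>\<in>Rep_l2 ` S. l2inner \<eta> (Rep_l2 \<psi> - Rep_l2 (cproj S \<psi>)) = 0)"
      unfolding iff using cproj[OF S] by blast
    fix \<phi> assume a: "\<phi> \<in> Rep_l2 ` S \<and> (\<forall>\<eta>\<in>Rep_l2 ` S. l2inner \<eta> (Rep_l2 \<psi> - \<phi>) = 0)"
    then obtain \<phi>' where \<phi>': "\<phi> = Rep_l2 \<phi>'" by blast
    show "\<phi> = Rep_l2 (cproj S \<psi>)"
      using a cproj_unique[OF S, of \<phi>' \<psi>] unfolding \<phi>' iff by simp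
  qed
qed

lemma l2lim_Rep: "l2lim (\<lambda>t. Rep_l2 (f t)) (Rep_l2 l) \<longleftrightarrow> f \<longlonglongrightarrow> l"
proof -
  have "l2norm (Rep_l2 (f t) - Rep_l2 l) = norm (f t - l)" for t
    by (simp add: norm_l2.rep_eq minus_l2.rep_eq fun_diff_def)
  then show ?thesis
    using Rep_l2[of l] by (simp add: l2lim_def tendsto_dist_iff[of f] dist_norm)
qed

section \<open>Range and adjoint of the wave operators\<close>

context trace_class_pair
begin

interpretation sw: trace_class_pair U0 U \<alpha> \<beta>
  by (rule swapped)

lemma W_ac_tendsto: "\<psi> \<in> ac_vectors U0 \<Longrightarrow> (\<lambda>t. wave t \<psi>) \<longlonglongrightarrow> W \<psi>"
  unfolding ac_vectors_eq[OF U0] by (rule W_tendsto)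

text \<open>For surjectivity the preimage of \<open>\<phi>\<close> is its reverse wave limit
  \<open>sw.W \<phi>\<close>: the forward waves of that vector converge to
  \<open>W (sw.W \<phi>)\<close> by definition and to \<open>\<phi>\<close> by
  \<open>W_reverse\<close> of the swapped pair.\<close>

lemma W_ac_image: "W ` ac_vectors U0 = ac_vectors U"
proof (intro equalityI subsetI)
  fix x assume "x \<in> W ` ac_vectors U0"
  then show "x \<in> ac_vectors U"
    unfolding ac_vectors_eq[OF U0] ac_vectors_eq[OF U] using W_closure by blast
next
  fix \<phi> assume "\<phi> \<in> ac_vectors U"
  then have \<phi>: "\<phi> \<in> closure (bessel_vectors U)" by (simp add: ac_vectors_eq[OF U])
  have "sw.W \<phi> \<in> closure (bessel_vectors U0)"
    by (rule sw.W_closure[OF \<phi>])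
  moreover have "W (sw.W \<phi>) = \<phi>"
    by (rule LIMSEQ_unique[OF W_tendsto sw.W_reverse[OF \<phi>]]) fact
  ultimately show "\<phi> \<in> W ` ac_vectors U0"
    unfolding ac_vectors_eq[OF U0] by force
qed

text \<open>At every finite time the forward and the reverse wave are exact adjoints, and both sides
  converge.\<close>

lemma W_adjoint:
  assumes "\<psi> \<in> ac_vectors U0" "\<phi> \<in> ac_vectors U"
  shows "cinner (W \<psi>) \<phi> = cinner \<psi> (trace_class_pair.W U0 U \<phi>)"
proof (rule LIMSEQ_unique)
  show "(\<lambda>t. cinner (wave t \<psi>) \<phi>) \<longlonglongrightarrow> cinner (W \<psi>) \<phi>"
    by (intro tendsto_cinner W_ac_tendsto assms tendsto_const)
  have "(\<lambda>t. cinner \<psi> (sw.wave t \<phi>)) \<longlonglongrightarrow> cinner \<psi> (sw.W \<phi>)"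
    by (intro tendsto_cinner trace_class_pair.W_ac_tendsto[OF swapped] assms tendsto_const)
  moreover have "cinner (wave t \<psi>) \<phi> = cinner \<psi> (sw.wave t \<phi>)" for t
  proof -
    have "cinner (wave t \<psi>) \<phi> = cinner ((U0 ^^ t) \<psi>) ((U ^^ t) \<phi>)"
      by (rule unitary_cinner_inv_funpow[OF U, symmetric])
    also have "\<dots> = cinner ((U0 ^^ t) \<psi>) ((U0 ^^ t) (sw.wave t \<phi>))"
      by (simp add: unitary_funpow_inv[OF U0])
    also have "\<dots> = cinner \<psi> (sw.wave t \<phi>)"
      by (rule unitary_cinner_funpow[OF U0])
    finally show ?thesis .
  qed
  ultimately show "(\<lambda>t. cinner (wave t \<psi>) \<phi>) \<longlonglongrightarrow> cinner \<psi> (sw.W \<phi>)"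
    by simp
qed

lemma W_ac_norm: "\<psi> \<in> ac_vectors U0 \<Longrightarrow> norm (W \<psi>) = norm \<psi>"
  unfolding ac_vectors_eq[OF U0] by (rule W_norm)

end

theorem theorem2p2:
  fixes C :: "int \<Rightarrow> complex^2^2" and C0 :: "complex^2^2"
  assumes "\<forall>x. unitary2 (C x)" and "unitary2 C0"
    and "\<exists>c1>0. \<exists>\<epsilon>>0. \<forall>x::int. x \<noteq> 0 \<longrightarrow>
           onorm (\<lambda>v. (C x - C0) *v v) \<le> c1 * \<bar>real_of_int x\<bar> powr (-1 - \<epsilon>)"
  shows "\<exists>W W'.
     (\<forall>\<psi>\<in>ell2. l2lim (\<lambda>t. (qw_inv C ^^ t) ((qw (\<lambda>_. C0) ^^ t)
                    (proj_onto (ac_subspace (qw (\<lambda>_. C0))) \<psi>))) (W \<psi>)) \<and>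
     (\<forall>\<psi>\<in>ell2. l2lim (\<lambda>t. (qw_inv (\<lambda>_. C0) ^^ t) ((qw C ^^ t)
                    (proj_onto (ac_subspace (qw C)) \<psi>))) (W' \<psi>)) \<and>
     (\<forall>\<phi>\<in>ell2. \<forall>\<psi>\<in>ell2. l2inner (W \<phi>) \<psi> = l2inner \<phi> (W' \<psi>)) \<and>
     W ` ac_subspace (qw (\<lambda>_. C0)) = ac_subspace (qw C) \<and>
     (\<forall>\<psi>\<in>ac_subspace (qw (\<lambda>_. C0)). l2norm (W \<psi>) = l2norm \<psi>)"
proof -
  let ?V = "walk C" and ?Vf = "walk (\<lambda>_. C0)"
  let ?d = "\<lambda>x. onorm (\<lambda>v. (C x - C0) *v v)"
  have C0: "\<forall>x::int. unitary2 C0" using assms(2) by simp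
  note C = assms(1)
  interpret p: trace_class_pair ?V ?Vf "\<lambda>u. site_weight ?d (inv (walk (\<lambda>_. mat 1)) u)" "site_weight ?d"
    by (rule walk_trace_class_pair[of C C0, OF assms])
  interpret q: trace_class_pair ?Vf ?V "\<lambda>u. site_weight ?d (inv (walk (\<lambda>_. mat 1)) u)" "site_weight ?d"
    by (rule p.swapped)
  let ?A = "ac_vectors ?V" and ?B = "ac_vectors ?Vf"
  note A = closed_csubspace_ac_vectors[OF p.U] and A0 = closed_csubspace_ac_vectors[OF p.U0]
  \<comment> \<open>The projection is built in, so that on every square summable state the operator
    is the strong limit itself.\<close>
  define W where "W \<psi> = Rep_l2 (p.W (cproj ?B (Abs_l2 \<psi>)))" for \<psi>
  define W' where "W' \<psi> = Rep_l2 (q.W (cproj ?A (Abs_l2 \<psi>)))" for \<psi>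
  have W_Rep: "W (Rep_l2 v) = Rep_l2 (p.W (cproj ?B v))" and W'_Rep: "W' (Rep_l2 v) = Rep_l2 (q.W (cproj ?A v))" for v
    by (simp_all add: W_def W'_def Rep_l2_inverse)
  have ell2_cases: "\<exists>v. \<psi> = Rep_l2 v" if "\<psi> \<in> ell2" for \<psi>
    using Abs_l2_inverse[OF that] by metis
  show ?thesis
  proof (rule exI[of _ W], rule exI[of _ W'], intro conjI ballI)
    fix \<psi> assume "\<psi> \<in> ell2"
    then obtain v where v: "\<psi> = Rep_l2 v" using ell2_cases by blast
    show "l2lim (\<lambda>t. (qw_inv C ^^ t) ((qw (\<lambda>_. C0) ^^ t) (proj_onto (ac_subspace (qw (\<lambda>_. C0))) \<psi>))) (W \<psi>)"
      unfolding v W_Rep ac_subspace_walk[OF C0] proj_onto_Rep[OF A0] Rep_walk_funpow[OF C0, symmetric]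
        Rep_inv_walk_funpow[OF C, symmetric] l2lim_Rep
      by (rule p.W_ac_tendsto[OF cproj(1)[OF A0]])
    show "l2lim (\<lambda>t. (qw_inv (\<lambda>_. C0) ^^ t) ((qw C ^^ t) (proj_onto (ac_subspace (qw C)) \<psi>))) (W' \<psi>)"
      unfolding v W'_Rep ac_subspace_walk[OF C] proj_onto_Rep[OF A] Rep_walk_funpow[OF C, symmetric]
        Rep_inv_walk_funpow[OF C0, symmetric] l2lim_Rep
      by (rule q.W_ac_tendsto[OF cproj(1)[OF A]])
  next
    fix \<phi> \<psi> assume "\<phi> \<in> ell2" "\<psi> \<in> ell2"
    then obtain u v where uv: "\<phi> = Rep_l2 u" "\<psi> = Rep_l2 v" using ell2_cases by blast
    let ?u = "cproj ?B u" and ?v = "cproj ?A v"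
    have u: "?u \<in> ?B" and v: "?v \<in> ?A" by (rule cproj(1)[OF A0], rule cproj(1)[OF A])
    have Wu: "p.W ?u \<in> ?A" and Wv: "q.W ?v \<in> ?B"
      using p.W_ac_image q.W_ac_image u v by blast+
    \<comment> \<open>The projections can be inserted and dropped because each wave limit lies in
      the absolutely continuous subspace onto which the other argument is projected.\<close>
    have "cinner (p.W ?u) v = cinner (p.W ?u) ?v"
      by (rule cinner_cproj_right[OF A Wu, symmetric])
    also have "\<dots> = cinner ?u (q.W ?v)"
      by (rule p.W_adjoint[OF u v])
    also have "\<dots> = cinner u (q.W ?v)"
      by (rule cinner_cproj_left[OF A0 Wv])
    finally show "l2inner (W \<phi>) \<psi> = l2inner \<phi> (W' \<psi>)"
      by (simp add: uv W_Rep W'_Rep cinner_l2.rep_eq)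
  next
    have W_ac: "W (Rep_l2 v) = Rep_l2 (p.W v)" if "v \<in> ?B" for v
      using that by (simp add: W_Rep cproj_id[OF A0])
    show "W ` ac_subspace (qw (\<lambda>_. C0)) = ac_subspace (qw C)"
      unfolding ac_subspace_walk[OF C0] ac_subspace_walk[OF C] p.W_ac_image[symmetric]
      using W_ac by (force simp: image_image)
    fix \<psi> assume "\<psi> \<in> ac_subspace (qw (\<lambda>_. C0))"
    then obtain v where v: "\<psi> = Rep_l2 v" "v \<in> ?B"
      unfolding ac_subspace_walk[OF C0] by blast
    show "l2norm (W \<psi>) = l2norm \<psi>"
      using p.W_ac_norm[OF v(2)] by (simp add: v(1) W_ac[OF v(2)] norm_l2.rep_eq)
  qed
qed

end
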